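(* Let $\epsilon\in(0,1/2)$ be a fixed small constant. In a single pass, one can process a dynamic stream of edge insertions and deletions on an $n$-node graph $G$ using $\tilde{O}(n)$ space, and with high probability return, at the end of the stream, a $(2+O(\epsilon))$-approximation of the maximum density $d^* = \max_{S \subseteq V} \rho(S)$ of the final graph.
   Context: $G=(V,E)$ is an unweighted undirected graph on a fixed node set $V$ with $|V|=n$, starting empty; the stream consists of insertions of new edges and deletions of existing edges. For nonempty $S\subseteq V$, $\rho(S)=|E(S)|/|S|$ where $E(S)$ is the set of edges with both endpoints in $S$. A value $\eta$ is a $\gamma$-approximation of $d^*$ if $d^*/\gamma\le \eta\le d^*$. $\tilde O(\cdot)$ hides $\mathrm{poly}(\log n,1/\epsilon)$ factors; "with high probability" means with probability at least $1-1/\mathrm{poly}(n)$. *)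

theory Defs
  imports "HOL-Probability.Probability" "HOL-Library.Log_Nat"
begin

section \<open>Dynamic graph streams and maximum density\<close>

datatype edge_update = Insert nat nat | Delete nat nat

text \<open>The nodes are \<open>{..<n}\<close> and an edge is a two-element set of nodes. The endpoints of an
  update may arrive in either order.\<close>

fun valid_stream :: "nat \<Rightarrow> nat set set \<Rightarrow> edge_update list \<Rightarrow> bool" where
  "valid_stream n E [] = True"
| "valid_stream n E (Insert u v # us) =
     (u < n \<and> v < n \<and> u \<noteq> v \<and> {u, v} \<notin> E \<and> valid_stream n (insert {u, v} E) us)"
| "valid_stream n E (Delete u v # us) = ({u, v} \<in> E \<and> valid_stream n (E - {{u, v}}) us)"

fun apply_update :: "edge_update \<Rightarrow> nat set set \<Rightarrow> nat set set" where
  "apply_update (Insert u v) E = insert {u, v} E"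
| "apply_update (Delete u v) E = E - {{u, v}}"

definition final_graph :: "edge_update list \<Rightarrow> nat set set" where
  "final_graph us = fold apply_update us {}"

definition induced_edges :: "nat set set \<Rightarrow> nat set \<Rightarrow> nat set set" where
  "induced_edges E S = {e \<in> E. e \<subseteq> S}"

definition density :: "nat set set \<Rightarrow> nat set \<Rightarrow> real" where
  "density E S = real (card (induced_edges E S)) / real (card S)"

definition max_density :: "nat \<Rightarrow> nat set set \<Rightarrow> real" where
  "max_density n E = Max (density E ` {S. S \<subseteq> {..<n} \<and> S \<noteq> {}})"

definition is_approximation :: "real \<Rightarrow> real \<Rightarrow> real \<Rightarrow> bool" where
  "is_approximation \<gamma> d \<eta> \<longleftrightarrow> d / \<gamma> \<le> \<eta> \<and> \<eta> \<le> d"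


section \<open>Randomized programs with space accounting\<close>

text \<open>
  A streaming algorithm is given by while-programs over finitely many registers. A register holds a
  natural number of any size and is charged the length of its binary representation. All operators
  on numbers are computable in space linear in the lengths of the operands and of the result, so up
  to a constant factor the measure below is the number of bits of working memory. The program text
  is a constant that does not depend on the number of nodes.
\<close>

type_synonym store = "string \<Rightarrow> nat"

datatype binop = Plus | Minus | Times | Div | Mod | Power | Less | Equal

fun binop_val :: "binop \<Rightarrow> nat \<Rightarrow> nat \<Rightarrow> nat" where
  "binop_val Plus a b = a + b"
| "binop_val Minus a b = a - b"
| "binop_val Times a b = a * b"
| "binop_val Div a b = a div b"
| "binop_val Mod a b = a mod b"
| "binop_val Power a b = a ^ b"
| "binop_val Less a b = of_bool (a < b)"
| "binop_val Equal a b = of_bool (a = b)"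

datatype aexp = Num nat | Reg string | Bin binop aexp aexp

primrec aval :: "aexp \<Rightarrow> store \<Rightarrow> nat" where
  "aval (Num k) s = k"
| "aval (Reg x) s = s x"
| "aval (Bin f e1 e2) s = binop_val f (aval e1 s) (aval e2 s)"

definition bit_length :: "nat \<Rightarrow> nat" where
  "bit_length k = max 1 (floorlog 2 k)"

text \<open>The values of all subexpressions are charged, so that no large intermediate result is free.\<close>

primrec aexp_space :: "aexp \<Rightarrow> store \<Rightarrow> nat" where
  "aexp_space (Num k) s = bit_length k"
| "aexp_space (Reg x) s = bit_length (s x)"
| "aexp_space (Bin f e1 e2) s =
     aexp_space e1 s + aexp_space e2 s + bit_length (binop_val f (aval e1 s) (aval e2 s))"

datatype com =
    Skip
  | Assign string aexp
  | Flip string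
  | Seq com com
  | If aexp com com
  | While aexp com

primrec aexp_regs :: "aexp \<Rightarrow> string set" where
  "aexp_regs (Num k) = {}"
| "aexp_regs (Reg x) = {x}"
| "aexp_regs (Bin f e1 e2) = aexp_regs e1 \<union> aexp_regs e2"

primrec com_regs :: "com \<Rightarrow> string set" where
  "com_regs Skip = {}"
| "com_regs (Assign x e) = insert x (aexp_regs e)"
| "com_regs (Flip x) = {x}"
| "com_regs (Seq c d) = com_regs c \<union> com_regs d"
| "com_regs (If e c d) = aexp_regs e \<union> com_regs c \<union> com_regs d"
| "com_regs (While e c) = aexp_regs e \<union> com_regs c"

text \<open>A configuration consists of the current store and the peak space usage so far. The set \<open>X\<close>
  contains the registers that are charged.\<close>

type_synonym config = "store \<times> nat"

definition charge :: "string set \<Rightarrow> nat \<Rightarrow> config \<Rightarrow> config" where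
  "charge X k z = (fst z, max (snd z) ((\<Sum>x\<in>X. bit_length (fst z x)) + k))"

definition set_reg :: "string \<Rightarrow> nat \<Rightarrow> config \<Rightarrow> config" where
  "set_reg x k z = ((fst z)(x := k), snd z)"

text \<open>A guard holds if its value is nonzero. Nontermination shows up as missing probability mass.\<close>

partial_function (spmf) while_spmf ::
  "string set \<Rightarrow> aexp \<Rightarrow> (config \<Rightarrow> config spmf) \<Rightarrow> config \<Rightarrow> config spmf" where
  "while_spmf X e body z =
     (let z' = charge X (aexp_space e (fst z)) z in
      if aval e (fst z) \<noteq> 0 then bind_spmf (body z') (while_spmf X e body)
      else return_spmf z')"

primrec exec :: "string set \<Rightarrow> com \<Rightarrow> config \<Rightarrow> config spmf" where
  "exec X Skip z = return_spmf z"
| "exec X (Assign x e) z =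
     return_spmf (charge X 0
       (set_reg x (aval e (fst z)) (charge X (aexp_space e (fst z)) z)))"
| "exec X (Flip x) z =
     map_spmf (\<lambda>b. charge X 0 (set_reg x (of_bool b) z)) coin_spmf"
| "exec X (Seq c d) z = bind_spmf (exec X c z) (exec X d)"
| "exec X (If e c d) z =
     (let z' = charge X (aexp_space e (fst z)) z in
      if aval e (fst z) \<noteq> 0 then exec X c z' else exec X d z')"
| "exec X (While e c) z = while_spmf X e (exec X c) z"


section \<open>One-pass streaming algorithms\<close>

text \<open>The first program runs before the stream starts, with the number of nodes in register
  \<open>n\<close>; the second one runs once for each stream element, whose registers are overwritten by
  the next element; the third one runs after the end of the stream and leaves the answer in
  the registers \<open>num\<close> and \<open>den\<close>, as the numerator and the denominator of a rational number.\<close>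

record stream_alg =
  init_prog :: com
  update_prog :: com
  output_prog :: com

definition alg_regs :: "stream_alg \<Rightarrow> string set" where
  "alg_regs A = {''n'', ''op'', ''u'', ''v'', ''num'', ''den''} \<union>
     com_regs (init_prog A) \<union> com_regs (update_prog A) \<union> com_regs (output_prog A)"

text \<open>The register \<open>op\<close> is 1 for an insertion and 0 for a deletion.\<close>

fun load_update :: "edge_update \<Rightarrow> config \<Rightarrow> config" where
  "load_update (Insert u v) z = set_reg ''op'' 1 (set_reg ''u'' u (set_reg ''v'' v z))"
| "load_update (Delete u v) z = set_reg ''op'' 0 (set_reg ''u'' u (set_reg ''v'' v z))"

primrec process_stream :: "stream_alg \<Rightarrow> edge_update list \<Rightarrow> config \<Rightarrow> config spmf" where
  "process_stream A [] z = return_spmf z"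
| "process_stream A (a # us) z =
     bind_spmf (exec (alg_regs A) (update_prog A) (charge (alg_regs A) 0 (load_update a z)))
       (process_stream A us)"

definition start_config :: "stream_alg \<Rightarrow> nat \<Rightarrow> config" where
  "start_config A n = charge (alg_regs A) 0 (set_reg ''n'' n (\<lambda>_. 0, 0))"

definition run :: "stream_alg \<Rightarrow> nat \<Rightarrow> edge_update list \<Rightarrow> config spmf" where
  "run A n us =
     bind_spmf (exec (alg_regs A) (init_prog A) (start_config A n)) (\<lambda>z.
     bind_spmf (process_stream A us z) (exec (alg_regs A) (output_prog A)))"

definition peak_space :: "config \<Rightarrow> nat" where
  "peak_space z = snd z"

definition answer :: "config \<Rightarrow> real" where
  "answer z = real (fst z ''num'') / real (fst z ''den'')"

end

theory Submission
  imports Defs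
begin

text \<open>
  A factor of exactly 2 suffices, so constant accuracy is enough and the algorithm does not depend on
  \<open>\<epsilon>\<close>. Edges are sampled by a random polynomial of degree \<open>O(n polylog n)\<close> over a prime field, whose coefficients
  fit into the space bound, at all rates \<open>2 ^ i / q\<close> up to scaling. The sampled hash values are grouped into
  \<open>O(n polylog n)\<close> cells, each with a linear counter, and an edge that is alone in its cell can be read off. At the
  end the rate is chosen from the number \<open>m\<close> of edges such that most of the sampled edges are alone
  and \<open>p * d \<ge> m * p / n\<close> is at least a constant times \<open>log n\<close>. Then, by high independence and a
  union bound over all \<open>S\<close>, with high probability no \<open>S\<close> has more than \<open>4 / 3 * p * d * card S\<close> sampled
  edges. Since the expected number of recovered edges in a densest \<open>S\<close> is at least
  \<open>7 / 8 * p * d * card S\<close>, this upper bound forces at least \<open>2 / 3 * p * d * card S\<close> of them with constant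
  probability, and the maximum over \<open>O(log n)\<close> repetitions has density between \<open>2 / 3 * p * d\<close> and
  \<open>4 / 3 * p * d\<close> with high probability. Time is not restricted, so the maximum over all \<open>S\<close> is found by
  exhaustive search.
\<close>


section \<open>Space-bounded evaluation of programs\<close>

text \<open>The edge count, and with it the right rate, is known only at the end because deletions
  may undo almost everything; so all levels are sketched at once, and linearity makes the sketch a
  function of the current graph alone. A union bound over \<open>2 ^ n\<close> vertex sets needs
  failure probabilities that decay like \<open>x ^ card S\<close>, and the moment method then asks
  for independence of order \<open>k * card S\<close> with \<open>k = O(log n)\<close>. This forces
  seeds with about \<open>n * log n\<close> coefficients, affordable only if each has
  \<open>O(log n)\<close> bits. So the program has to find a prime that is polynomial in
  \<open>n\<close>, which needs a bound on how far away the next prime can be. Seeds correspond one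
  to one to value vectors at any \<open>t\<close> points, so probabilities can be handled as
  cardinalities of sets of seeds. Coins are flipped in a single loop at the start; afterwards the
  run is a function of the number drawn, and space is controlled by bounding the values of the
  registers.\<close>

lemma bit_length_le: "0 < w \<Longrightarrow> k < 2 ^ w \<Longrightarrow> bit_length k \<le> w"
  unfolding bit_length_def by (auto intro: floorlog_leI)

primrec power_free :: "aexp \<Rightarrow> bool" where
  "power_free (Num k) = True"
| "power_free (Reg x) = True"
| "power_free (Bin f e1 e2) = (f \<noteq> Power \<and> power_free e1 \<and> power_free e2)"

text \<open>Without exponentiation, the length of the value of an expression is linear in the register length.
  A power may only be assigned directly, so that its length is the length of a register.\<close>

primrec power_free_below :: "aexp \<Rightarrow> bool" where
  "power_free_below (Num k) = True"
| "power_free_below (Reg x) = True"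
| "power_free_below (Bin f e1 e2) = (power_free e1 \<and> power_free e2)"

text \<open>Factor by which the length of a value may exceed the register length;
  \<open>k + 1\<close> for a constant is crude but enough, because \<open>k < 2 ^ k\<close> and the
  program text is fixed.\<close>

primrec value_weight :: "aexp \<Rightarrow> nat" where
  "value_weight (Num k) = k + 1"
| "value_weight (Reg x) = 1"
| "value_weight (Bin f e1 e2) = value_weight e1 + value_weight e2"

primrec space_weight :: "aexp \<Rightarrow> nat" where
  "space_weight (Num k) = k + 1"
| "space_weight (Reg x) = 1"
| "space_weight (Bin f e1 e2) = space_weight e1 + space_weight e2 + value_weight e1 + value_weight e2"

primrec com_ok :: "com \<Rightarrow> bool" where
  "com_ok Skip = True"
| "com_ok (Assign x e) = power_free_below e"
| "com_ok (Flip x) = True"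
| "com_ok (Seq c d) = (com_ok c \<and> com_ok d)"
| "com_ok (If e c d) = (power_free e \<and> com_ok c \<and> com_ok d)"
| "com_ok (While e c) = (power_free e \<and> com_ok c)"

primrec com_weight :: "com \<Rightarrow> nat" where
  "com_weight Skip = 0"
| "com_weight (Assign x e) = space_weight e"
| "com_weight (Flip x) = 0"
| "com_weight (Seq c d) = com_weight c + com_weight d"
| "com_weight (If e c d) = space_weight e + com_weight c + com_weight d"
| "com_weight (While e c) = space_weight e + com_weight c"

lemma value_weight_pos: "0 < value_weight e"
  by (induction e) auto

lemma binop_val_less:
  assumes "f \<noteq> Power" "a < 2 ^ v" "b < 2 ^ w" "0 < v" "0 < w"
  shows "binop_val f a b < 2 ^ (v + w)"
proof -
  have v: "(2::nat) ^ v \<le> 2 ^ (v + w)" by (rule power_increasing) auto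
  have 1: "1 < (2::nat) ^ (v + w)" using assms by (intro one_less_power) auto
  have s: "a + b < 2 ^ (v + w)"
  proof -
    \<comment> \<open>Both powers are at least 2, and \<open>x + y \<le> x * y\<close> holds for
      such numbers, so sums need no more room than products.\<close>
    have "(2::nat) ^ v + 2 ^ w \<le> 2 ^ v * 2 ^ w"
    proof -
      obtain x y :: nat where "2 ^ v = x + 2" "2 ^ w = y + 2"
        using assms(4,5) by (metis add.commute le_Suc_ex self_le_power one_le_numeral power_one_right power_increasing Suc_leI One_nat_def)
      then show ?thesis by (simp add: algebra_simps)
    qed
    then show ?thesis using assms by (simp add: power_add)
  qed
  have t: "a * b < 2 ^ (v + w)"
    using assms mult_strict_mono'[of a "2^v" b "2^w"] by (simp add: power_add)
  have d: "a div b < 2 ^ (v + w)" "a mod b < 2 ^ (v + w)" "a - b < 2 ^ (v + w)"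
    using assms(2) v by (meson div_le_dividend mod_less_eq_dividend diff_le_self le_less_trans less_le_trans)+
  show ?thesis
    using assms(1,2) v 1 s t d by (cases f) auto
qed

lemma aval_less:
  assumes "power_free e" "\<forall>x\<in>aexp_regs e. s x < 2 ^ l" "0 < l"
  shows "aval e s < 2 ^ (value_weight e * l)"
  using assms
proof (induction e)
  case (Num k)
  have "k < 2 ^ k" by simp
  also have "k * 1 \<le> (k + 1) * l" using Num by (intro mult_mono) auto
  then have "(2::nat) ^ k \<le> 2 ^ ((k + 1) * l)" by (intro power_increasing) auto
  finally show ?case by simp
next
  case (Reg x) then show ?case by simp
next
  case (Bin f a b)
  then show ?case
    using binop_val_less[of f "aval a s" "value_weight a * l" "aval b s" "value_weight b * l"]
    by (auto simp: value_weight_pos algebra_simps)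
qed

lemma aexp_space_le:
  assumes "power_free e" "\<forall>x\<in>aexp_regs e. s x < 2 ^ l" "0 < l"
  shows "aexp_space e s \<le> space_weight e * l"
  using assms
proof (induction e)
  case (Num k)
  have "bit_length (aval (Num k) s) \<le> value_weight (Num k) * l"
    by (rule bit_length_le, use Num in simp, rule aval_less) (use Num in auto)
  then show ?case by simp
next
  case (Reg x) then show ?case by (simp add: bit_length_le)
next
  case (Bin f a b)
  have "bit_length (aval (Bin f a b) s) \<le> value_weight (Bin f a b) * l"
    by (rule bit_length_le, use Bin value_weight_pos in simp, rule aval_less) (use Bin in auto)
  then show ?case using Bin by (auto simp: algebra_simps)
qed

text \<open>Only the operands are estimated by weights. The result of the outermost operator,
  possibly a power, is as long as the register that receives it, which is the assumption on
  \<open>aval e s\<close>.\<close>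

lemma aexp_space_below_le:
  assumes "power_free_below e" "\<forall>x\<in>aexp_regs e. s x < 2 ^ l" "0 < l" "aval e s < 2 ^ l"
  shows "aexp_space e s \<le> space_weight e * l"
proof (cases e)
  case (Bin f a b)
  have "aexp_space a s \<le> space_weight a * l" "aexp_space b s \<le> space_weight b * l"
    using assms Bin by (auto intro!: aexp_space_le)
  moreover have "bit_length (aval e s) \<le> l" using assms bit_length_le by blast
  moreover have "l \<le> value_weight a * l" using mult_le_mono1[of 1 "value_weight a" l] value_weight_pos[of a] by simp
  ultimately show ?thesis unfolding Bin aexp_space.simps space_weight.simps add_mult_distrib aval.simps
    by linarith
qed (use assms aexp_space_le[of e s l] in auto)

lemma weight_mult_le: "k \<le> w * l \<Longrightarrow> w \<le> M \<Longrightarrow> k \<le> M * (l::nat)"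
  by (meson le_trans mult_le_mono1)

text \<open>There is no rule for coin flips: big steps are used only for the deterministic parts of a program.
  All assigned values are required to lie below \<open>U\<close>.\<close>

inductive big_step :: "nat \<Rightarrow> com \<Rightarrow> store \<Rightarrow> store \<Rightarrow> bool" for U where
  Skip: "big_step U Skip s s"
| Assign: "aval e s < U \<Longrightarrow> big_step U (Assign x e) s (s(x := aval e s))"
| Seq: "big_step U c s s' \<Longrightarrow> big_step U d s' s'' \<Longrightarrow> big_step U (Seq c d) s s''"
| IfTrue: "aval e s \<noteq> 0 \<Longrightarrow> big_step U c s s' \<Longrightarrow> big_step U (If e c d) s s'"
| IfFalse: "aval e s = 0 \<Longrightarrow> big_step U d s s' \<Longrightarrow> big_step U (If e c d) s s'"
| WhileFalse: "aval e s = 0 \<Longrightarrow> big_step U (While e c) s s"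
| WhileTrue: "aval e s \<noteq> 0 \<Longrightarrow> big_step U c s s' \<Longrightarrow> big_step U (While e c) s' s'' \<Longrightarrow>
    big_step U (While e c) s s''"

section \<open>From bounds on register values to bounds on space\<close>

definition bounded_on :: "string set \<Rightarrow> nat \<Rightarrow> store \<Rightarrow> bool" where
  "bounded_on X l s \<longleftrightarrow> (\<forall>x\<in>X. s x < 2 ^ l)"

text \<open>\<open>card X\<close> registers of length \<open>l\<close>, plus \<open>M * l\<close>
  for the expression being evaluated; \<open>card X\<close> and \<open>M\<close> are constants of
  the program text.\<close>

definition space_bound :: "string set \<Rightarrow> nat \<Rightarrow> nat \<Rightarrow> nat" where
  "space_bound X M l = (card X + M) * l"

lemma charge_le:
  assumes "bounded_on X l s" "finite X" "0 < l" "k \<le> M * l" "m \<le> space_bound X M l"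
  shows "\<exists>m'\<le>space_bound X M l. charge X k (s, m) = (s, m')"
proof -
  have "(\<Sum>x\<in>X. bit_length (s x)) \<le> (\<Sum>x\<in>X. l)"
    using assms(1,3) by (intro sum_mono bit_length_le) (auto simp: bounded_on_def)
  then show ?thesis using assms by (simp add: charge_def space_bound_def algebra_simps)
qed

lemma charge_exp:
  assumes "bounded_on X l s" "finite X" "0 < l" "m \<le> space_bound X M l"
    and "power_free e \<or> power_free_below e \<and> aval e s < 2 ^ l" "aexp_regs e \<subseteq> X" "space_weight e \<le> M"
  shows "\<exists>m'\<le>space_bound X M l. charge X (aexp_space e s) (s, m) = (s, m')"
proof -
  have "\<forall>x\<in>aexp_regs e. s x < 2 ^ l" using assms(1,6) by (auto simp: bounded_on_def)
  then have "aexp_space e s \<le> space_weight e * l"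
    using assms(3,5) aexp_space_le[of e s l] aexp_space_below_le[of e s l] by blast
  then have "aexp_space e s \<le> M * l" using assms(7) by (rule weight_mult_le)
  then show ?thesis using assms(4) by (rule charge_le[OF assms(1-3)])
qed

text \<open>Reduces the space analysis to bounding values: a derivation of
  \<open>big_step (2 ^ l)\<close> certifies that every assigned value has at most \<open>l\<close>
  bits, and the syntactic weights bound what evaluation adds. The bound does not grow with the
  number of steps, since peak space is a maximum over them.\<close>

lemma exec_big_step:
  assumes "big_step (2 ^ l) c s s'" "com_ok c" "com_regs c \<subseteq> X" "com_weight c \<le> M"
    "bounded_on X l s" "finite X" "0 < l" "m \<le> space_bound X M l"
  shows "bounded_on X l s' \<and>
    (\<exists>m'\<le>space_bound X M l. exec X c (s, m) = return_spmf (s', m'))"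
  using assms
proof (induction arbitrary: m rule: big_step.induct)
  case (Skip s) then show ?case by auto
next
  case (Assign e s x)
  from charge_exp[of X l s m M e] Assign obtain m1 where 1: "m1 \<le> space_bound X M l" "charge X (aexp_space e s) (s, m) = (s, m1)"
    by auto
  have b: "bounded_on X l (s(x := aval e s))" using Assign by (auto simp: bounded_on_def)
  from charge_le[OF b, of 0 M m1] 1 Assign.prems
  obtain m2 where "m2 \<le> space_bound X M l" "charge X 0 (s(x := aval e s), m1) = (s(x := aval e s), m2)"
    by auto
  then show ?case using 1 b by (auto simp: set_reg_def simp del: fun_upd_apply)
next
  case (Seq c s s' d s'')
  have "com_ok c" "com_ok d" "com_regs c \<subseteq> X" "com_regs d \<subseteq> X" "com_weight c \<le> M" "com_weight d \<le> M"
    using Seq.prems by auto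
  note p = this
  from Seq.IH(1)[OF p(1,3,5) Seq.prems(4-7)] obtain m1 where
    1: "bounded_on X l s'" "m1 \<le> space_bound X M l" "exec X c (s, m) = return_spmf (s', m1)" by auto
  from Seq.IH(2)[OF p(2,4,6) 1(1) Seq.prems(5-6) 1(2)] 1 show ?case by auto
next
  case (IfTrue e s c s' d)
  have p: "com_ok c" "com_regs c \<subseteq> X" "com_weight c \<le> M" using IfTrue.prems by auto
  from charge_exp[of X l s m M e] IfTrue obtain m1 where 1: "m1 \<le> space_bound X M l" "charge X (aexp_space e s) (s, m) = (s, m1)"
    by auto
  from IfTrue.IH[OF p IfTrue.prems(4-6) 1(1)] show ?case using 1 IfTrue.hyps by auto
next
  case (IfFalse e s d s' c)
  have p: "com_ok d" "com_regs d \<subseteq> X" "com_weight d \<le> M" using IfFalse.prems by auto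
  from charge_exp[of X l s m M e] IfFalse obtain m1 where 1: "m1 \<le> space_bound X M l" "charge X (aexp_space e s) (s, m) = (s, m1)"
    by auto
  from IfFalse.IH[OF p IfFalse.prems(4-6) 1(1)] show ?case using 1 IfFalse.hyps by auto
next
  case (WhileFalse e s c)
  from charge_exp[of X l s m M e] WhileFalse obtain m1 where 1: "m1 \<le> space_bound X M l" "charge X (aexp_space e s) (s, m) = (s, m1)"
    by auto
  then show ?case using WhileFalse by (subst exec.simps, subst while_spmf.simps) auto
next
  case (WhileTrue e s c s' s'')
  have p: "com_ok c" "com_regs c \<subseteq> X" "com_weight c \<le> M" using WhileTrue.prems by auto
  from charge_exp[of X l s m M e] WhileTrue obtain m1 where 1: "m1 \<le> space_bound X M l" "charge X (aexp_space e s) (s, m) = (s, m1)"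
    by auto
  from WhileTrue.IH(1)[OF p WhileTrue.prems(4-6) 1(1)] obtain m2 where
    2: "bounded_on X l s'" "m2 \<le> space_bound X M l" "exec X c (s, m1) = return_spmf (s', m2)" by auto
  from WhileTrue.IH(2)[OF WhileTrue.prems(1-3) 2(1) WhileTrue.prems(5,6) 2(2)] 
  show ?case using 1 2 WhileTrue.hyps by (subst exec.simps, subst while_spmf.simps) auto
qed

text \<open>Total correctness: termination and the bound \<open>U\<close> on all assigned values are
  part of the claim. The existential form is adequate because programs without coin flips are
  deterministic.\<close>

definition wp :: "nat \<Rightarrow> com \<Rightarrow> (store \<Rightarrow> bool) \<Rightarrow> store \<Rightarrow> bool" where
  "wp U c Q s \<longleftrightarrow> (\<exists>s'. big_step U c s s' \<and> Q s')"

lemma wp_Seq: "wp U c (wp U d Q) s \<Longrightarrow> wp U (Seq c d) Q s"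
  by (auto simp: wp_def intro: big_step.intros)

lemma wp_If:
  "(aval e s \<noteq> 0 \<Longrightarrow> wp U c Q s) \<Longrightarrow> (aval e s = 0 \<Longrightarrow> wp U d Q s) \<Longrightarrow> wp U (If e c d) Q s"
  by (cases "aval e s = 0") (auto simp: wp_def intro: big_step.intros)

lemma wp_conseq: "wp U c Q s \<Longrightarrow> (\<And>s. Q s \<Longrightarrow> Q' s) \<Longrightarrow> wp U c Q' s"
  by (auto simp: wp_def)

lemma wp_While_measure:
  fixes f :: "store \<Rightarrow> 'a::wellorder"
  assumes "I s" and "\<And>s. I s \<Longrightarrow> aval e s \<noteq> 0 \<Longrightarrow> wp U c (\<lambda>s'. I s' \<and> f s' < f s) s"
    and "\<And>s. I s \<Longrightarrow> aval e s = 0 \<Longrightarrow> Q s"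
  shows "wp U (While e c) Q s"
  using assms(1)
proof (induction "f s" arbitrary: s rule: less_induct)
  case less
  show ?case
  proof (cases "aval e s = 0")
    case True
    then show ?thesis using assms(3) less.prems by (auto simp: wp_def intro: big_step.intros)
  next
    case False
    from assms(2)[OF less.prems False] obtain s' where
      s': "big_step U c s s'" "I s'" "f s' < f s" by (auto simp: wp_def)
    from less.hyps[OF s'(3,2)] show ?thesis
      using False s'(1) by (auto simp: wp_def intro: big_step.intros)
  qed
qed

text \<open>For loops whose number of iterations is known beforehand; the index of \<open>I\<close>
  replaces a variant. Only the search for a prime needs the rule with a measure.\<close>

lemma wp_While_count:
  fixes N :: nat
  assumes "I 0 s" and "\<And>j s. j < N \<Longrightarrow> I j s \<Longrightarrow> aval e s \<noteq> 0 \<and> wp U c (I (Suc j)) s"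
    and "\<And>s. I N s \<Longrightarrow> aval e s = 0 \<and> Q s"
  shows "wp U (While e c) Q s"
proof -
  have "j \<le> N \<Longrightarrow> I j s \<Longrightarrow> wp U (While e c) Q s" for j s
  proof (induction "N - j" arbitrary: j s)
    case 0
    then have "I N s" by simp
    then show ?case using assms(3) by (auto simp: wp_def intro: big_step.intros)
  next
    case (Suc k)
    then have "j < N" by simp
    from assms(2)[OF this Suc.prems(2)] obtain s' where
      s': "aval e s \<noteq> 0" "big_step U c s s'" "I (Suc j) s'" by (auto simp: wp_def)
    have "wp U (While e c) Q s'" using Suc.hyps(1)[of "Suc j" s'] Suc.hyps(2) s' by simp
    then show ?case using s' by (auto simp: wp_def intro: big_step.intros)
  qed
  then show ?thesis using assms(1) by blast
qed


section \<open>A prime between a number and its cube\<close>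

text \<open>The numbers \<open>1 / ((n + 1) * (n choose k))\<close> form Leibniz's harmonic
  triangle: column \<open>0\<close> consists of the unit fractions, and every entry of column
  \<open>Suc k\<close> is the difference of two entries of column \<open>k\<close>. Hence the
  entries are integer combinations of \<open>1, 1 / 2, ..., 1 / M\<close>.\<close>

lemma leibniz_triangle:
  fixes D :: nat
  assumes "\<And>i. 0 < i \<Longrightarrow> i \<le> M \<Longrightarrow> i dvd D" "n < M" "k \<le> n"
  shows "real D / (real (n + 1) * real (n choose k)) \<in> \<int>"
  using assms(2,3)
proof (induction k arbitrary: n)
  case 0
  then obtain c where "D = (n + 1) * c" using assms(1)[of "n + 1"] by (auto elim: dvdE)
  then have "real D / (real (n + 1) * real (n choose 0)) = of_nat c"
    by (simp add: field_simps)
  then show ?case by simp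
next
  case (Suc k)
  obtain m where n: "n = Suc m" using Suc.prems by (cases n) auto
  define a where "a = real (m choose k)"
  define b where "b = real (n choose k)"
  define c where "c = real (n choose Suc k)"
  have pos: "a > 0" "b > 0" "c > 0" 
    unfolding a_def b_def c_def of_nat_0_less_iff
    by (rule zero_less_binomial, use Suc.prems n in simp)+
  have "real (Suc k * (n choose Suc k)) = real (n * (m choose k))"
    using Suc_times_binomial_eq[of m k] by (simp add: n mult.commute)
  then have "real (Suc k) * c = real n * a" by (simp only: of_nat_mult a_def c_def)
  then have 1: "(real k + 1) * c = (real m + 1) * a" by (simp add: n add.commute)
  have "Suc k * (n choose Suc k) = (n - k) * (n choose k)"
    by (metis binomial_absorb_comp binomial_absorption mult.commute)
  then have "real (Suc k * (n choose Suc k)) = real ((n - k) * (n choose k))" by simp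
  then have "real (Suc k) * c = real (n - k) * b" by (simp only: of_nat_mult b_def c_def)
  then have 2: "(real k + 1) * c = (real m + 1 - real k) * b"
    using Suc.prems by (simp add: n of_nat_diff algebra_simps)
  have ca: "1 / ((real m + 1) * a) - 1 / ((real m + 2) * b) = 1 / ((real m + 2) * c)"
  proof -
    define K where "K = real k + 1"
    define V where "V = real m + 2"
    have KV: "K > 0" "V > 0" by (auto simp: K_def V_def)
    have VK: "V - K = real m + 1 - real k" by (simp add: K_def V_def)
    have *: "K * c = (real m + 1) * a" "K * c = (V - K) * b"
      unfolding VK using 1 2 by (simp_all add: K_def)
    have "V - K \<noteq> 0" using *(2) pos KV by auto
    then have "1 / (V * b) = (V - K) / (V * (K * c))" unfolding *(2) using pos KV by simp
    moreover have "1 / (K * c) - (V - K) / (V * (K * c)) = 1 / (V * c)"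
      using KV pos by (simp add: field_simps)
    ultimately show ?thesis unfolding *(1)[symmetric] V_def[symmetric] by simp
  qed
  have "real D / (real (m + 1) * a) \<in> \<int>" "real D / (real (n + 1) * b) \<in> \<int>"
    using Suc.IH[of m] Suc.IH[of n] Suc.prems by (auto simp: a_def b_def n)
  then have "real D / (real (m + 1) * a) - real D / (real (n + 1) * b) \<in> \<int>" by (rule Ints_diff)
  also have "real D / (real (m + 1) * a) - real D / (real (n + 1) * b) = real D * (1 / ((real m + 1) * a) - 1 / ((real m + 2) * b))"
    by (simp add: n algebra_simps)
  also have "\<dots> = real D / (real (n + 1) * c)" unfolding ca by (simp add: n algebra_simps)
  finally show ?case by (simp add: c_def)
qed

text \<open>By the Leibniz triangle \<open>D\<close> is a positive multiple of
  \<open>(n + 1) * (n choose (n div 2))\<close>, and this is at least the sum \<open>2 ^ n\<close>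
  of the \<open>n + 1\<close> binomial coefficients of the row.\<close>

lemma common_multiple_ge:
  fixes D :: nat
  assumes "\<And>i. 0 < i \<Longrightarrow> i \<le> Suc n \<Longrightarrow> i dvd D" "0 < D"
  shows "2 ^ n \<le> D"
proof -
  have "2 ^ n = (\<Sum>k\<le>n. n choose k)" by (simp add: choose_row_sum)
  also have "\<dots> \<le> (\<Sum>k\<le>n. n choose (n div 2))" by (intro sum_mono binomial_maximum)
  also have "\<dots> = (n + 1) * (n choose (n div 2))" by simp
  also have "\<dots> \<le> D"
  proof -
    let ?b = "(n + 1) * (n choose (n div 2))"
    have "real D / (real (n + 1) * real (n choose (n div 2))) \<in> \<int>"
      by (rule leibniz_triangle[OF assms(1)]) auto
    then have "real D / real ?b \<in> \<int>" by (simp only: of_nat_mult)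
    then obtain z :: int where z: "real D / real ?b = of_int z" by (elim Ints_cases)
    have "n choose (n div 2) > 0" by simp
    then have "real ?b > 0" by (metis of_nat_0_less_iff nat_0_less_mult_iff zero_less_Suc Suc_eq_plus1)
    then have "real D / real ?b > 0" using assms(2) by simp
    then have "z \<ge> 1" unfolding z by simp
    then have "1 \<le> real D / real ?b" unfolding z by simp
    then have "real ?b \<le> real D" using \<open>real ?b > 0\<close> by (simp add: le_divide_eq)
    then show ?thesis by linarith
  qed
  finally show ?thesis .
qed

text \<open>If no prime lies in \<open>(N, M]\<close>, then \<open>1, \<dots>, M\<close> have a common multiple of size at most
  \<open>M ^ N\<close>, which contradicts the exponential growth of their least common multiple.\<close>

lemma exists_prime_between:
  fixes N :: nat
  assumes "2 \<le> N"
  shows "\<exists>p. prime p \<and> N < p \<and> p \<le> N ^ 3"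
proof (rule ccontr)
  assume no: "\<not> ?thesis"
  define M where "M = N ^ 3"
  have M: "M > 0" using assms by (simp add: M_def)
  define P where "P = {p. prime p \<and> p \<le> N}"
  define g where "g p = (GREATEST j. p ^ j \<le> M)" for p
  \<comment> \<open>By the assumption every prime factor of a number up to \<open>M\<close> lies in
    \<open>P\<close>. So the product of the largest prime powers not exceeding \<open>M\<close> is a
    common multiple, although it has only \<open>card P\<close> factors of size at most
    \<open>M\<close>.\<close>
  define D where "D = (\<Prod>p\<in>P. p ^ g p)"
  have fin: "finite P" unfolding P_def by (rule finite_subset[of _ "{..N}"]) auto
  have P0: "p > 1" if "p \<in> P" for p using that by (auto simp: P_def prime_gt_Suc_0_nat)
  have bound: "j \<le> M" if "p \<in> P" "p ^ j \<le> M" for p j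
  proof -
    have "2 ^ j \<le> p ^ j" using P0[OF that(1)] by (intro power_mono) auto
    moreover have "j < 2 ^ j" by simp
    ultimately show ?thesis using that(2) by linarith
  qed
  have g: "p ^ g p \<le> M" if "p \<in> P" for p
    unfolding g_def by (rule GreatestI_nat[of _ 0 M]) (use that bound M in auto)
  have g2: "j \<le> g p" if "p \<in> P" "p ^ j \<le> M" for p j
    unfolding g_def by (rule Greatest_le_nat[of _ _ M]) (use that bound M in auto)
  have "D > 0" unfolding D_def using P0 by (intro prod_pos) (metis less_trans zero_less_one zero_less_power)
  have "i dvd D" if i: "0 < i" "i \<le> M" for i
  proof (rule multiplicity_le_imp_dvd)
    show "i \<noteq> 0" using i by simp
    fix p :: nat assume p: "prime p"
    show "multiplicity p i \<le> multiplicity p D"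
    proof (cases "p \<in> P")
      case True
      have "p ^ multiplicity p i dvd i" by (rule multiplicity_dvd)
      then have "p ^ multiplicity p i \<le> M" using i by (meson dvd_imp_le le_trans)
      then have "multiplicity p i \<le> g p" using g2 True by blast
      moreover have "p ^ g p dvd D" unfolding D_def using fin True by (rule dvd_prodI)
      ultimately have "p ^ multiplicity p i dvd D" by (meson le_imp_power_dvd dvd_trans)
      then show ?thesis using \<open>D > 0\<close> p by (intro multiplicity_geI) auto
    next
      case False
      then have "N < p" using p by (auto simp: P_def)
      then have "p > M" using no p unfolding M_def by (metis not_le)
      then have "\<not> p dvd i" using i by (meson dvd_imp_le le_trans not_le)
      then show ?thesis by (simp add: not_dvd_imp_multiplicity_0)
    qed
  qed
  then have "2 ^ (M - 1) \<le> D" using common_multiple_ge[of "M - 1" D] M \<open>D > 0\<close> by simp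
  also have "D \<le> (\<Prod>p\<in>P. M)" unfolding D_def using g by (intro prod_mono) auto
  also have "\<dots> = M ^ card P" by simp
  also have "\<dots> \<le> M ^ (N - 1)"
  proof (intro power_increasing)
    have "P \<subseteq> {2..N}" using prime_ge_2_nat by (auto simp: P_def)
    then have "card P \<le> card {2..N}" by (rule card_mono[rotated]) simp
    then show "card P \<le> N - 1" by simp
  qed (use M in auto)
  also have "\<dots> \<le> (2 ^ (3 * (N - 1))) ^ (N - 1)"
  proof (intro power_mono)
    have "N \<le> 2 ^ (N - 1)" using less_exp[of "N - 1"] by linarith
    then have "N ^ 3 \<le> (2 ^ (N - 1)) ^ 3" by (rule power_mono) simp
    then show "M \<le> 2 ^ (3 * (N - 1))" by (simp add: M_def mult.commute flip: power_mult)
  qed simp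
  also have "\<dots> = 2 ^ (3 * (N - 1) * (N - 1))" by (simp add: power_mult)
  finally have "M - 1 \<le> 3 * (N - 1) * (N - 1)" by (simp only: power_increasing_iff one_less_numeral_iff semiring_norm)
  moreover obtain k where k: "N = k + 2" using assms by (metis add.commute le_Suc_ex)
  \<comment> \<open>The reason for the cube: the upper bound on \<open>D\<close> has an exponent
    quadratic in \<open>N\<close> with leading coefficient 3, and \<open>N ^ 3 - 1\<close> exceeds
    it for every \<open>N \<ge> 2\<close>.\<close>
  have "3 * (N - 1) * (N - 1) + 1 < N ^ 3"
  proof -
    have "(k + 2) ^ 3 = 3 * (k + 1) * (k + 1) + 1 + (k * k * k + 3 * k * k + 6 * k + 4)"
      by (simp add: power3_eq_cube algebra_simps)
    then show ?thesis by (simp add: k)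
  qed
  ultimately show False unfolding M_def by linarith
qed


section \<open>Independence of polynomial hashing\<close>

lemma digits_eqI:
  fixes Q :: nat
  assumes "A < Q ^ R" "B < Q ^ R" "\<And>r. r < R \<Longrightarrow> A div Q ^ r mod Q = B div Q ^ r mod Q"
  shows "A = B"
  using assms
proof (induction R arbitrary: A B)
  case 0 then show ?case by simp
next
  case (Suc R)
  have "A div Q = B div Q"
  proof (rule Suc.IH)
    show "A div Q < Q ^ R" "B div Q < Q ^ R"
      using Suc.prems(1,2) by (auto simp: less_mult_imp_div_less mult.commute)
    show "A div Q div Q ^ r mod Q = B div Q div Q ^ r mod Q" if "r < R" for r
      using Suc.prems(3)[of "Suc r"] that by (simp add: div_mult2_eq)
  qed
  moreover have "A mod Q = B mod Q" using Suc.prems(3)[of 0] by simp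
  ultimately show ?case by (metis div_mult_mod_eq)
qed

text \<open>Makes a uniform number below \<open>Q ^ R\<close> the same as \<open>R\<close>
  independent uniform numbers below \<open>Q\<close>, which is how all repetitions share a single
  seed register.\<close>

lemma bij_betw_digits:
  fixes Q :: nat
  assumes "0 < Q"
  shows "bij_betw (\<lambda>A. \<lambda>r\<in>{..<R}. A div Q ^ r mod Q) {..<Q ^ R} ({..<R} \<rightarrow>\<^sub>E {..<Q})"
    (is "bij_betw ?f _ ?P")
proof -
  have inj: "inj_on ?f {..<Q ^ R}"
  proof (rule inj_onI)
    fix A B assume "A \<in> {..<Q ^ R}" "B \<in> {..<Q ^ R}" "?f A = ?f B"
    then show "A = B"
      by (intro digits_eqI[of A Q R B]) (auto dest!: fun_cong split: if_splits)
  qed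
  have "?f ` {..<Q ^ R} = ?P"
  proof (rule card_subset_eq)
    show "finite ?P" by (simp add: finite_PiE)
    show "?f ` {..<Q ^ R} \<subseteq> ?P"
      by (rule image_subsetI) (use assms in \<open>simp add: PiE_iff extensional_def\<close>)
    show "card (?f ` {..<Q ^ R}) = card ?P" using inj by (simp add: card_image card_PiE)
  qed
  then show ?thesis using inj by (simp add: bij_betw_def)
qed

lemma sum_digits_less:
  fixes D :: nat
  assumes "\<And>i. i < N \<Longrightarrow> c i < D"
  shows "(\<Sum>j<N. c j * D ^ j) < D ^ N"
  using assms
proof (induction N)
  case (Suc N)
  have "(\<Sum>j<N. c j * D ^ j) < D ^ N" using Suc by simp
  moreover have "c N + 1 \<le> D" using Suc.prems[of N] by simp
  then have "(c N + 1) * D ^ N \<le> D * D ^ N" by (rule mult_le_mono1)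
  ultimately show ?case by simp
qed simp

lemma digit_of_sum:
  fixes D :: nat
  assumes "\<And>i. i < N \<Longrightarrow> c i < D" "i < N"
  shows "(\<Sum>j<N. c j * D ^ j) div D ^ i mod D = c i"
  using assms
proof (induction N arbitrary: c i)
  case (Suc N)
  have D: "D > 0" using Suc.prems(1)[of i] Suc.prems(2) by (cases "D = 0") auto
  have eq: "(\<Sum>j<Suc N. c j * D ^ j) = c 0 + D * (\<Sum>j<N. c (Suc j) * D ^ j)"
    by (subst sum.lessThan_Suc_shift) (simp add: sum_distrib_left algebra_simps)
  show ?case
  proof (cases i)
    case 0
    then show ?thesis using Suc.prems(1)[of 0] unfolding eq by simp
  next
    case (Suc k)
    have "(c 0 + D * (\<Sum>j<N. c (Suc j) * D ^ j)) div D = (\<Sum>j<N. c (Suc j) * D ^ j)"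
      using Suc.prems(1)[of 0] D by simp
    then show ?thesis using Suc.IH[of "\<lambda>i. c (Suc i)" k] Suc.prems Suc unfolding eq
      by (simp add: div_mult2_eq)
  qed
qed simp

text \<open>Lagrange's bound on the number of roots modulo \<open>q\<close>, by splitting off one
  root at a time. Integer coefficients and divisibility take the place of a finite field, so that
  \<open>q\<close> can be an ordinary value computed at run time.\<close>

lemma dvd_coeffs_of_roots:
  fixes P :: "int poly" and q :: int
  assumes "prime q" "finite X" "\<And>x y. x \<in> X \<Longrightarrow> y \<in> X \<Longrightarrow> q dvd x - y \<Longrightarrow> x = y"
    "\<And>x. x \<in> X \<Longrightarrow> q dvd poly P x" "\<And>i. card X \<le> i \<Longrightarrow> coeff P i = 0"
  shows "q dvd coeff P i"
  using assms(2-5)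
proof (induction X arbitrary: P i rule: finite_induct)
  case empty then show ?case by simp
next
  case (insert x X)
  define Q where "Q = synthetic_div P x"
  have P: "P = [:-x, 1:] * Q + [:poly P x:]" unfolding Q_def using synthetic_div_correct' by metis
  have deg: "degree P \<le> card X"
    using insert by (intro degree_le) auto
  have Q0: "coeff Q i = 0" if "card X \<le> i" for i
  proof (cases "degree P = 0")
    case True then show ?thesis by (simp add: Q_def synthetic_div_eq_0_iff[THEN iffD2])
  next
    case False
    then have "degree Q < i" using that deg by (simp add: Q_def degree_synthetic_div)
    then show ?thesis by (rule coeff_eq_0)
  qed
  have Qd: "q dvd coeff Q i" for i
  proof (rule insert.IH)
    fix y assume y: "y \<in> X"
    have "q dvd poly P y" "q dvd poly P x" using insert.prems(2) y by auto
    moreover have "poly P y = (y - x) * poly Q y + poly P x" by (subst P) (simp add: algebra_simps)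
    ultimately have "q dvd (y - x) * poly Q y" by (simp add: dvd_add_left_iff)
    moreover have "\<not> q dvd y - x" using insert.prems(1)[of y x] y insert.hyps(2) by auto
    ultimately show "q dvd poly Q y" using assms(1) by (simp add: prime_dvd_mult_iff)
  qed (use Q0 insert.prems(1) in auto)
  have "coeff P i = - x * coeff Q i + (coeff (pCons 0 Q) i + coeff [:poly P x:] i)"
    by (subst P) (simp add: mult_pCons_left)
  moreover have "q dvd coeff (pCons 0 Q) i" using Qd by (cases i) auto
  moreover have "q dvd coeff [:poly P x:] i" using insert.prems(2)[of x] by (cases i) auto
  ultimately show ?case using Qd by simp
qed

text \<open>A polynomial of degree below \<open>t\<close> over the field with \<open>q\<close>
  elements, evaluated at \<open>e\<close>. Its coefficients are the base-\<open>q\<close> digits of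
  \<open>a\<close>, so a single number below \<open>q ^ t\<close> is a complete seed.\<close>

definition hash :: "nat \<Rightarrow> nat \<Rightarrow> nat \<Rightarrow> nat \<Rightarrow> nat" where
  "hash q t a e = (\<Sum>j<t. (a div q ^ j mod q) * e ^ j) mod q"

lemma hash_less: "0 < q \<Longrightarrow> hash q t a e < q"
  by (simp add: hash_def)

text \<open>The difference of the two polynomials has \<open>t\<close> roots and at most
  \<open>t\<close> coefficients, so all its coefficients vanish modulo \<open>q\<close>.\<close>

lemma hash_inj:
  assumes q: "prime q" and J: "card J = t" "J \<subseteq> {..<q}"
    and a: "a < q ^ t" "b < q ^ t" and eq: "\<And>e. e \<in> J \<Longrightarrow> hash q t a e = hash q t b e"
  shows "a = b"
proof (rule digits_eqI[OF a])
  fix r assume r: "r < t"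
  have fin: "finite J" using J(2) finite_subset by blast
  define f where "f j = int (a div q ^ j mod q) - int (b div q ^ j mod q)" for j
  define P where "P = (\<Sum>j<t. monom (f j) j)"
  have coeff: "coeff P i = (if i < t then f i else 0)" for i
    by (simp add: P_def coeff_sum sum.delta)
  have "int q dvd coeff P r"
  proof (rule dvd_coeffs_of_roots[of "int q" "int ` J"])
    show "x = y" if "x \<in> int ` J" "y \<in> int ` J" "int q dvd x - y" for x y
    proof -
      from that obtain u v where uv: "x = int u" "y = int v" "u < q" "v < q" using J by auto
      then have "int u mod int q = int v mod int q" using that(3) by (metis mod_eq_dvd_iff)
      then show ?thesis using uv by simp
    qed
    fix x assume "x \<in> int ` J"
    then obtain e where e: "e \<in> J" "x = int e" by auto
    have "(\<Sum>j<t. (a div q ^ j mod q) * e ^ j) mod q = (\<Sum>j<t. (b div q ^ j mod q) * e ^ j) mod q"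
      using eq[OF e(1)] by (simp add: hash_def)
    then have "int (\<Sum>j<t. (a div q ^ j mod q) * e ^ j) mod int q = int (\<Sum>j<t. (b div q ^ j mod q) * e ^ j) mod int q"
      by (simp only: of_nat_mod[symmetric])
    then have "int q dvd int (\<Sum>j<t. (a div q ^ j mod q) * e ^ j) - int (\<Sum>j<t. (b div q ^ j mod q) * e ^ j)"
      by (simp only: mod_eq_dvd_iff)
    also have "\<dots> = poly P x"
      unfolding P_def f_def e(2) of_nat_sum of_nat_mult of_nat_power
      by (simp add: poly_sum poly_monom algebra_simps sum_subtractf)
    finally show "int q dvd poly P x" .
  qed (use q fin coeff J(1) in \<open>auto simp: card_image\<close>)
  then have "int q dvd int (a div q ^ r mod q) - int (b div q ^ r mod q)"
    using r by (simp add: coeff f_def)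
  then have "int (a div q ^ r mod q) mod int q = int (b div q ^ r mod q) mod int q"
    by (simp only: mod_eq_dvd_iff)
  then show "a div q ^ r mod q = b div q ^ r mod q" by (simp flip: zmod_int)
qed

text \<open>Evaluation at \<open>t\<close> distinct points is an injection from seeds to value
  vectors. Both sets have \<open>q ^ t\<close> elements, so it is a bijection and the count is
  exact.\<close>

lemma hash_independent:
  assumes q: "prime q" and "t \<le> q" "J \<subseteq> {..<q}" "card J \<le> t" "\<And>e. e \<in> J \<Longrightarrow> B e \<subseteq> {..<q}"
  shows "card {a. a < q ^ t \<and> (\<forall>e\<in>J. hash q t a e \<in> B e)} = (\<Prod>e\<in>J. card (B e)) * q ^ (t - card J)"
proof -
  have q0: "q > 0" using q prime_gt_0_nat by blast
  have "t - card J \<le> card ({..<q} - J)" using assms by (simp add: card_Diff_subset finite_subset)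
  \<comment> \<open>\<open>J\<close> is padded to exactly \<open>t\<close> points; the added points
    are unconstrained and contribute the factor \<open>q ^ (t - card J)\<close>.\<close>
  then obtain K where K: "K \<subseteq> {..<q} - J" "card K = t - card J" "finite K"
    by (rule obtain_subset_with_card_n)
  have finJ: "finite J" using assms(3) finite_subset by blast
  define I where "I = J \<union> K"
  have "card I = card J + card K" unfolding I_def by (rule card_Un_disjoint) (use K finJ in auto)
  then have I1: "card I = t" using K(2) assms(4) by simp
  have I2: "I \<subseteq> {..<q}" unfolding I_def using K(1) assms(3) by blast
  have I3: "finite I" using K(3) finJ by (simp add: I_def)
  note I = I1 I2 I3
  define f where "f a = (\<lambda>e\<in>I. hash q t a e)" for a
  have inj: "inj_on f {..<q ^ t}"
  proof (rule inj_onI)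
    fix a b assume ab: "a \<in> {..<q ^ t}" "b \<in> {..<q ^ t}" and eq: "f a = f b"
    have "hash q t a e = hash q t b e" if "e \<in> I" for e
      using fun_cong[OF eq, of e] that by (simp add: f_def)
    then show "a = b" using ab hash_inj[OF q I(1,2), of a b] by simp
  qed
  have img: "f ` {..<q ^ t} = (I \<rightarrow>\<^sub>E {..<q})"
  proof (rule card_subset_eq)
    show "f ` {..<q ^ t} \<subseteq> (I \<rightarrow>\<^sub>E {..<q})"
      by (rule image_subsetI) (use q0 in \<open>simp add: PiE_iff extensional_def f_def hash_def\<close>)
    show "card (f ` {..<q ^ t}) = card (I \<rightarrow>\<^sub>E {..<q})" using inj I by (simp add: card_image card_PiE)
  qed (use I in \<open>simp add: finite_PiE\<close>)
  let ?S = "{a. a < q ^ t \<and> (\<forall>e\<in>J. hash q t a e \<in> B e)}"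
  define C where "C e = (if e \<in> J then B e else {..<q})" for e
  have "f ` ?S = PiE I C"
  proof
    show "f ` ?S \<subseteq> PiE I C"
    proof (rule image_subsetI)
      fix a assume "a \<in> ?S"
      then show "f a \<in> PiE I C"
        using hash_less[OF q0] by (simp add: PiE_iff extensional_def f_def C_def)
    qed
    show "PiE I C \<subseteq> f ` ?S"
    proof
      fix g assume g: "g \<in> PiE I C"
      moreover have "PiE I C \<subseteq> (I \<rightarrow>\<^sub>E {..<q})" using assms(5) by (intro PiE_mono) (auto simp: C_def)
      ultimately have "g \<in> f ` {..<q ^ t}" unfolding img by blast
      then obtain a where a: "a < q ^ t" "g = f a" by auto
      have "hash q t a e \<in> B e" if "e \<in> J" for e
      proof -
        have "e \<in> I" using that by (simp add: I_def)
        then have "g e \<in> C e" using g by (simp add: PiE_iff)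
        then show ?thesis using that \<open>e \<in> I\<close> by (simp add: a(2) f_def C_def)
      qed
      then show "g \<in> f ` ?S" using a by auto
    qed
  qed
  note img' = this
  have sub: "?S \<subseteq> {..<q ^ t}" by blast
  have "card ?S = card (f ` ?S)" by (rule card_image[OF inj_on_subset[OF inj sub], symmetric])
  also have "\<dots> = (\<Prod>e\<in>I. card (C e))" unfolding img' by (rule card_PiE[OF I(3)])
  also have "\<dots> = (\<Prod>e\<in>J. card (C e)) * (\<Prod>e\<in>K. card (C e))"
    unfolding I_def by (rule prod.union_disjoint) (use K finJ in blast)+
  also have "(\<Prod>e\<in>J. card (C e)) = (\<Prod>e\<in>J. card (B e))" by (intro prod.cong) (auto simp: C_def)
  also have "(\<Prod>e\<in>K. card (C e)) = (\<Prod>e\<in>K. q)" using K by (intro prod.cong) (auto simp: C_def)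
  finally show ?thesis using K by simp
qed


section \<open>Counting bad seeds\<close>

lemma card_Collect_sum: "finite A \<Longrightarrow> card {a \<in> A. P a} = (\<Sum>a\<in>A. of_bool (P a))"
  by (simp add: Int_def flip: Collect_conj_eq)

lemma card_Collect_less_sum: "card {a. a < N \<and> P a} = (\<Sum>a<N. of_bool (P a))" for N :: nat
  using card_Collect_sum[of "{..<N}" P] by simp

text \<open>A binomial moment by double counting: exchanging the sums, each \<open>s\<close>-subset
  of \<open>J\<close> is sampled completely by exactly \<open>\<theta> ^ s * q ^ (t - s)\<close>
  seeds.\<close>

lemma hash_moment:
  assumes q: "prime q" "t \<le> q" "J \<subseteq> {..<q}" "s \<le> t" "\<theta> \<le> q"
  shows "(\<Sum>a<q ^ t. card {e \<in> J. hash q t a e < \<theta>} choose s) = (card J choose s) * \<theta> ^ s * q ^ (t - s)"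
proof -
  have fin: "finite J" using assms(3) finite_subset by blast
  define F where "F = {K. K \<subseteq> J \<and> card K = s}"
  have finF: "finite F" unfolding F_def by (rule finite_subset[of _ "Pow J"]) (use fin in auto)
  have 1: "card {e \<in> J. hash q t a e < \<theta>} choose s = (\<Sum>K\<in>F. of_bool (\<forall>e\<in>K. hash q t a e < \<theta>))" for a
  proof -
    have "card {e \<in> J. hash q t a e < \<theta>} choose s = card {K. K \<subseteq> {e \<in> J. hash q t a e < \<theta>} \<and> card K = s}"
      by (rule n_subsets[symmetric]) (use fin in auto)
    also have "{K. K \<subseteq> {e \<in> J. hash q t a e < \<theta>} \<and> card K = s} = {K \<in> F. \<forall>e\<in>K. hash q t a e < \<theta>}"
      by (auto simp: F_def)
    finally show ?thesis using finF by (simp add: card_Collect_sum)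
  qed
  have 2: "(\<Sum>a<q ^ t. of_bool (\<forall>e\<in>K. hash q t a e < \<theta>)) = \<theta> ^ s * q ^ (t - s)" if "K \<in> F" for K
  proof -
    have K: "K \<subseteq> {..<q}" "card K = s" using that assms(3) by (auto simp: F_def)
    have "(\<Sum>a<q ^ t. of_bool (\<forall>e\<in>K. hash q t a e < \<theta>)) = card {a. a < q ^ t \<and> (\<forall>e\<in>K. hash q t a e \<in> {..<\<theta>})}"
      by (simp only: card_Collect_less_sum lessThan_iff)
    also have "\<dots> = (\<Prod>e\<in>K. card {..<\<theta>}) * q ^ (t - card K)"
      by (rule hash_independent[OF q(1,2) K(1)]) (use K assms in auto)
    finally show ?thesis using K by simp
  qed
  have "(\<Sum>a<q ^ t. card {e \<in> J. hash q t a e < \<theta>} choose s) =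
      (\<Sum>K\<in>F. \<Sum>a<q ^ t. of_bool (\<forall>e\<in>K. hash q t a e < \<theta>))"
    unfolding 1 by (rule sum.swap)
  also have "\<dots> = (\<Sum>K\<in>F. \<theta> ^ s * q ^ (t - s))" using 2 by (rule sum.cong[OF refl])
  also have "card F = card J choose s" unfolding F_def using fin by (rule n_subsets)
  then have "(\<Sum>K\<in>F. \<theta> ^ s * q ^ (t - s)) = (card J choose s) * \<theta> ^ s * q ^ (t - s)" by simp
  finally show ?thesis .
qed

text \<open>The right-hand side is a falling factorial of \<open>s\<close> factors, each larger than
  \<open>n - s\<close>.\<close>

lemma binomial_fact_ge: "s \<le> n \<Longrightarrow> (n - s) ^ s \<le> (n choose s) * fact s"
proof (induction s)
  case (Suc s)
  have "(n - Suc s) ^ Suc s \<le> (n - s) ^ Suc s" by (rule power_mono) auto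
  also have "\<dots> = (n - s) ^ s * (n - s)" by simp
  also have "\<dots> \<le> (n choose s) * fact s * (n - s)" using Suc by (intro mult_right_mono) auto
  also have "\<dots> = (n choose Suc s) * fact (Suc s)"
  proof -
    have "Suc s * (n choose Suc s) = (n - s) * (n choose s)"
      by (metis binomial_absorb_comp binomial_absorption mult.commute)
    then have "(n choose Suc s) * (Suc s * fact s) = (n choose s) * fact s * (n - s)"
      by (metis mult.assoc mult.commute)
    then show ?thesis by (simp only: fact_Suc of_nat_id)
  qed
  finally show ?case .
qed simp

text \<open>Counting \<open>s\<close>-subsets of the sampled edges needs only \<open>s\<close>-wise independence and no exponential moments.\<close>

lemma hash_upper_tail:
  assumes q: "prime q" "t \<le> q" "J \<subseteq> {..<q}" "s \<le> t" "\<theta> \<le> q"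
    and mu: "real \<theta> * real (card J) \<le> \<mu> * real q" "6 * real s \<le> \<mu>"
  shows "real (card {a. a < q ^ t \<and> 4 / 3 * \<mu> < real (card {e \<in> J. hash q t a e < \<theta>})}) \<le> (6 / 7) ^ s * real (q ^ t)"
    (is "real (card ?B) \<le> _")
proof (cases "\<mu> > 0")
  case False
  then have s: "s = 0" using mu(2) by linarith
  have "card ?B \<le> card {..<q ^ t}" by (rule card_mono) auto
  then have "card ?B \<le> q ^ t" by simp
  then have "real (card ?B) \<le> real (q ^ t)" by (rule of_nat_mono)
  then show ?thesis by (simp add: s)
next
  case True
  define X where "X a = card {e \<in> J. hash q t a e < \<theta>}" for a
  define A where "A = nat \<lceil>4 / 3 * \<mu>\<rceil>"
  have A: "4 / 3 * \<mu> \<le> real A" unfolding A_def by linarith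
  have sA: "s \<le> A" using A mu(2) by linarith
  have "card ?B * (A choose s) = (\<Sum>a\<in>?B. A choose s)" by simp
  also have "\<dots> \<le> (\<Sum>a\<in>?B. X a choose s)"
  proof (rule sum_mono)
    fix a assume "a \<in> ?B"
    then have "4 / 3 * \<mu> < real (X a)" by (simp add: X_def)
    then have "A \<le> X a" unfolding A_def by linarith
    then show "A choose s \<le> X a choose s" by (rule binomial_right_mono)
  qed
  also have "\<dots> \<le> (\<Sum>a<q ^ t. X a choose s)" by (rule sum_mono2) auto
  also have "\<dots> = (card J choose s) * \<theta> ^ s * q ^ (t - s)"
    unfolding X_def by (rule hash_moment[OF q])
  finally have 1: "card ?B * (A choose s) \<le> (card J choose s) * \<theta> ^ s * q ^ (t - s)" .
  have "card ?B * (A - s) ^ s \<le> card ?B * ((A choose s) * fact s)"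
    using binomial_fact_ge[OF sA] by simp
  also have "\<dots> \<le> (card J choose s) * \<theta> ^ s * q ^ (t - s) * fact s"
    using mult_right_mono[OF 1, of "fact s"] by (simp add: mult.assoc)
  also have "\<dots> = (card J choose s) * fact s * (\<theta> ^ s * q ^ (t - s))" by (simp add: algebra_simps)
  also have "\<dots> \<le> card J ^ s * (\<theta> ^ s * q ^ (t - s))"
    by (rule mult_right_mono[OF binomial_fact_pow]) simp
  finally have "real (card ?B * (A - s) ^ s) \<le> real (card J ^ s * (\<theta> ^ s * q ^ (t - s)))" by (rule of_nat_mono)
  then have "real (card ?B) * (real A - real s) ^ s \<le> (real \<theta> * real (card J)) ^ s * real q ^ (t - s)"
    using sA by (simp add: of_nat_diff power_mult_distrib algebra_simps)
  also have "\<dots> \<le> (\<mu> * real q) ^ s * real q ^ (t - s)"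
    using mu(1) by (intro mult_right_mono power_mono) auto
  also have "\<dots> = \<mu> ^ s * real (q ^ t)"
    using \<open>s \<le> t\<close> by (simp add: power_mult_distrib mult.assoc flip: power_add)
  finally have 2: "real (card ?B) * (real A - real s) ^ s \<le> \<mu> ^ s * real (q ^ t)" .
  \<comment> \<open>Origin of the base \<open>6 / 7\<close>:
    \<open>A - s \<ge> 4 / 3 * \<mu> - 1 / 6 * \<mu> = 7 / 6 * \<mu>\<close>, to be compared with
    the moment bound \<open>\<mu> ^ s\<close>.\<close>
  have "real (card ?B) * (7 / 6 * \<mu>) ^ s \<le> real (card ?B) * (real A - real s) ^ s"
    using A mu(2) True by (intro mult_left_mono power_mono) auto
  also note 2
  finally have "(real (card ?B) * (7 / 6) ^ s) * \<mu> ^ s \<le> real (q ^ t) * \<mu> ^ s"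
    by (simp only: power_mult_distrib mult.assoc mult.commute)
  then have "real (card ?B) * (7 / 6) ^ s \<le> real (q ^ t)"
    by (rule mult_right_le_imp_le) (use True in simp)
  then show ?thesis by (simp add: field_simps power_divide)
qed

lemma sum_power_card_Pow:
  fixes x :: real
  assumes "finite A" shows "(\<Sum>S\<in>Pow A. x ^ card S) = (1 + x) ^ card A"
  using assms
proof (induction A rule: finite_induct)
  case (insert a A)
  have "(\<Sum>S\<in>Pow (insert a A). x ^ card S) = (\<Sum>S\<in>Pow A. x ^ card S) + (\<Sum>S\<in>insert a ` Pow A. x ^ card S)"
    unfolding Pow_insert by (rule sum.union_disjoint) (use insert in auto)
  also have "(\<Sum>S\<in>insert a ` Pow A. x ^ card S) = (\<Sum>S\<in>Pow A. x ^ card (insert a S))"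
    by (rule sum.reindex_cong[OF _ refl refl]) (use insert in \<open>auto simp: inj_on_def\<close>)
  also have "\<dots> = (\<Sum>S\<in>Pow A. x * x ^ card S)"
  proof (rule sum.cong[OF refl])
    fix S assume "S \<in> Pow A"
    then have "finite S" "a \<notin> S" using insert finite_subset by auto
    then show "x ^ card (insert a S) = x * x ^ card S" by simp
  qed
  finally show ?case using insert by (simp add: algebra_simps flip: sum_distrib_left)
qed simp

text \<open>The cost of a union bound in which a set fails with probability at most
  \<open>x ^ card S\<close>: as soon as \<open>n * x \<le> 1\<close>, all nonempty sets together
  cost at most twice as much as the \<open>n\<close> singletons.\<close>

lemma sum_power_card_nonempty:
  fixes x :: real
  assumes "0 \<le> x" "real n * x \<le> 1"
  shows "(\<Sum>S\<in>Pow {..<n} - {{}}. x ^ card S) \<le> 2 * real n * x"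
proof -
  have "(\<Sum>S\<in>Pow {..<n} - {{}}. x ^ card S) = (1 + x) ^ n - 1"
    using sum_power_card_Pow[of "{..<n}" x] by (simp add: sum_diff1)
  also have "(1 + x) ^ n \<le> exp x ^ n" using assms by (intro power_mono exp_ge_add_one_self) auto
  also have "\<dots> = exp (real n * x)" by (simp add: exp_of_nat_mult)
  also have "\<dots> \<le> 1 + real n * x + (real n * x)\<^sup>2" using assms by (intro exp_bound) auto
  also have "(real n * x)\<^sup>2 \<le> real n * x * 1" unfolding power2_eq_square using assms by (intro mult_left_mono) auto
  finally show ?thesis by (simp add: mult.commute mult.left_commute)
qed

text \<open>Using the moment of order \<open>k * card S\<close> makes the failure probability of
  \<open>S\<close> exponential in its size, which outweighs the number of sets of that size;
  \<open>n * k \<le> t\<close> provides the independence for the largest \<open>S\<close>. The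
  number \<open>\<delta>\<close> bounds the expected number of sampled edges per node.\<close>

lemma hash_upper_tail_all:
  fixes I :: "nat set \<Rightarrow> nat set"
  assumes q: "prime q" "t \<le> q" "\<theta> \<le> q"
    and I: "\<And>S. S \<subseteq> {..<n} \<Longrightarrow> I S \<subseteq> {..<q}"
    and d: "\<And>S. S \<subseteq> {..<n} \<Longrightarrow> S \<noteq> {} \<Longrightarrow> real \<theta> * real (card (I S)) \<le> \<delta> * real (card S) * real q"
    and k: "6 * real k \<le> \<delta>" "n * k \<le> t" "real n * (6 / 7) ^ k \<le> 1"
  shows "real (card {a. a < q ^ t \<and> (\<exists>S\<subseteq>{..<n}. S \<noteq> {} \<and>
      4 / 3 * (\<delta> * real (card S)) < real (card {e \<in> I S. hash q t a e < \<theta>}))})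
    \<le> 2 * real n * (6 / 7) ^ k * real (q ^ t)" (is "real (card ?B) \<le> _")
proof -
  define C where "C S = {a. a < q ^ t \<and> 4 / 3 * (\<delta> * real (card S)) < real (card {e \<in> I S. hash q t a e < \<theta>})}" for S
  have "?B = (\<Union>S\<in>Pow {..<n} - {{}}. C S)" by (auto simp: C_def)
  then have "card ?B \<le> (\<Sum>S\<in>Pow {..<n} - {{}}. card (C S))" by (simp add: card_UN_le)
  then have "real (card ?B) \<le> (\<Sum>S\<in>Pow {..<n} - {{}}. real (card (C S)))" by (simp flip: of_nat_sum)
  also have "\<dots> \<le> (\<Sum>S\<in>Pow {..<n} - {{}}. ((6 / 7) ^ k) ^ card S * real (q ^ t))"
  proof (rule sum_mono)
    fix S assume S: "S \<in> Pow {..<n} - {{}}"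
    then have S': "S \<subseteq> {..<n}" "S \<noteq> {}" by auto
    have cS: "card S \<le> n" using card_mono[OF _ S'(1)] by simp
    have "real (card (C S)) \<le> (6 / 7) ^ (k * card S) * real (q ^ t)" unfolding C_def
    proof (rule hash_upper_tail[OF q(1,2) I[OF S'(1)] _ q(3) d[OF S']])
      show "k * card S \<le> t" using cS k(2) by (metis le_trans mult.commute mult_le_mono2)
      show "6 * real (k * card S) \<le> \<delta> * real (card S)"
        using mult_right_mono[OF k(1), of "real (card S)"] by (simp add: mult.assoc)
    qed
    then show "real (card (C S)) \<le> ((6 / 7) ^ k) ^ card S * real (q ^ t)" by (simp add: power_mult)
  qed
  also have "\<dots> = (\<Sum>S\<in>Pow {..<n} - {{}}. ((6 / 7) ^ k) ^ card S) * real (q ^ t)" by (rule sum_distrib_right[symmetric])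
  also have "\<dots> \<le> 2 * real n * (6 / 7) ^ k * real (q ^ t)"
    using k(3) by (intro mult_right_mono sum_power_card_nonempty) auto
  finally show ?thesis .
qed

section \<open>Isolated edges and the mean number of recovered edges\<close>

definition isolated :: "nat \<Rightarrow> nat \<Rightarrow> nat \<Rightarrow> nat set \<Rightarrow> nat \<Rightarrow> nat \<Rightarrow> bool" where
  "isolated q t w I a e \<longleftrightarrow> (\<forall>e'\<in>I. e' \<noteq> e \<longrightarrow> hash q t a e' div w \<noteq> hash q t a e div w)"

text \<open>Pairwise independence suffices: once \<open>e\<close> has hash value \<open>x\<close>,
  another edge meets its cell for at most \<open>w\<close> of the \<open>q\<close> possible values.
  These collisions are subtracted for all other edges and all \<open>x < \<theta>\<close>.\<close>

lemma hash_isolated_count: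
  assumes q: "prime q" "t \<le> q" "2 \<le> t" "I \<subseteq> {..<q}" "\<theta> \<le> q" and w: "0 < w" and e: "e \<in> I"
  shows "\<theta> * q ^ (t - 1) \<le> card {a. a < q ^ t \<and> hash q t a e < \<theta> \<and> isolated q t w I a e} + card I * \<theta> * w * q ^ (t - 2)"
proof -
  have fin: "finite I" using q(4) finite_subset by blast
  let ?A = "{a. a < q ^ t \<and> hash q t a e < \<theta> \<and> isolated q t w I a e}"
  define C where "C e' x = {a. a < q ^ t \<and> hash q t a e = x \<and> hash q t a e' div w = x div w}" for e' x
  have C: "card (C e' x) \<le> w * q ^ (t - 2)" if "e' \<in> I - {e}" "x < \<theta>" for e' x
  proof -
    define B where "B z = (if z = e then {x} else {y. y < q \<and> y div w = x div w})" for z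
    have "C e' x \<subseteq> {a. a < q ^ t \<and> (\<forall>z\<in>{e, e'}. hash q t a z \<in> B z)}"
      using that hash_less[of q t] prime_gt_0_nat[OF q(1)] by (auto simp: C_def B_def)
    then have "card (C e' x) \<le> card {a. a < q ^ t \<and> (\<forall>z\<in>{e, e'}. hash q t a z \<in> B z)}"
      by (intro card_mono) auto
    also have "\<dots> = (\<Prod>z\<in>{e, e'}. card (B z)) * q ^ (t - card {e, e'})"
      by (rule hash_independent[OF q(1,2)]) (use q e that in \<open>auto simp: B_def card_insert_if\<close>)
    also have "\<dots> = card (B e') * q ^ (t - 2)"
    proof -
      have "e \<noteq> e'" using that by auto
      then have "(\<Prod>z\<in>{e, e'}. card (B z)) = card (B e) * card (B e')" "card {e, e'} = 2" by simp_all
      moreover have "card (B e) = 1" by (simp add: B_def)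
      ultimately show ?thesis by simp
    qed
    also have "card (B e') \<le> w"
    proof -
      have "B e' \<subseteq> {x div w * w..<x div w * w + w}"
        using that w by (auto simp: B_def) (metis div_mult_mod_eq le_add1, metis div_mult_mod_eq mod_less_divisor nat_add_left_cancel_less)
      from card_mono[OF _ this] show ?thesis by simp
    qed
    finally show ?thesis by simp
  qed
  have "\<theta> * q ^ (t - 1) = card {a. a < q ^ t \<and> (\<forall>z\<in>{e}. hash q t a z \<in> {..<\<theta>})}"
    by (subst hash_independent[OF q(1,2)]) (use q e in auto)
  also have "\<dots> \<le> card (?A \<union> (\<Union>e'\<in>I - {e}. \<Union>x<\<theta>. C e' x))"
    by (rule card_mono) (auto simp: C_def isolated_def fin)
  also have "\<dots> \<le> card ?A + card (\<Union>e'\<in>I - {e}. \<Union>x<\<theta>. C e' x)" by (rule card_Un_le)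
  also have "card (\<Union>e'\<in>I - {e}. \<Union>x<\<theta>. C e' x) \<le> (\<Sum>e'\<in>I - {e}. card (\<Union>x<\<theta>. C e' x))"
    using fin by (intro card_UN_le) auto
  also have "\<dots> \<le> (\<Sum>e'\<in>I - {e}. \<theta> * (w * q ^ (t - 2)))"
  proof (rule sum_mono)
    fix e' assume e': "e' \<in> I - {e}"
    have "card (\<Union>x<\<theta>. C e' x) \<le> (\<Sum>x<\<theta>. card (C e' x))" by (rule card_UN_le) simp
    also have "\<dots> \<le> (\<Sum>x<\<theta>. w * q ^ (t - 2))" using C[OF e'] by (intro sum_mono) auto
    finally show "card (\<Union>x<\<theta>. C e' x) \<le> \<theta> * (w * q ^ (t - 2))" by simp
  qed
  also have "\<dots> \<le> (\<Sum>e'\<in>I. \<theta> * (w * q ^ (t - 2)))" using fin by (intro sum_mono2) auto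
  finally show ?thesis by (simp add: mult.assoc)
qed

text \<open>Under \<open>sparse\<close> the expected number of other edges in the cell of
  \<open>e\<close> is at most \<open>1 / 8\<close>, even given the hash value of \<open>e\<close>;
  the rest is linearity of expectation.\<close>

lemma hash_isolated_sum:
  assumes q: "prime q" "t \<le> q" "2 \<le> t" "I \<subseteq> {..<q}" "\<theta> \<le> q" and w: "0 < w" and J: "J \<subseteq> I"
    and sparse: "8 * (card I * w) \<le> q"
  shows "7 / 8 * (real (card J) * real \<theta> / real q) * real (q ^ t)
    \<le> (\<Sum>a<q ^ t. real (card {e \<in> J. hash q t a e < \<theta> \<and> isolated q t w I a e}))"
proof -
  have q0: "q > 0" using q(1) prime_gt_0_nat by blast
  have fin: "finite J" by (rule finite_subset[OF _ finite_lessThan]) (use q(4) J in blast)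
  obtain u where t: "t = u + 2" using q(3) by (metis add.commute le_Suc_ex)
  have 1: "7 * \<theta> * q ^ (t - 1) \<le> 8 * card {a. a < q ^ t \<and> hash q t a e < \<theta> \<and> isolated q t w I a e}"
    (is "_ \<le> 8 * card (?A e)") if "e \<in> J" for e
  proof -
    have "8 * (\<theta> * q ^ (t - 1)) \<le> 8 * (card (?A e) + card I * \<theta> * w * q ^ (t - 2))"
      using hash_isolated_count[OF q w, of e] that J by (intro mult_left_mono) auto
    also have "\<dots> = 8 * card (?A e) + 8 * (card I * w) * (\<theta> * q ^ (t - 2))" by (simp add: algebra_simps)
    also have "8 * (card I * w) * (\<theta> * q ^ (t - 2)) \<le> q * (\<theta> * q ^ (t - 2))"
      using sparse by (rule mult_right_mono) simp
    also have "q * (\<theta> * q ^ (t - 2)) = \<theta> * q ^ (t - 1)" by (simp add: t)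
    finally show ?thesis by simp
  qed
  have "(\<Sum>a<q ^ t. card {e \<in> J. hash q t a e < \<theta> \<and> isolated q t w I a e}) = (\<Sum>e\<in>J. card (?A e))"
  proof -
    show ?thesis
      unfolding card_Collect_sum[OF fin] card_Collect_less_sum by (rule sum.swap)
  qed
  moreover have "(\<Sum>e\<in>J. 7 * \<theta> * q ^ (t - 1)) \<le> (\<Sum>e\<in>J. 8 * card (?A e))" using 1 by (rule sum_mono)
  ultimately have "card J * (7 * \<theta> * q ^ (t - 1)) \<le> 8 * (\<Sum>a<q ^ t. card {e \<in> J. hash q t a e < \<theta> \<and> isolated q t w I a e})"
    by (simp add: sum_distrib_left)
  then have "real (card J * (7 * \<theta> * q ^ (t - 1))) \<le> real (8 * (\<Sum>a<q ^ t. card {e \<in> J. hash q t a e < \<theta> \<and> isolated q t w I a e}))"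
    by (rule of_nat_mono)
  then have "7 * (real (card J) * real \<theta>) * real q ^ (t - 1) \<le> 8 * (\<Sum>a<q ^ t. real (card {e \<in> J. hash q t a e < \<theta> \<and> isolated q t w I a e}))"
    by (simp add: mult.assoc mult.left_commute)
  moreover have "7 / 8 * (real (card J) * real \<theta> / real q) * real (q ^ t) = 7 / 8 * (real (card J) * real \<theta>) * real q ^ (t - 1)"
    using q0 by (simp add: t)
  ultimately show ?thesis by linarith
qed

text \<open>The mean is at least \<open>7 / 8 * \<mu>\<close> and values above \<open>4 / 3 * \<mu>\<close> are rare, so values below \<open>2 / 3 * \<mu>\<close>
  cannot be too frequent; no variance is needed.\<close>

lemma reverse_markov:
  fixes Y :: "'a \<Rightarrow> real"
  assumes "finite \<Omega>" "Bad \<subseteq> \<Omega>" "0 < \<mu>" "0 \<le> m"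
    and Y: "\<And>a. a \<in> \<Omega> - Bad \<Longrightarrow> Y a \<le> 4 / 3 * \<mu>" "\<And>a. a \<in> \<Omega> \<Longrightarrow> Y a \<le> m"
    and sum: "7 / 8 * \<mu> * real (card \<Omega>) \<le> (\<Sum>a\<in>\<Omega>. Y a)"
    and Bad: "24 * (real (card Bad) * m) \<le> \<mu> * real (card \<Omega>)"
  shows "real (card {a \<in> \<Omega>. Y a < 2 / 3 * \<mu>}) \<le> 3 / 4 * real (card \<Omega>)"
proof -
  let ?F = "{a \<in> \<Omega>. Y a < 2 / 3 * \<mu>}"
  \<comment> \<open>A pointwise bound that is lowered on the set in question and raised by
    \<open>m\<close> on \<open>Bad\<close>. After averaging,
    \<open>4 / 3 + 1 / 24 - 7 / 8 = 1 / 2\<close> remains, and division by \<open>2 / 3\<close>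
    yields the frequency \<open>3 / 4\<close>.\<close>
  have "(\<Sum>a\<in>\<Omega>. Y a) \<le> (\<Sum>a\<in>\<Omega>. 4 / 3 * \<mu> - 2 / 3 * \<mu> * of_bool (a \<in> ?F) + m * of_bool (a \<in> Bad))"
    using Y assms(3,4) by (intro sum_mono) (fastforce simp: of_bool_def)
  also have "\<dots> = 4 / 3 * \<mu> * real (card \<Omega>) - 2 / 3 * \<mu> * (\<Sum>a\<in>\<Omega>. of_bool (a \<in> ?F)) + m * (\<Sum>a\<in>\<Omega>. of_bool (a \<in> Bad))"
    by (simp add: sum.distrib sum_subtractf sum_distrib_left mult.commute del: sum_of_bool_eq sum_mult_of_bool_eq sum_of_bool_mult_eq)
  also have "(\<Sum>a\<in>\<Omega>. of_bool (a \<in> ?F)) = real (card ?F)"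
    using assms(1) by (simp add: Int_def)
  also have "(\<Sum>a\<in>\<Omega>. of_bool (a \<in> Bad)) = real (card Bad)"
    using assms(1,2) by (simp add: Int_absorb1)
  finally have "7 / 8 * \<mu> * real (card \<Omega>) \<le> 4 / 3 * \<mu> * real (card \<Omega>) - 2 / 3 * \<mu> * real (card ?F) + m * real (card Bad)"
    using sum by linarith
  then have "2 / 3 * \<mu> * real (card ?F) \<le> \<mu> * real (card \<Omega>) / 2" using Bad by (simp add: algebra_simps)
  then have "\<mu> * (2 / 3 * real (card ?F)) \<le> \<mu> * (real (card \<Omega>) / 2)" by (simp add: algebra_simps)
  then have "2 / 3 * real (card ?F) \<le> real (card \<Omega>) / 2" using assms(3) by (simp only: mult_le_cancel_left_pos)
  then show ?thesis by simp
qed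

text \<open>Seeds in \<open>B\<close> must not occur in any repetition, so their frequency is
  multiplied by \<open>R\<close>; landing in \<open>F\<close> does harm only if it happens in every
  repetition, which gives a power.\<close>

lemma repeat_count:
  fixes Q :: nat
  assumes "0 < Q" "B \<subseteq> {..<Q}" "F \<subseteq> {..<Q}" "real (card B) \<le> \<beta> * real Q" "real (card F) \<le> \<phi> * real Q"
  shows "real (card {A. A < Q ^ R \<and> ((\<exists>r<R. A div Q ^ r mod Q \<in> B) \<or> (\<forall>r<R. A div Q ^ r mod Q \<in> F))})
    \<le> (real R * \<beta> + \<phi> ^ R) * real (Q ^ R)"
proof -
  let ?f = "\<lambda>A. \<lambda>r\<in>{..<R}. A div Q ^ r mod Q"
  let ?S = "{A. A < Q ^ R \<and> ((\<exists>r<R. A div Q ^ r mod Q \<in> B) \<or> (\<forall>r<R. A div Q ^ r mod Q \<in> F))}"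
  define C where "C r = PiE {..<R} (\<lambda>i. if i = r then B else {..<Q})" for r
  have finB: "finite B" "finite F" using assms(2,3) finite_subset by blast+
  have inj: "inj_on ?f ?S"
    by (rule inj_on_subset[OF bij_betw_imp_inj_on[OF bij_betw_digits[OF assms(1)]]]) auto
  have "?f ` ?S \<subseteq> (\<Union>r<R. C r) \<union> ({..<R} \<rightarrow>\<^sub>E F)"
  proof (rule image_subsetI)
    fix A assume "A \<in> ?S"
    then consider r where "r < R" "A div Q ^ r mod Q \<in> B" | "\<forall>r<R. A div Q ^ r mod Q \<in> F" by auto
    then show "?f A \<in> (\<Union>r<R. C r) \<union> ({..<R} \<rightarrow>\<^sub>E F)"
    proof cases
      case 1
      then have "?f A \<in> C r" using assms(1) by (simp add: C_def PiE_iff extensional_def)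
      then show ?thesis using 1 by blast
    next
      case 2
      then show ?thesis by (simp add: PiE_iff extensional_def)
    qed
  qed
  then have "card (?f ` ?S) \<le> card ((\<Union>r<R. C r) \<union> ({..<R} \<rightarrow>\<^sub>E F))"
    by (rule card_mono[rotated]) (use finB in \<open>simp add: C_def finite_PiE\<close>)
  also have "\<dots> \<le> card (\<Union>r<R. C r) + card ({..<R} \<rightarrow>\<^sub>E F)" by (rule card_Un_le)
  also have "card (\<Union>r<R. C r) \<le> (\<Sum>r<R. card (C r))" by (rule card_UN_le) simp
  also have "(\<Sum>r<R. card (C r)) = (\<Sum>r<R. card B * Q ^ (R - 1))"
  proof (rule sum.cong[OF refl])
    fix r assume r: "r \<in> {..<R}"
    have "card (C r) = (\<Prod>i<R. card (if i = r then B else {..<Q}))" by (simp add: C_def card_PiE)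
    also have "\<dots> = card B * (\<Prod>i\<in>{..<R} - {r}. card (if i = r then B else {..<Q}))"
      using r by (subst prod.remove[of _ r]) auto
    also have "(\<Prod>i\<in>{..<R} - {r}. card (if i = r then B else {..<Q})) = (\<Prod>i\<in>{..<R} - {r}. Q)"
      by (rule prod.cong) auto
    finally show "card (C r) = card B * Q ^ (R - 1)" using r by simp
  qed
  finally have "card ?S \<le> R * (card B * Q ^ (R - 1)) + card F ^ R"
    unfolding card_image[OF inj] by (simp add: card_PiE)
  then have "real (card ?S) \<le> real (R * (card B * Q ^ (R - 1)) + card F ^ R)" by (rule of_nat_mono)
  also have "\<dots> = real R * (real (card B) * real Q ^ (R - 1)) + real (card F) ^ R" by simp
  also have "\<dots> \<le> real R * (\<beta> * real Q * real Q ^ (R - 1)) + (\<phi> * real Q) ^ R"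
    using assms(4,5) by (intro add_mono mult_left_mono mult_right_mono power_mono) auto
  also have "\<dots> = (real R * \<beta> + \<phi> ^ R) * real (Q ^ R)"
    by (cases R) (simp_all add: power_mult_distrib algebra_simps)
  finally show ?thesis .
qed

text \<open>Reducing a uniform number below \<open>k\<close> modulo \<open>m\<close> at most doubles the probability of any event when
  \<open>m \<le> k \<le> 2 * m\<close>, which avoids rejection sampling for the seeds.\<close>

lemma card_mod_le:
  fixes m :: nat
  assumes "k \<le> 2 * m"
  shows "card {A. A < k \<and> P (A mod m)} \<le> 2 * card {A. A < m \<and> P A}"
proof -
  let ?S = "{A. A < m \<and> P A}"
  have "{A. A < k \<and> P (A mod m)} \<subseteq> ?S \<union> (\<lambda>A. A + m) ` ?S"
  proof
    fix A assume A: "A \<in> {A. A < k \<and> P (A mod m)}"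
    show "A \<in> ?S \<union> (\<lambda>A. A + m) ` ?S"
    proof (cases "A < m")
      case False
      then have "A = (A - m) + m" "A - m < m" using A assms by auto
      moreover from this have "A mod m = A - m" by (metis mod_add_self2 mod_less)
      ultimately show ?thesis using A by auto
    qed (use A in auto)
  qed
  then have "card {A. A < k \<and> P (A mod m)} \<le> card (?S \<union> (\<lambda>A. A + m) ` ?S)" by (rule card_mono[rotated]) simp
  also have "\<dots> \<le> card ?S + card ((\<lambda>A. A + m) ` ?S)" by (rule card_Un_le)
  also have "card ((\<lambda>A. A + m) ` ?S) \<le> card ?S" by (rule card_image_le) simp
  finally show ?thesis by simp
qed


section \<open>Densest subgraphs of recovered samples\<close>

definition graph_on :: "nat \<Rightarrow> nat set set \<Rightarrow> bool" where
  "graph_on n E \<longleftrightarrow> (\<forall>e\<in>E. \<exists>u v. e = {u, v} \<and> u < v \<and> v < n)"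

definition edge_id :: "nat \<Rightarrow> nat set \<Rightarrow> nat" where
  "edge_id n e = Min e * n + Max e"

definition edge_ids :: "nat \<Rightarrow> nat set set \<Rightarrow> nat set \<Rightarrow> nat set" where
  "edge_ids n E S = edge_id n ` induced_edges E S"

lemma edge_id_pair: "u < v \<Longrightarrow> edge_id n {u, v} = u * n + v"
  by (simp add: edge_id_def)

lemma edge_id_div_mod: "u < v \<Longrightarrow> v < n \<Longrightarrow> edge_id n {u, v} div n = u \<and> edge_id n {u, v} mod n = v"
  by (simp add: edge_id_pair)

lemma edge_id_decode:
  assumes "graph_on n E" "e \<in> E"
  shows "e = {edge_id n e div n, edge_id n e mod n}"
  using assms edge_id_div_mod unfolding graph_on_def by metis

lemma inj_on_edge_id: "graph_on n E \<Longrightarrow> inj_on (edge_id n) E"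
  by (rule inj_onI) (metis edge_id_decode)

lemma edge_id_bounds:
  assumes "graph_on n E" "e \<in> E"
  shows "0 < edge_id n e" "edge_id n e < n ^ 2"
proof -
  obtain u v where e: "e = {u, v}" "u < v" "v < n" using assms by (auto simp: graph_on_def)
  then have "edge_id n e = u * n + v" by (simp add: edge_id_pair)
  moreover have "(u + 1) * n \<le> n * n" using e by (intro mult_right_mono) auto
  ultimately show "0 < edge_id n e" "edge_id n e < n ^ 2" using e by (auto simp: power2_eq_square)
qed

lemma finite_graph_on: "graph_on n E \<Longrightarrow> finite E"
  by (rule finite_subset[of _ "Pow {..<n}"]) (auto simp: graph_on_def)

lemma induced_edges_univ: "graph_on n E \<Longrightarrow> induced_edges E {..<n} = E"
  by (fastforce simp: graph_on_def induced_edges_def)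

lemma edge_ids_subset: "graph_on n E \<Longrightarrow> edge_ids n E S \<subseteq> {1..<n ^ 2}"
  using edge_id_bounds by (fastforce simp: edge_ids_def induced_edges_def)

lemma edge_ids_mono: "S \<subseteq> S' \<Longrightarrow> edge_ids n E S \<subseteq> edge_ids n E S'"
  by (auto simp: edge_ids_def induced_edges_def)

lemma card_edge_ids: "graph_on n E \<Longrightarrow> card (edge_ids n E S) = card (induced_edges E S)"
  unfolding edge_ids_def
  by (intro card_image inj_on_subset[OF inj_on_edge_id]) (auto simp: induced_edges_def)

text \<open>The inequality is strict because no edge has id \<open>0\<close>; so the number of edges
  in a cell can be stored as a residue modulo \<open>n ^ 2\<close>.\<close>

lemma card_graph_less:
  assumes "graph_on n E" "0 < n" shows "card E < n ^ 2"
proof -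
  have "card E = card (edge_ids n E {..<n})" using assms by (simp add: card_edge_ids induced_edges_univ)
  also have "\<dots> \<le> card {1..<n ^ 2}" using edge_ids_subset[OF assms(1)] by (intro card_mono) auto
  finally have "card E \<le> n ^ 2 - 1" by simp
  moreover have "n ^ 2 > 0" using assms(2) by simp
  ultimately show ?thesis by linarith
qed

lemma density_le_max: "S \<subseteq> {..<n} \<Longrightarrow> S \<noteq> {} \<Longrightarrow> density E S \<le> max_density n E"
  unfolding max_density_def by (rule Max_ge) auto

lemma max_density_attained:
  assumes "0 < n" shows "\<exists>S\<subseteq>{..<n}. S \<noteq> {} \<and> density E S = max_density n E"
proof -
  have "max_density n E \<in> density E ` {S. S \<subseteq> {..<n} \<and> S \<noteq> {}}"
    unfolding max_density_def by (rule Max_in) (use assms in \<open>auto intro!: exI[of _ "{0}"]\<close>)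
  then obtain S where "S \<subseteq> {..<n}" "S \<noteq> {}" "max_density n E = density E S" by blast
  then show ?thesis by metis
qed

lemma max_density_nonneg: assumes "0 < n" shows "0 \<le> max_density n E"
proof -
  obtain S where "max_density n E = density E S" using max_density_attained[OF assms] by metis
  then show ?thesis by (simp add: density_def)
qed

lemma card_edge_ids_density:
  assumes "graph_on n E" "S \<subseteq> {..<n}" "S \<noteq> {}"
  shows "real (card (edge_ids n E S)) = density E S * real (card S)"
proof -
  have "card S > 0" using assms finite_subset[OF assms(2)] by (simp add: card_gt_0_iff)
  then show ?thesis by (simp add: card_edge_ids[OF assms(1)] density_def)
qed

text \<open>Isolation refers to all edges of the graph: decoding sees whole cells, and an edge
  outside \<open>S\<close> in the same cell hides the edge inside.\<close>

definition recovered :: "nat \<Rightarrow> nat \<Rightarrow> nat \<Rightarrow> nat \<Rightarrow> nat set set \<Rightarrow> nat \<Rightarrow> nat \<Rightarrow> nat set \<Rightarrow> nat set" where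
  "recovered n q t w E \<theta> a S =
     {e \<in> edge_ids n E S. hash q t a e < \<theta> \<and> isolated q t w (edge_ids n E {..<n}) a e}"

text \<open>The quantity \<open>x\<close> stands for the largest density of a recovered sample over all repetitions;
  \<open>0\<close> is its initial value in the program.\<close>

definition good_seed :: "nat \<Rightarrow> nat \<Rightarrow> nat \<Rightarrow> nat \<Rightarrow> nat set set \<Rightarrow> nat \<Rightarrow> nat \<Rightarrow> nat \<Rightarrow> bool" where
  "good_seed n q t w E \<theta> R A \<longleftrightarrow> (\<forall>x::real.
     (\<forall>r<R. \<forall>S\<subseteq>{..<n}. S \<noteq> {} \<longrightarrow>
        real (card (recovered n q t w E \<theta> (A div (q ^ t) ^ r mod q ^ t) S)) \<le> x * real (card S)) \<longrightarrow>
     (x = 0 \<or> (\<exists>r<R. \<exists>S\<subseteq>{..<n}. S \<noteq> {} \<and>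
        real (card (recovered n q t w E \<theta> (A div (q ^ t) ^ r mod q ^ t) S)) = x * real (card S))) \<longrightarrow>
     max_density n E / 2 \<le> 3 / 4 * x * (real q / real \<theta>) \<and>
     3 / 4 * x * (real q / real \<theta>) \<le> max_density n E)"

text \<open>Two opposite demands fix the width \<open>w\<close> up to about a factor of 2:
  \<open>8 * (card E * w) \<le> q\<close> keeps the cells sparse, while
  \<open>q < 16 * ((card E + 1) * w)\<close> keeps the rate \<open>p = T * w / q\<close> above
  \<open>12 * n * k / (card E + 1)\<close>. This is the origin of
  \<open>192 = 12 * 16\<close>.\<close>

lemma bad_seed_count:
  assumes q: "prime q" "t \<le> q" "n ^ 2 \<le> q" and n: "2 \<le> n" and E: "graph_on n E"
    and t: "t = n * k" "T = 192 * t" "0 < k" and w: "0 < w" "8 * (card E * w) \<le> q" "q < 16 * ((card E + 1) * w)"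
    and \<theta>: "\<theta> = min (T * w) q" and k: "4 * real n ^ 2 * (6 / 7) ^ k \<le> 1"
  shows "real (card {A. A < (q ^ t) ^ R \<and> \<not> good_seed n q t w E \<theta> R A})
    \<le> (real R * (2 * real n * (6 / 7) ^ k) + (3 / 4) ^ R) * real ((q ^ t) ^ R)"
proof -
  define Q where "Q = q ^ t"
  define d where "d = max_density n E"
  define p where "p = real \<theta> / real q"
  define I where "I = edge_ids n E"
  define X where "X a S = real (card {e \<in> I S. hash q t a e < \<theta>})" for a S
  define Y where "Y a S = real (card (recovered n q t w E \<theta> a S))" for a S
  define Bad where "Bad = {a. a < Q \<and> (\<exists>S\<subseteq>{..<n}. S \<noteq> {} \<and> 4 / 3 * ((p * d) * real (card S)) < X a S)}"
  have q0: "q > 0" using q(1) prime_gt_0_nat by blast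
  then have Q0: "Q > 0" by (simp add: Q_def)
  have n0: "n > 0" using n by simp
  have t2: "2 \<le> t" using n t mult_le_mono[of 2 n 1 k] by simp
  then have "T * w > 0" using t w n0 by simp
  then have th: "0 < \<theta>" "\<theta> \<le> q" using q0 \<theta> by auto
  have p: "0 < p" "p \<le> 1" using th q0 by (auto simp: p_def)
  have d0: "0 \<le> d" unfolding d_def using n0 by (rule max_density_nonneg)
  have Isub: "I S \<subseteq> {..<q}" for S using edge_ids_subset[OF E] q(3) by (fastforce simp: I_def)
  have finI: "finite (I S)" for S using Isub finite_subset by blast
  have Id: "real (card (I S)) \<le> d * real (card S)" if "S \<subseteq> {..<n}" "S \<noteq> {}" for S
    using card_edge_ids_density[OF E that] density_le_max[OF that, of E]
    by (simp add: I_def d_def mult_right_mono)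
  have cE: "card (I {..<n}) = card E" by (simp add: I_def card_edge_ids[OF E] induced_edges_univ[OF E])
  have XI: "X a S \<le> real (card (I S))" for a S unfolding X_def by (intro of_nat_mono card_mono finI) auto
  have YX: "Y a S \<le> X a S" for a S
    unfolding Y_def X_def recovered_def I_def[symmetric] by (intro of_nat_mono card_mono) (use finI in auto)
  \<comment> \<open>Two degenerate cases, in which the rate is not estimated: if everything is
    sampled or there is no edge, the upper bound holds for every seed.\<close>
  have Bad1: "Bad = {}" if "\<theta> = q \<or> card E = 0"
  proof -
    have *: "X a S \<le> 4 / 3 * ((p * d) * real (card S))" if S: "S \<subseteq> {..<n}" "S \<noteq> {}" for a S
    proof (cases "card E = 0")
      case True
      have "card (I S) \<le> card (I {..<n})" unfolding I_def
        by (intro card_mono edge_ids_mono) (use finI I_def S in auto)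
      then have "X a S = 0" using XI[of a S] True cE by (simp add: X_def)
      then show ?thesis using p d0 by simp
    next
      case False
      then have "p = 1" using \<open>\<theta> = q \<or> card E = 0\<close> q0 by (simp add: p_def)
      moreover have "d * real (card S) \<ge> 0" using d0 by simp
      ultimately show ?thesis using XI[of a S] Id[OF S] by simp
    qed
    have "\<not> 4 / 3 * ((p * d) * real (card S)) < X a S" if "S \<subseteq> {..<n}" "S \<noteq> {}" for a S
      unfolding not_less by (rule *[OF that])
    then show ?thesis unfolding Bad_def by blast
  qed
  \<comment> \<open>With \<open>m\<close> for \<open>card E\<close>:
    \<open>m + 1 \<le> n ^ 2\<close> turns the lower bound for the rate into
    \<open>12 * k / n\<close>, while \<open>m \<le> d * n\<close> and
    \<open>m + 1 \<le> 2 * m\<close> turn it into the mean per node that the tail bound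
    demands.\<close>
  have pn: "12 * real k / real n \<le> p \<and> 6 * real k \<le> p * d" if "\<theta> \<noteq> q" "card E \<noteq> 0"
  proof -
    have "\<theta> = T * w" using that \<theta> by linarith
    then have "real T * real w = p * real q" using q0 by (simp add: p_def)
    moreover have "real q \<le> 16 * ((real (card E) + 1) * real w)"
    proof -
      have "real q \<le> real (16 * ((card E + 1) * w))" using w(3) by (intro of_nat_mono) simp
      then show ?thesis by (simp add: algebra_simps)
    qed
    then have "p * real q \<le> p * (16 * ((real (card E) + 1) * real w))" using p by (intro mult_left_mono) auto
    ultimately have "real T * real w \<le> (p * (16 * (real (card E) + 1))) * real w"
      by (simp only: mult.assoc)
    then have "real T \<le> p * (16 * (real (card E) + 1))" by (rule mult_right_le_imp_le) (use w in simp)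
    then have pT: "12 * real n * real k \<le> p * (real (card E) + 1)" by (simp add: t algebra_simps)
    have "card E + 1 \<le> n ^ 2" using card_graph_less[OF E n0] by simp
    then have "real (card E + 1) \<le> real (n ^ 2)" by (rule of_nat_mono)
    then have "p * (real (card E) + 1) \<le> p * real n ^ 2" using p by (intro mult_left_mono) auto
    then have "(12 * real k) * real n \<le> (p * real n) * real n" using pT by (simp add: power2_eq_square mult_ac)
    then have "12 * real k \<le> p * real n" by (rule mult_right_le_imp_le) (use n0 in simp)
    then have 1: "12 * real k / real n \<le> p" using n0 by (simp add: divide_le_eq)
    have "real (card E) \<le> d * real n" using Id[of "{..<n}"] n0 cE by auto
    moreover have "real (card E) + 1 \<le> 2 * real (card E)" using that by (cases "card E") auto
    ultimately have "p * (real (card E) + 1) \<le> p * (2 * (d * real n))" using p by (intro mult_left_mono) auto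
    then have "(6 * real k) * real n \<le> (p * d) * real n" using pT by (simp add: mult_ac)
    then have "6 * real k \<le> p * d" by (rule mult_right_le_imp_le) (use n0 in simp)
    then show ?thesis using 1 by simp
  qed
  have k1: "real n * (6 / 7) ^ k \<le> 1"
  proof -
    have "real n * 1 \<le> real n * (4 * real n)" using n by (intro mult_left_mono) auto
    then have "real n * (6 / 7) ^ k \<le> (4 * real n ^ 2) * (6 / 7) ^ k"
      by (intro mult_right_mono) (auto simp: power2_eq_square)
    then show ?thesis using k by linarith
  qed
  have Bad2: "real (card Bad) \<le> 2 * real n * (6 / 7) ^ k * real Q"
  proof (cases "\<theta> = q \<or> card E = 0")
    case True then show ?thesis using Bad1 by simp
  next
    case False
    show ?thesis unfolding Bad_def X_def Q_def
    proof (rule hash_upper_tail_all[OF q(1,2) th(2) Isub _ _ _ k1])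
      fix S assume S: "S \<subseteq> {..<n}" "S \<noteq> {}"
      have "real \<theta> * real (card (I S)) \<le> real \<theta> * (d * real (card S))"
        using Id[OF S] by (intro mult_left_mono) auto
      also have "\<dots> = p * d * real (card S) * real q" using q0 by (simp add: p_def)
      finally show "real \<theta> * real (card (I S)) \<le> p * d * real (card S) * real q" .
    qed (use pn False t in auto)
  qed
  \<comment> \<open>The lower bound is needed for one densest set only, so no union bound enters
    here and constant probability is enough.\<close>
  obtain S where S: "S \<subseteq> {..<n}" "S \<noteq> {}" "density E S = d"
    using max_density_attained[OF n0, of E] by (auto simp: d_def)
  have cS: "real (card (I S)) = d * real (card S)"
    using card_edge_ids_density[OF E S(1,2)] S(3) by (simp add: I_def)
  define \<mu> where "\<mu> = p * real (card (I S))"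
  define F where "F = {a \<in> {..<Q}. Y a S < 2 / 3 * \<mu>}"
  have F: "real (card F) \<le> 3 / 4 * real Q"
  proof (cases "card (I S) = 0")
    case True
    then have "F = {}" by (auto simp: F_def \<mu>_def Y_def)
    then show ?thesis by simp
  next
    case False
    have "real (card {a \<in> {..<Q}. Y a S < 2 / 3 * \<mu>}) \<le> 3 / 4 * real (card {..<Q})"
    proof (rule reverse_markov[where Bad = Bad and m = "real (card (I S))"])
      show "0 < \<mu>" using False p by (simp add: \<mu>_def)
      show "Y a S \<le> 4 / 3 * \<mu>" if "a \<in> {..<Q} - Bad" for a
      proof -
        have "\<not> 4 / 3 * ((p * d) * real (card S)) < X a S" using that S(1,2) unfolding Bad_def by blast
        then show ?thesis using YX[of a S] by (simp add: \<mu>_def cS)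
      qed
      show "Y a S \<le> real (card (I S))" for a using YX[of a S] XI[of a S] by simp
      have "7 / 8 * (real (card (I S)) * real \<theta> / real q) * real (q ^ t)
          \<le> (\<Sum>a<q ^ t. real (card {e \<in> I S. hash q t a e < \<theta> \<and> isolated q t w (I {..<n}) a e}))"
        by (rule hash_isolated_sum[OF q(1,2) t2 Isub th(2) w(1)])
          (use w(2) cE S edge_ids_mono in \<open>auto simp: I_def\<close>)
      then show "7 / 8 * \<mu> * real (card {..<Q}) \<le> (\<Sum>a\<in>{..<Q}. Y a S)"
        by (simp add: \<mu>_def p_def Y_def recovered_def I_def Q_def mult_ac)
      \<comment> \<open>On bad seeds \<open>Y\<close> is bounded only by
        \<open>card (I S) = \<mu> / p\<close>, so the frequency of \<open>Bad\<close> must be at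
        most \<open>p / 24\<close>. Since \<open>p\<close> is only known to be at least
        \<open>12 * k / n\<close>, the hypothesis on \<open>(6 / 7) ^ k\<close> carries a quadratic
        factor.\<close>
      show "24 * (real (card Bad) * real (card (I S))) \<le> \<mu> * real (card {..<Q})"
      proof (cases "\<theta> = q \<or> card E = 0")
        case True then show ?thesis using Bad1 p by (simp add: \<mu>_def)
      next
        case F: False
        have "24 * real (card Bad) \<le> 48 * real n * (6 / 7) ^ k * real Q"
          using mult_left_mono[OF Bad2, of 24] by (simp add: mult_ac)
        also have "\<dots> \<le> p * real Q"
        proof (rule mult_right_mono)
          have "48 * real n * (6 / 7) ^ k * real n \<le> 12 * 1"
            using k by (simp add: power2_eq_square)
          then have "48 * real n * (6 / 7) ^ k \<le> 12 / real n" using n0 by (simp add: le_divide_eq)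
          also have "\<dots> \<le> 12 * real k / real n" using t(3) n0 by (simp add: divide_right_mono)
          also have "\<dots> \<le> p" using pn F by blast
          finally show "48 * real n * (6 / 7) ^ k \<le> p" .
        qed simp
        finally have "24 * real (card Bad) * real (card (I S)) \<le> p * real Q * real (card (I S))"
          by (rule mult_right_mono) simp
        then show ?thesis by (simp add: \<mu>_def mult_ac)
      qed
    qed (auto simp: Bad_def)
    then show ?thesis by (simp add: F_def)
  qed
  have good: "good_seed n q t w E \<theta> R A"
    if noB: "\<And>r. r < R \<Longrightarrow> A div Q ^ r mod Q \<notin> Bad" and notF: "\<not> (\<forall>r<R. A div Q ^ r mod Q \<in> F)" for A
    unfolding good_seed_def Q_def[symmetric] Y_def[symmetric] d_def[symmetric]
  proof (intro allI impI)
    fix x :: real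
    assume up: "\<forall>r<R. \<forall>S\<subseteq>{..<n}. S \<noteq> {} \<longrightarrow> Y (A div Q ^ r mod Q) S \<le> x * real (card S)"
      and att: "x = 0 \<or> (\<exists>r<R. \<exists>S\<subseteq>{..<n}. S \<noteq> {} \<and> Y (A div Q ^ r mod Q) S = x * real (card S))"
    have pos: "real (card S') > 0" if "S' \<subseteq> {..<n}" "S' \<noteq> {}" for S'
      using that finite_subset[OF that(1)] by (simp add: card_gt_0_iff)
    have "x \<le> 4 / 3 * (p * d)" using att
    proof
      assume "x = 0" then show ?thesis using p d0 by simp
    next
      assume "\<exists>r<R. \<exists>S\<subseteq>{..<n}. S \<noteq> {} \<and> Y (A div Q ^ r mod Q) S = x * real (card S)"
      then obtain r S' where r: "r < R" "S' \<subseteq> {..<n}" "S' \<noteq> {}" "Y (A div Q ^ r mod Q) S' = x * real (card S')"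
        by blast
      have "X (A div Q ^ r mod Q) S' \<le> 4 / 3 * ((p * d) * real (card S'))"
      proof -
        have "A div Q ^ r mod Q < Q" using Q0 by simp
        then have "\<not> 4 / 3 * ((p * d) * real (card S')) < X (A div Q ^ r mod Q) S'"
          using noB[OF r(1)] r(2,3) unfolding Bad_def by blast
        then show ?thesis by (simp only: not_less)
      qed
      then have "x * real (card S') \<le> (4 / 3 * (p * d)) * real (card S')"
        using YX[of "A div Q ^ r mod Q" S'] r(4) by simp
      then show ?thesis using pos[OF r(2,3)] by (simp only: mult_le_cancel_right_pos)
    qed
    moreover have "2 / 3 * (p * d) \<le> x"
    proof -
      obtain r where r: "r < R" "A div Q ^ r mod Q \<notin> F" using notF by blast
      then have "2 / 3 * \<mu> \<le> Y (A div Q ^ r mod Q) S" using Q0 by (simp add: F_def)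
      also have "\<dots> \<le> x * real (card S)" using up r S by blast
      finally have "(2 / 3 * (p * d)) * real (card S) \<le> x * real (card S)" by (simp add: \<mu>_def cS)
      then show ?thesis using pos[OF S(1,2)] by (simp only: mult_le_cancel_right_pos)
    qed
    \<comment> \<open>Division by \<open>p\<close> and the factor \<open>3 / 4\<close> map the range
      from \<open>2 / 3 * (p * d)\<close> to \<open>4 / 3 * (p * d)\<close> onto the range from
      \<open>d / 2\<close> to \<open>d\<close>.\<close>
    moreover have "real q / real \<theta> = 1 / p" using q0 th by (simp add: p_def)
    ultimately show "d / 2 \<le> 3 / 4 * x * (real q / real \<theta>) \<and> 3 / 4 * x * (real q / real \<theta>) \<le> d"
      using p(1) by (simp add: pos_le_divide_eq pos_divide_le_eq mult.commute)
  qed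
  have "card {A. A < Q ^ R \<and> \<not> good_seed n q t w E \<theta> R A} \<le>
      card {A. A < Q ^ R \<and> ((\<exists>r<R. A div Q ^ r mod Q \<in> Bad) \<or> (\<forall>r<R. A div Q ^ r mod Q \<in> F))}"
  proof (rule card_mono)
    show "{A. A < Q ^ R \<and> \<not> good_seed n q t w E \<theta> R A} \<subseteq>
      {A. A < Q ^ R \<and> ((\<exists>r<R. A div Q ^ r mod Q \<in> Bad) \<or> (\<forall>r<R. A div Q ^ r mod Q \<in> F))}"
      using good by blast
  qed simp
  then have "real (card {A. A < Q ^ R \<and> \<not> good_seed n q t w E \<theta> R A}) \<le>
      real (card {A. A < Q ^ R \<and> ((\<exists>r<R. A div Q ^ r mod Q \<in> Bad) \<or> (\<forall>r<R. A div Q ^ r mod Q \<in> F))})"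
    by (rule of_nat_mono)
  also have "\<dots> \<le> (real R * (2 * real n * (6 / 7) ^ k) + (3 / 4) ^ R) * real (Q ^ R)"
    by (rule repeat_count[OF Q0]) (use Bad2 F in \<open>auto simp: Bad_def F_def\<close>)
  finally show ?thesis by (simp only: Q_def)
qed


section \<open>Maintaining the sketch\<close>

lemma wp_simps:
  "wp U Skip Q s \<longleftrightarrow> Q s"
  "wp U (Assign x e) Q s \<longleftrightarrow> aval e s < U \<and> Q (s(x := aval e s))"
  "wp U (Seq c d) Q s \<longleftrightarrow> wp U c (wp U d Q) s"
  "wp U (If e c d) Q s \<longleftrightarrow> (if aval e s \<noteq> 0 then wp U c Q s else wp U d Q s)"
proof -
  show "wp U (Seq c d) Q s \<longleftrightarrow> wp U c (wp U d Q) s"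
  proof
    assume "wp U (Seq c d) Q s"
    then obtain s'' where s'': "big_step U (Seq c d) s s''" "Q s''" by (auto simp: wp_def)
    from s''(1) show "wp U c (wp U d Q) s"
      by (cases rule: big_step.cases) (use s''(2) in \<open>auto simp: wp_def\<close>)
  qed (auto simp: wp_def intro: big_step.intros)
qed (auto simp: wp_def elim: big_step.cases intro: big_step.intros)

lemma wp_AssignI: "aval e s = k \<Longrightarrow> k < U \<Longrightarrow> Q (s(x := k)) \<Longrightarrow> wp U (Assign x e) Q s"
  by (simp add: wp_simps)

lemma wp_IfTrue: "aval e s \<noteq> 0 \<Longrightarrow> wp U c Q s \<Longrightarrow> wp U (If e c d) Q s"
  by (simp add: wp_simps)

abbreviation seq_com (infixr \<open>;;\<close> 60) where "c ;; d \<equiv> Seq c d"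
abbreviation assign_com (infix \<open>::=\<close> 65) where "x ::= e \<equiv> Assign x e"
abbreviation plus_exp (infixl \<open>\<oplus>\<close> 70) where "a \<oplus> b \<equiv> Bin Plus a b"
abbreviation minus_exp (infixl \<open>\<ominus>\<close> 70) where "a \<ominus> b \<equiv> Bin Minus a b"
abbreviation times_exp (infixl \<open>\<otimes>\<close> 75) where "a \<otimes> b \<equiv> Bin Times a b"
abbreviation div_exp (infixl \<open>\<oslash>\<close> 75) where "a \<oslash> b \<equiv> Bin Div a b"
abbreviation mod_exp (infixl \<open>\<odot>\<close> 75) where "a \<odot> b \<equiv> Bin Mod a b"
abbreviation less_exp (infix \<open>\<prec>\<close> 68) where "a \<prec> b \<equiv> Bin Less a b"
abbreviation power_exp (infixr \<open>\<up>\<close> 80) where "a \<up> b \<equiv> Bin Power a b"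

text \<open>Reduction modulo \<open>q\<close> keeps \<open>y\<close> and \<open>w\<close> short;
  \<open>x\<close> starts as the seed of the repetition and loses one digit per round.\<close>

definition hash_body :: com where
  "hash_body =
     (''y'' ::= (Reg ''y'' \<oplus> (Reg ''x'' \<odot> Reg ''q'') \<otimes> Reg ''w'') \<odot> Reg ''q'' ;;
      ''w'' ::= (Reg ''w'' \<otimes> Reg ''e'') \<odot> Reg ''q'' ;;
      ''x'' ::= Reg ''x'' \<oslash> Reg ''q'' ;;
      ''j'' ::= Reg ''j'' \<oplus> Num 1)"

definition hash_prog :: com where
  "hash_prog =
     (''y'' ::= Num 0 ;; ''w'' ::= Num 1 ;; ''j'' ::= Num 0 ;;
      While (Reg ''j'' \<prec> Reg ''t'') hash_body)"

text \<open>Frame condition: \<open>V\<close> lists the registers that a program may change.\<close>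

definition agree :: "string set \<Rightarrow> store \<Rightarrow> store \<Rightarrow> bool" where
  "agree V s s' \<longleftrightarrow> (\<forall>z. z \<notin> V \<longrightarrow> s' z = s z)"

lemma agreeD: "agree V s s' \<Longrightarrow> z \<notin> V \<Longrightarrow> s' z = s z"
  by (simp add: agree_def)

lemma agree_refl: "agree V s s"
  by (simp add: agree_def)

lemma agree_upd: "agree V s s' \<Longrightarrow> z \<in> V \<Longrightarrow> agree V s (s'(z := k))"
  by (auto simp: agree_def)

lemma agree_trans: "agree V s s' \<Longrightarrow> agree V' s' s'' \<Longrightarrow> V \<subseteq> W \<Longrightarrow> V' \<subseteq> W \<Longrightarrow> agree W s s''"
  unfolding agree_def by (metis subsetD)

lemma wp_hash_prog:
  assumes "s ''q'' = q" "s ''t'' = t" "1 < q" "q < U" "t < U" "s ''x'' < U"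
  shows "wp U hash_prog (\<lambda>s'. agree {''y'', ''w'', ''j'', ''x''} s s' \<and>
    s' ''y'' = hash q t (s ''x'') (s ''e'')) s"
proof -
  define a e where "a = s ''x''" and "e = s ''e''"
  define I where "I j s' \<longleftrightarrow> agree {''y'', ''w'', ''j'', ''x''} s s' \<and> s' ''j'' = j \<and> s' ''x'' = a div q ^ j \<and>
    s' ''y'' = (\<Sum>i<j. (a div q ^ i mod q) * e ^ i) mod q \<and> s' ''w'' = e ^ j mod q" for j s'
  have step: "aval (Reg ''j'' \<prec> Reg ''t'') s' \<noteq> 0 \<and> wp U hash_body (I (Suc j)) s'" if j: "j < t" and I: "I j s'" for j s'
  proof -
    have fr: "s' z = s z" if "z \<notin> {''y'', ''w'', ''j'', ''x''}" for z
      using I that unfolding I_def by (blast intro: agreeD)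
    have c: "s' ''q'' = q" "s' ''t'' = t" "s' ''e'' = e" using fr assms by (simp_all add: e_def)
    have l: "z mod q < U" for z using assms by (meson less_trans mod_less_divisor zero_less_one)
    have "a div q ^ j div q < U"
      using assms(6) unfolding a_def by (meson div_le_dividend le_less_trans)
    then have "wp U hash_body (\<lambda>s''. agree {''y'', ''w'', ''j'', ''x''} s s'' \<and> s'' ''j'' = Suc j \<and>
          s'' ''x'' = a div q ^ j div q \<and>
          s'' ''y'' = ((\<Sum>i<j. (a div q ^ i mod q) * e ^ i) mod q + (a div q ^ j mod q) * (e ^ j mod q)) mod q \<and>
          s'' ''w'' = (e ^ j mod q) * e mod q) s'"
      using I j assms c l unfolding I_def hash_body_def by (simp add: wp_simps agree_upd)
    then have "wp U hash_body (I (Suc j)) s'"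
    proof (rule wp_conseq)
      have m: "(x + y * (z mod q)) mod q = (x + y * z) mod q" for x y z
        by (metis mod_add_right_eq mod_mult_right_eq)
      fix s''
      assume "agree {''y'', ''w'', ''j'', ''x''} s s'' \<and> s'' ''j'' = Suc j \<and>
          s'' ''x'' = a div q ^ j div q \<and>
          s'' ''y'' = ((\<Sum>i<j. (a div q ^ i mod q) * e ^ i) mod q + (a div q ^ j mod q) * (e ^ j mod q)) mod q \<and>
          s'' ''w'' = (e ^ j mod q) * e mod q"
      then show "I (Suc j) s''"
        by (simp add: I_def power_Suc2 div_mult2_eq mod_simps m del: power_Suc)
    qed
    then show ?thesis using j I c by (simp add: I_def)
  qed
  have "wp U (While (Reg ''j'' \<prec> Reg ''t'') hash_body) (\<lambda>s'. agree {''y'', ''w'', ''j'', ''x''} s s' \<and>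
    s' ''y'' = hash q t a e) (s(''y'' := 0, ''w'' := 1, ''j'' := 0))"
  proof (rule wp_While_count[where I = I and N = t])
    show "I 0 (s(''y'' := 0, ''w'' := 1, ''j'' := 0))"
      using assms(3) by (simp add: I_def a_def agree_upd agree_refl)
    fix s' assume I: "I t s'"
    then have "s' ''t'' = t" using assms(2) agreeD[of _ s s' "''t''"] unfolding I_def by auto
    then show "aval (Reg ''j'' \<prec> Reg ''t'') s' = 0 \<and>
        agree {''y'', ''w'', ''j'', ''x''} s s' \<and> s' ''y'' = hash q t a e"
      using I by (simp add: I_def hash_def)
  qed (use step in blast)
  then show ?thesis using assms by (simp add: hash_prog_def wp_simps a_def e_def)
qed

text \<open>One division serves two purposes: the quotient of the hash value by the cell width
  \<open>2 ^ i\<close> is the index of the cell, and it is below \<open>T\<close> exactly if the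
  edge is sampled at level \<open>i\<close>.\<close>

definition cell_update :: com where
  "cell_update =
     (''P'' ::= Num 2 \<up> (Reg ''k'' \<odot> Reg ''G'') ;;
          ''y'' ::= Reg ''y'' \<oslash> Reg ''P'' ;;
          If (Reg ''y'' \<prec> Reg ''T'')
          (''P'' ::= Reg ''D'' \<up> (Reg ''k'' \<otimes> Reg ''T'' \<oplus> Reg ''y'') ;;
           ''x'' ::= Reg ''P'' \<otimes> (Num 1 \<oplus> Reg ''e'' \<otimes> (Reg ''n'' \<otimes> Reg ''n'')) ;;
           If (Reg ''op'') (''S'' ::= Reg ''S'' \<oplus> Reg ''x'') (''S'' ::= Reg ''S'' \<ominus> Reg ''x''))
          Skip ;;
          ''k'' ::= Reg ''k'' \<oplus> Num 1)"

text \<open>Registers: \<open>A\<close> holds the seeds of all repetitions, \<open>S\<close> the sketch and \<open>m\<close> the number of edges;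
  \<open>k\<close> encodes the repetition \<open>k div G\<close> and the sampling level \<open>k mod G\<close>.\<close>

definition update_body :: com where
  "update_body =
     (''P'' ::= Reg ''Q'' \<up> (Reg ''k'' \<oslash> Reg ''G'') ;;
      ''x'' ::= (Reg ''A'' \<oslash> Reg ''P'') \<odot> Reg ''Q'' ;;
      hash_prog ;;
      cell_update)"

definition update_com :: com where
  "update_com =
     (If (Reg ''u'' \<prec> Reg ''v'') (''e'' ::= Reg ''u'' \<otimes> Reg ''n'' \<oplus> Reg ''v'')
        (''e'' ::= Reg ''v'' \<otimes> Reg ''n'' \<oplus> Reg ''u'') ;;
      ''k'' ::= Num 0 ;;
      While (Reg ''k'' \<prec> Reg ''R'' \<otimes> Reg ''G'') update_body ;;
      If (Reg ''op'') (''m'' ::= Reg ''m'' \<oplus> Num 1) (''m'' ::= Reg ''m'' \<ominus> Num 1))"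

text \<open>Each bound on \<open>U\<close> stems from one kind of register value: the seeds (with a
  factor 2, since coins draw below a power of two), the sketch, the cell widths, the search counter,
  edge ids and edge counts, cell indices, numerator and denominator of the answer, and the counter
  of the hash loop.\<close>

locale sketch =
  fixes n t T R G q U :: nat
  assumes n: "2 \<le> n" and q: "prime q" and t: "0 < t" "t \<le> q" and pos: "0 < T" "0 < R" "0 < G"
    and nq: "n ^ 2 \<le> q"
    and U: "2 * (q ^ t) ^ R < U" "(n ^ 6) ^ (R * G * T) < U" "2 ^ G < U" "R * 2 ^ n < U"
      "n * n < U" "R * G * T < U"  "3 * T * q < U" "4 * n * q < U" "t < U"
begin

abbreviation "Q \<equiv> q ^ t"
abbreviation "D \<equiv> n ^ 6"
abbreviation "rep_seed A k \<equiv> A div Q ^ (k div G) mod Q"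

definition bucket :: "nat \<Rightarrow> nat \<Rightarrow> nat \<Rightarrow> nat" where
  "bucket A e k = hash q t (rep_seed A k) e div 2 ^ (k mod G)"

text \<open>A cell holds the number of its edges plus \<open>n ^ 2\<close> times the sum of their ids, which identifies the
  edge of a cell with a single edge. The cells of all pairs \<open>k\<close> of repetition and level are the digits
  of the register \<open>S\<close> in base \<open>D\<close>, so that every update is one addition or subtraction.\<close>

definition contrib :: "nat \<Rightarrow> nat \<Rightarrow> nat \<Rightarrow> nat" where
  "contrib A e k = (if bucket A e k < T then (1 + e * n ^ 2) * D ^ (k * T + bucket A e k) else 0)"

definition par :: "nat \<Rightarrow> store \<Rightarrow> bool" where
  "par A s \<longleftrightarrow> s ''n'' = n \<and> s ''q'' = q \<and> s ''t'' = t \<and> s ''T'' = T \<and> s ''R'' = R \<and> s ''G'' = G \<and>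
     s ''Q'' = Q \<and> s ''D'' = D \<and> s ''A'' = A"

lemma q1: "1 < q" using q prime_gt_1_nat by blast

lemma Q0: "0 < Q" using q1 by simp

lemma QU: "Q < U" and qU: "q < U"
proof -
  have "Q ^ 1 \<le> Q ^ R" using pos Q0 by (intro power_increasing) auto
  then show 1: "Q < U" using U(1) by simp
  have "q ^ 1 \<le> q ^ t" using t q1 by (intro power_increasing) auto
  then show "q < U" using 1 by simp
qed

lemma idx_less: "k < R * G \<Longrightarrow> b < T \<Longrightarrow> k * T + b < R * G * T"
proof -
  assume "k < R * G" "b < T"
  then have "Suc k * T \<le> R * G * T" by (intro mult_right_mono) auto
  then show ?thesis using \<open>b < T\<close> by simp
qed

lemma contrib_less:
  assumes "k < R * G" "e < n ^ 2" "bucket A e k < T"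
  shows "(1 + e * n ^ 2) * D ^ (k * T + bucket A e k) < U"
proof -
  have "(e + 1) * n ^ 2 \<le> n ^ 2 * n ^ 2" using assms(2) by (intro mult_right_mono) auto
  moreover have "1 \<le> n ^ 2" using n by simp
  ultimately have "1 + e * n ^ 2 \<le> n ^ 4" by (simp add: algebra_simps flip: power_add)
  also have "\<dots> \<le> D" using n by (intro power_increasing) auto
  finally have "(1 + e * n ^ 2) * D ^ (k * T + bucket A e k) \<le> D * D ^ (k * T + bucket A e k)"
    by (rule mult_right_mono) simp
  also have "\<dots> = D ^ Suc (k * T + bucket A e k)" by simp
  also have "\<dots> \<le> D ^ (R * G * T)" using idx_less[OF assms(1,3)] n by (intro power_increasing) auto
  finally show ?thesis using U(2) by simp
qed

lemma wp_update_body: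
  assumes par: "par A s" and k: "s ''k'' = k" "k < R * G" and e: "s ''e'' = e" "e < n ^ 2"
    and S: "s ''S'' < U" "s ''op'' \<noteq> 0 \<Longrightarrow> s ''S'' + contrib A e k < U"
  shows "wp U update_body (\<lambda>s'. agree {''P'', ''x'', ''y'', ''w'', ''j'', ''S'', ''k''} s s' \<and> s' ''k'' = Suc k \<and>
     s' ''S'' = (if s ''op'' \<noteq> 0 then s ''S'' + contrib A e k else s ''S'' - contrib A e k)) s"
proof -
  define s1 where "s1 = s(''P'' := Q ^ (k div G), ''x'' := rep_seed A k)"
  have kd: "k div G < R" "k mod G < G" using k pos by (auto simp: less_mult_imp_div_less)
  have P1: "Q ^ (k div G) < U"
  proof -
    have "Q ^ (k div G) \<le> Q ^ R" using kd Q0 by (intro power_increasing) auto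
    then show ?thesis using U(1) by simp
  qed
  have P2: "2 ^ (k mod G) < U"
  proof -
    have "(2::nat) ^ (k mod G) \<le> 2 ^ G" using kd by (intro power_increasing) auto
    then show ?thesis using U(3) by linarith
  qed
  have aU: "rep_seed A k < U" using QU Q0 by (meson less_trans mod_less_divisor)
  have hU: "hash q t (rep_seed A k) e div 2 ^ (k mod G) < U"
    using hash_less[of q t "rep_seed A k" e] q1 qU by (meson div_le_dividend le_less_trans less_trans zero_less_one)
  have kU: "Suc k < U"
  proof -
    have "Suc k * 1 \<le> R * G * T" using k pos by (intro mult_mono) auto
    then show ?thesis using U(6) by simp
  qed
  have wh: "wp U hash_prog (\<lambda>s'. agree {''y'', ''w'', ''j'', ''x''} s1 s' \<and>
      s' ''y'' = hash q t (s1 ''x'') (s1 ''e'')) s1"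
    by (rule wp_hash_prog) (use par q1 qU aU U(9) in \<open>simp_all add: s1_def par_def\<close>)
  have "wp U hash_prog (wp U cell_update (\<lambda>s'. agree {''P'', ''x'', ''y'', ''w'', ''j'', ''S'', ''k''} s s' \<and> s' ''k'' = Suc k \<and>
     s' ''S'' = (if s ''op'' \<noteq> 0 then s ''S'' + contrib A e k else s ''S'' - contrib A e k))) s1"
  proof (rule wp_conseq[OF wh])
    fix s' assume s': "agree {''y'', ''w'', ''j'', ''x''} s1 s' \<and> s' ''y'' = hash q t (s1 ''x'') (s1 ''e'')"
    then have ag: "agree {''y'', ''w'', ''j'', ''x''} s1 s'" by blast
    have v: "s' ''k'' = k" "s' ''G'' = G" "s' ''T'' = T" "s' ''D'' = D" "s' ''e'' = e" "s' ''n'' = n"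
      "s' ''op'' = s ''op''" "s' ''S'' = s ''S''"
      using par k e by (simp_all add: agreeD[OF ag] s1_def par_def)
    have y: "s' ''y'' = hash q t (rep_seed A k) e" using s' e by (simp add: s1_def)
    have "agree {''P'', ''x'', ''y'', ''w'', ''j'', ''S'', ''k''} s s1"
      unfolding s1_def by (intro agree_upd agree_refl) auto
    then have ag': "agree {''P'', ''x'', ''y'', ''w'', ''j'', ''S'', ''k''} s s'"
      using ag by (rule agree_trans) auto
    have DU: "D ^ (k * T + bucket A e k) < U" if "bucket A e k < T"
      using contrib_less[OF k(2) e(2) that] by (rule le_less_trans[rotated]) simp
    show "wp U cell_update (\<lambda>s'. agree {''P'', ''x'', ''y'', ''w'', ''j'', ''S'', ''k''} s s' \<and> s' ''k'' = Suc k \<and>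
     s' ''S'' = (if s ''op'' \<noteq> 0 then s ''S'' + contrib A e k else s ''S'' - contrib A e k)) s'"
    proof -
      have yb: "s' ''y'' div 2 ^ (k mod G) = bucket A e k" by (simp add: y bucket_def)
      have bU: "bucket A e k < U" using hU by (simp add: bucket_def)
      have c: "D ^ (k * T + bucket A e k) * (1 + e * (n * n)) = contrib A e k" if "bucket A e k < T"
        using that by (simp add: contrib_def power2_eq_square mult.commute)
      have cU: "contrib A e k < U" using contrib_less[OF k(2) e(2), of A] kU by (simp add: contrib_def)
      have SU: "s ''S'' - contrib A e k < U" using S(1) by linarith
      show ?thesis
      proof (cases "bucket A e k < T")
        case True
        let ?s = "s'(''P'' := 2 ^ (k mod G), ''y'' := bucket A e k, ''P'' := D ^ (k * T + bucket A e k), ''x'' := contrib A e k)"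
        have S': "wp U (If (Reg ''op'') (''S'' ::= Reg ''S'' \<oplus> Reg ''x'') (''S'' ::= Reg ''S'' \<ominus> Reg ''x''))
            (wp U (''k'' ::= Reg ''k'' \<oplus> Num 1) (\<lambda>s'. agree {''P'', ''x'', ''y'', ''w'', ''j'', ''S'', ''k''} s s' \<and> s' ''k'' = Suc k \<and>
              s' ''S'' = (if s ''op'' \<noteq> 0 then s ''S'' + contrib A e k else s ''S'' - contrib A e k))) ?s"
          using S(2) SU kU ag' by (cases "s ''op'' = 0") (simp_all add: wp_simps v agree_upd)
        show ?thesis unfolding cell_update_def
          by (rule wp_Seq, rule wp_AssignI[where k = "2 ^ (k mod G)"], simp add: v, rule P2,
              rule wp_Seq, rule wp_AssignI[where k = "bucket A e k"], simp add: yb, rule bU,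
              rule wp_Seq, rule wp_IfTrue, simp add: v True,
              rule wp_Seq, rule wp_AssignI[where k = "D ^ (k * T + bucket A e k)"], simp add: v, rule DU[OF True],
              rule wp_Seq, rule wp_AssignI[where k = "contrib A e k"], simp add: v c[OF True, simplified], rule cU, rule S')
      next
        case False
        then have "contrib A e k = 0" by (simp add: contrib_def)
        then show ?thesis using ag' False S(1)
          by (simp add: cell_update_def wp_simps v yb bU P2 kU agree_upd)
      qed
    qed
  qed
  then have "wp U hash_prog (wp U cell_update (\<lambda>s'. agree {''P'', ''x'', ''y'', ''w'', ''j'', ''S'', ''k''} s s' \<and> s' ''k'' = Suc k \<and>
     s' ''S'' = (if s ''op'' \<noteq> 0 then s ''S'' + contrib A e k else s ''S'' - contrib A e k)))
     (s(''P'' := s ''Q'' ^ (s ''k'' div s ''G''), ''x'' := s ''A'' div s ''Q'' ^ (s ''k'' div s ''G'') mod s ''Q''))"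
    using par k by (simp only: s1_def par_def)
  then show ?thesis unfolding update_body_def wp_simps
    using par k P1 aU by (simp add: par_def)
qed

lemma par_agree: "par A s \<Longrightarrow> agree V s s' \<Longrightarrow>
    V \<inter> {''n'', ''q'', ''t'', ''T'', ''R'', ''G'', ''Q'', ''D'', ''A''} = {} \<Longrightarrow> par A s'"
  unfolding par_def agree_def by (simp add: disjoint_iff) metis

abbreviation "edge_contrib A e \<equiv> \<Sum>k<R * G. contrib A e k"

lemma wp_update_com:
  assumes par: "par A s" and e: "(if s ''u'' < s ''v'' then s ''u'' * n + s ''v'' else s ''v'' * n + s ''u'') = e" "e < n ^ 2"
    and S: "s ''S'' < U" "s ''op'' \<noteq> 0 \<Longrightarrow> s ''S'' + edge_contrib A e < U" "s ''m'' + 1 < U"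
  shows "wp U update_com (\<lambda>s'. par A s' \<and>
     s' ''S'' = (if s ''op'' \<noteq> 0 then s ''S'' + edge_contrib A e else s ''S'' - edge_contrib A e) \<and>
     s' ''m'' = (if s ''op'' \<noteq> 0 then s ''m'' + 1 else s ''m'' - 1)) s"
proof -
  let ?V = "{''P'', ''x'', ''y'', ''w'', ''j'', ''S'', ''k''}"
  define s1 where "s1 = s(''e'' := e, ''k'' := 0)"
  \<comment> \<open>Truncated subtraction satisfies \<open>a - b - c = a - (b + c)\<close>, so the
    invariant holds for deletions without knowing yet that the edge is contained in the
    sketch.\<close>
  define I where "I k s' \<longleftrightarrow> agree ?V s1 s' \<and> s' ''k'' = k \<and>
    s' ''S'' = (if s ''op'' \<noteq> 0 then s ''S'' + (\<Sum>k<k. contrib A e k) else s ''S'' - (\<Sum>k<k. contrib A e k))" for k s'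
  have par1: "par A s1" using par by (simp add: s1_def par_def)
  have loop: "wp U (While (Reg ''k'' \<prec> Reg ''R'' \<otimes> Reg ''G'') update_body) (I (R * G)) s1"
  proof (rule wp_While_count[where I = I and N = "R * G"])
    show "I 0 s1" by (simp add: I_def agree_refl s1_def)
    show "aval (Reg ''k'' \<prec> Reg ''R'' \<otimes> Reg ''G'') s' = 0 \<and> I (R * G) s'" if "I (R * G) s'" for s'
    proof -
      have "par A s'" using that par1 par_agree unfolding I_def by blast
      then show ?thesis using that by (simp add: par_def I_def)
    qed
    fix k s' assume k: "k < R * G" and I: "I k s'"
    have ag: "agree ?V s1 s'" using I unfolding I_def by blast
    have par': "par A s'" using par_agree[OF par1 ag] by simp
    have v: "s' ''e'' = e" "s' ''op'' = s ''op''" by (simp_all add: agreeD[OF ag] s1_def)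
    have le: "(\<Sum>k<k. contrib A e k) + contrib A e k \<le> edge_contrib A e"
    proof -
      have "(\<Sum>k<Suc k. contrib A e k) \<le> edge_contrib A e" using k by (intro sum_mono2) auto
      then show ?thesis by simp
    qed
    have "wp U update_body (\<lambda>s''. agree ?V s' s'' \<and> s'' ''k'' = Suc k \<and>
       s'' ''S'' = (if s' ''op'' \<noteq> 0 then s' ''S'' + contrib A e k else s' ''S'' - contrib A e k)) s'"
    proof (rule wp_update_body[OF par' _ k v(1) e(2)])
      show "s' ''k'' = k" using I by (simp add: I_def)
      show "s' ''S'' < U" using I S le by (auto simp: I_def)
      show "s' ''S'' + contrib A e k < U" if "s' ''op'' \<noteq> 0" using that I S(2) le v by (auto simp: I_def)
    qed
    then have "wp U update_body (I (Suc k)) s'"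
    proof (rule wp_conseq)
      fix s'' assume s'': "agree ?V s' s'' \<and> s'' ''k'' = Suc k \<and>
       s'' ''S'' = (if s' ''op'' \<noteq> 0 then s' ''S'' + contrib A e k else s' ''S'' - contrib A e k)"
      moreover have "agree ?V s1 s''" using ag s'' agree_trans by blast
      ultimately show "I (Suc k) s''" using I v by (simp add: I_def)
    qed
    then show "aval (Reg ''k'' \<prec> Reg ''R'' \<otimes> Reg ''G'') s' \<noteq> 0 \<and> wp U update_body (I (Suc k)) s'"
      using par' k I by (simp add: par_def I_def)
  qed
  define Post where "Post = (\<lambda>s'. par A s' \<and>
     s' ''S'' = (if s ''op'' \<noteq> 0 then s ''S'' + edge_contrib A e else s ''S'' - edge_contrib A e) \<and>
     s' ''m'' = (if s ''op'' \<noteq> 0 then s ''m'' + 1 else s ''m'' - 1))"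
  have "wp U (While (Reg ''k'' \<prec> Reg ''R'' \<otimes> Reg ''G'') update_body)
     (wp U (If (Reg ''op'') (''m'' ::= Reg ''m'' \<oplus> Num 1) (''m'' ::= Reg ''m'' \<ominus> Num 1)) Post) s1"
  proof (rule wp_conseq[OF loop])
    fix s' assume I: "I (R * G) s'"
    have ag: "agree ?V s1 s'" using I unfolding I_def by blast
    have par': "par A s'" using par_agree[OF par1 ag] by simp
    have v: "s' ''m'' = s ''m''" "s' ''op'' = s ''op''" by (simp_all add: agreeD[OF ag] s1_def)
    show "wp U (If (Reg ''op'') (''m'' ::= Reg ''m'' \<oplus> Num 1) (''m'' ::= Reg ''m'' \<ominus> Num 1)) Post s'"
    proof -
      have "s ''m'' - 1 < U" using S(3) by linarith
      then show ?thesis using v par' I S(3) by (simp add: wp_simps par_def I_def Post_def)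
    qed
  qed
  then have main: "wp U (''k'' ::= Num 0) (wp U (While (Reg ''k'' \<prec> Reg ''R'' \<otimes> Reg ''G'') update_body)
     (wp U (If (Reg ''op'') (''m'' ::= Reg ''m'' \<oplus> Num 1) (''m'' ::= Reg ''m'' \<ominus> Num 1)) Post)) (s(''e'' := e))"
    using S(1) by (simp only: wp_simps(2) aval.simps s1_def) simp
  show ?thesis unfolding update_com_def wp_simps(3) Post_def[symmetric]
  proof (rule wp_If)
    have eU: "e < U" using e(2) U(5) by (simp add: power2_eq_square)
    have n': "s ''n'' = n" using par by (simp add: par_def)
    {
      assume "aval (Reg ''u'' \<prec> Reg ''v'') s \<noteq> 0"
      then have "aval (Reg ''u'' \<otimes> Reg ''n'' \<oplus> Reg ''v'') s = e" using e(1) n' by (simp split: if_splits)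
      then show "wp U (''e'' ::= Reg ''u'' \<otimes> Reg ''n'' \<oplus> Reg ''v'') (wp U (''k'' ::= Num 0)
        (wp U (While (Reg ''k'' \<prec> Reg ''R'' \<otimes> Reg ''G'') update_body)
        (wp U (If (Reg ''op'') (''m'' ::= Reg ''m'' \<oplus> Num 1) (''m'' ::= Reg ''m'' \<ominus> Num 1)) Post))) s"
        using main eU by (simp only: wp_simps(2)[of U "''e''"])
    next
      assume "aval (Reg ''u'' \<prec> Reg ''v'') s = 0"
      then have "aval (Reg ''v'' \<otimes> Reg ''n'' \<oplus> Reg ''u'') s = e" using e(1) n' by (simp split: if_splits)
      then show "wp U (''e'' ::= Reg ''v'' \<otimes> Reg ''n'' \<oplus> Reg ''u'') (wp U (''k'' ::= Num 0)
        (wp U (While (Reg ''k'' \<prec> Reg ''R'' \<otimes> Reg ''G'') update_body)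
        (wp U (If (Reg ''op'') (''m'' ::= Reg ''m'' \<oplus> Num 1) (''m'' ::= Reg ''m'' \<ominus> Num 1)) Post))) s"
        using main eU by (simp only: wp_simps(2)[of U "''e''"])
    }
  qed
qed

end


section \<open>Decoding the sketch\<close>

lemma sum_div_mod:
  fixes f :: "nat \<Rightarrow> nat \<Rightarrow> nat"
  assumes "0 < T"
  shows "(\<Sum>k<N. \<Sum>b<T. f k b) = (\<Sum>i<N * T. f (i div T) (i mod T))"
proof -
  have "(\<Sum>b<T. f k b) = (\<Sum>i\<in>{k * T..<k * T + T}. f (i div T) (i mod T))" for k
    by (rule sum.reindex_bij_witness[where i = "\<lambda>i. i - k * T" and j = "\<lambda>b. k * T + b"])
      (use assms in auto)
  then have "(\<Sum>k<N. \<Sum>b<T. f k b) = (\<Sum>k<N. \<Sum>i\<in>{k * T..<k * T + T}. f (i div T) (i mod T))" by simp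
  then show ?thesis by (simp only: sum.nat_group)
qed

definition bits :: "nat \<Rightarrow> nat \<Rightarrow> nat set" where
  "bits n K = {j. j < n \<and> K div 2 ^ j mod 2 = 1}"

lemma card_bits: "card (bits n K) = (\<Sum>j<n. K div 2 ^ j mod 2)"
proof -
  have "card (bits n K) = (\<Sum>j<n. of_bool (K div 2 ^ j mod 2 = 1))"
    unfolding bits_def by (rule card_Collect_less_sum)
  also have "\<dots> = (\<Sum>j<n. K div 2 ^ j mod 2)" by (rule sum.cong) (auto simp: mod2_eq_if)
  finally show ?thesis .
qed

lemma bits_subset: "bits n K \<subseteq> {..<n}"
  by (auto simp: bits_def)

lemma bits_surj: "S \<subseteq> {..<n} \<Longrightarrow> \<exists>K<2 ^ n. bits n K = S"
proof (induction n arbitrary: S)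
  case 0 then show ?case by (auto simp: bits_def)
next
  case (Suc n)
  from Suc.IH[of "S \<inter> {..<n}"] obtain K where K: "K < 2 ^ n" "bits n K = S \<inter> {..<n}" by auto
  define b :: nat where "b = of_bool (n \<in> S)"
  have d: "(K + b * 2 ^ n) div 2 ^ j mod 2 = (if j = n then b else K div 2 ^ j mod 2)" if "j < Suc n" for j
  proof (cases "j = n")
    case True
    then show ?thesis using K(1) by (simp add: b_def)
  next
    case False
    then have "j < n" using that by simp
    then obtain i where i: "n = j + Suc i" by (auto dest: less_imp_Suc_add)
    have "K + b * 2 ^ n = K + 2 ^ j * (2 * (b * 2 ^ i))" by (simp add: i power_add)
    then have "(K + b * 2 ^ n) div 2 ^ j = K div 2 ^ j + 2 * (b * 2 ^ i)"
      by (simp only: div_mult_self2[OF power_not_zero[OF zero_neq_numeral[symmetric]]])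
    then show ?thesis using False by simp
  qed
  have "bits (Suc n) (K + b * 2 ^ n) = S"
  proof (rule set_eqI)
    fix j
    show "j \<in> bits (Suc n) (K + b * 2 ^ n) \<longleftrightarrow> j \<in> S"
    proof (cases "j < Suc n")
      case True
      have "j \<in> bits n K \<longleftrightarrow> j \<in> S \<inter> {..<n}" using K(2) by simp
      then show ?thesis using True d[OF True] by (auto simp: bits_def b_def)
    next
      case False
      then show ?thesis using Suc.prems by (auto simp: bits_def)
    qed
  qed
  moreover have "K + b * 2 ^ n < 2 ^ Suc n" using K(1) by (simp add: b_def)
  ultimately show ?case by blast
qed

context sketch
begin

definition state :: "nat \<Rightarrow> nat set set \<Rightarrow> nat" where
  "state A E = (\<Sum>e\<in>edge_ids n E {..<n}. \<Sum>k<R * G. contrib A e k)"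

definition in_cell :: "nat \<Rightarrow> nat set set \<Rightarrow> nat \<Rightarrow> nat \<Rightarrow> nat set" where
  "in_cell A E k b = {e \<in> edge_ids n E {..<n}. bucket A e k = b}"

definition cell :: "nat \<Rightarrow> nat set set \<Rightarrow> nat \<Rightarrow> nat \<Rightarrow> nat" where
  "cell A E k b = (\<Sum>e\<in>in_cell A E k b. 1 + e * n ^ 2)"

lemma finite_edge_ids: "graph_on n E \<Longrightarrow> finite (edge_ids n E S)"
  by (rule finite_subset[OF edge_ids_subset]) auto

lemma card_in_cell:
  assumes "graph_on n E" shows "card (in_cell A E k b) < n ^ 2"
proof -
  have "card (in_cell A E k b) \<le> card (edge_ids n E {..<n})"
    unfolding in_cell_def by (rule card_mono) (use finite_edge_ids[OF assms] in auto)
  also have "\<dots> < n ^ 2"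
    using card_graph_less[OF assms] n by (simp add: card_edge_ids[OF assms] induced_edges_univ[OF assms])
  finally show ?thesis .
qed

text \<open>Origin of the base \<open>D = n ^ 6\<close>: a cell has fewer than \<open>n ^ 2\<close>
  edges, and each contributes at most \<open>n ^ 4\<close>.\<close>

lemma cell_less:
  assumes "graph_on n E" shows "cell A E k b < D"
proof -
  have "cell A E k b \<le> (\<Sum>e\<in>in_cell A E k b. n ^ 4)"
    unfolding cell_def
  proof (rule sum_mono)
    fix e assume "e \<in> in_cell A E k b"
    then have "e < n ^ 2" using edge_ids_subset[OF assms] by (fastforce simp: in_cell_def)
    then have "(e + 1) * n ^ 2 \<le> n ^ 2 * n ^ 2" by (intro mult_right_mono) auto
    moreover have "1 \<le> n ^ 2" using n by simp
    ultimately show "1 + e * n ^ 2 \<le> n ^ 4" by (simp add: algebra_simps flip: power_add)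
  qed
  also have "\<dots> = card (in_cell A E k b) * n ^ 4" by simp
  also have "\<dots> < n ^ 2 * n ^ 4" using card_in_cell[OF assms] n by (intro mult_strict_right_mono) auto
  finally show ?thesis by (simp flip: power_add)
qed

text \<open>Exchanging the sums regroups the contributions by cell; since \<open>cell_less\<close>
  excludes carries, the right-hand side is the base-\<open>D\<close> expansion.\<close>

lemma state_digits:
  assumes "graph_on n E"
  shows "state A E = (\<Sum>i<R * G * T. cell A E (i div T) (i mod T) * D ^ i)"
proof -
  let ?I = "edge_ids n E {..<n}"
  have c: "contrib A e k = (\<Sum>b<T. if bucket A e k = b then (1 + e * n ^ 2) * D ^ (k * T + b) else 0)" for e k
    by (simp add: contrib_def)
  have "state A E = (\<Sum>k<R * G. \<Sum>e\<in>?I. contrib A e k)" unfolding state_def by (rule sum.swap)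
  also have "\<dots> = (\<Sum>k<R * G. \<Sum>b<T. \<Sum>e\<in>?I. if bucket A e k = b then (1 + e * n ^ 2) * D ^ (k * T + b) else 0)"
    unfolding c by (intro sum.cong[OF refl] sum.swap)
  also have "\<dots> = (\<Sum>k<R * G. \<Sum>b<T. cell A E k b * D ^ (k * T + b))"
  proof (intro sum.cong[OF refl])
    fix k b
    have "(\<Sum>e\<in>?I. if bucket A e k = b then (1 + e * n ^ 2) * D ^ (k * T + b) else 0)
      = (\<Sum>e\<in>in_cell A E k b. (1 + e * n ^ 2) * D ^ (k * T + b))"
      unfolding in_cell_def by (rule sum.inter_filter[symmetric]) (rule finite_edge_ids[OF assms])
    then show "(\<Sum>e\<in>?I. if bucket A e k = b then (1 + e * n ^ 2) * D ^ (k * T + b) else 0) = cell A E k b * D ^ (k * T + b)"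
      by (simp only: cell_def sum_distrib_right)
  qed
  also have "\<dots> = (\<Sum>i<R * G * T. cell A E (i div T) (i mod T) * D ^ (i div T * T + i mod T))"
    by (rule sum_div_mod) (rule pos)
  finally show ?thesis by simp
qed

lemma state_less: "graph_on n E \<Longrightarrow> state A E < D ^ (R * G * T)"
  unfolding state_digits by (intro sum_digits_less cell_less)

lemma state_digit:
  assumes "graph_on n E" "k < R * G" "b < T"
  shows "state A E div D ^ (k * T + b) mod D = cell A E k b"
  unfolding state_digits[OF assms(1)]
  by (subst digit_of_sum) (use assms idx_less cell_less in auto)

text \<open>The count cannot reach \<open>n ^ 2\<close>, so it does not spill over into the sum of
  ids, which for a single edge is the id itself.\<close>

lemma cell_eq_card:
  assumes "graph_on n E"
  shows "cell A E k b mod n ^ 2 = card (in_cell A E k b)" "cell A E k b div n ^ 2 = (\<Sum>e\<in>in_cell A E k b. e)"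
proof -
  have "cell A E k b = card (in_cell A E k b) + (\<Sum>e\<in>in_cell A E k b. e) * n ^ 2"
    unfolding cell_def sum.distrib by (simp add: sum_distrib_right)
  then show "cell A E k b mod n ^ 2 = card (in_cell A E k b)" "cell A E k b div n ^ 2 = (\<Sum>e\<in>in_cell A E k b. e)"
    using card_in_cell[OF assms, of A k b] n by simp_all
qed

definition cell_count :: "nat \<Rightarrow> nat set set \<Rightarrow> nat \<Rightarrow> nat \<Rightarrow> nat \<Rightarrow> nat" where
  "cell_count A E k K b = (let c = cell A E k b in
     if c mod n ^ 2 = 1 then (K div 2 ^ (c div n ^ 2 div n) mod 2) * (K div 2 ^ (c div n ^ 2 mod n) mod 2) else 0)"

lemma edge_ids_iff:
  assumes "graph_on n E" "e \<in> edge_ids n E {..<n}"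
  shows "e \<in> edge_ids n E S \<longleftrightarrow> e div n \<in> S \<and> e mod n \<in> S"
proof
  assume "e \<in> edge_ids n E S"
  then obtain f where "f \<in> E" "f \<subseteq> S" "e = edge_id n f" by (auto simp: edge_ids_def induced_edges_def)
  then show "e div n \<in> S \<and> e mod n \<in> S" using edge_id_decode[OF assms(1)] by blast
next
  assume S: "e div n \<in> S \<and> e mod n \<in> S"
  obtain f where f: "f \<in> E" "e = edge_id n f" using assms(2) by (auto simp: edge_ids_def induced_edges_def)
  then have "f = {e div n, e mod n}" using edge_id_decode[OF assms(1)] by blast
  then have "f \<subseteq> S" using S by auto
  then show "e \<in> edge_ids n E S" using f by (auto simp: edge_ids_def induced_edges_def)
qed

text \<open>A recovered edge is the only occupant of its cell, so mapping edges to cells is a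
  bijection onto the cells with a single edge inside the set, and counting cells counts edges. The
  minimum with \<open>q\<close> is harmless because hash values are below \<open>q\<close>.\<close>

lemma sum_cell_count:
  assumes E: "graph_on n E" and k: "k = r * G + i" "i < G"
  shows "(\<Sum>b<T. cell_count A E k K b) =
    card (recovered n q t (2 ^ i) E (min (T * 2 ^ i) q) (A div Q ^ r mod Q) (bits n K))"
proof -
  let ?a = "A div Q ^ r mod Q"
  let ?rec = "recovered n q t (2 ^ i) E (min (T * 2 ^ i) q) ?a (bits n K)"
  let ?I = "edge_ids n E {..<n}"
  have bk: "bucket A e k = hash q t ?a e div 2 ^ i" for e using k by (simp add: bucket_def)
  define B where "B = {b. b < T \<and> (\<exists>e\<in>edge_ids n E (bits n K). in_cell A E k b = {e})}"
  have Isub: "edge_ids n E (bits n K) \<subseteq> ?I" by (rule edge_ids_mono) (rule bits_subset)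
  have "cell_count A E k K b = of_bool (\<exists>e\<in>edge_ids n E (bits n K). in_cell A E k b = {e})" for b
  proof (cases "card (in_cell A E k b) = 1")
    case True
    then obtain e where e: "in_cell A E k b = {e}" by (auto simp: card_1_singleton_iff)
    then have eI: "e \<in> ?I" by (auto simp: in_cell_def)
    then have en: "e < n * n" using edge_ids_subset[OF E] by (fastforce simp: power2_eq_square)
    have dm: "e div n < n" "e mod n < n" using en n by (auto simp: less_mult_imp_div_less)
    have "cell A E k b mod n ^ 2 = 1" "cell A E k b div n ^ 2 = e" using cell_eq_card[OF E, of A k b] e by auto
    then have "cell_count A E k K b = (K div 2 ^ (e div n) mod 2) * (K div 2 ^ (e mod n) mod 2)"
      by (simp add: cell_count_def)
    also have "\<dots> = of_bool (e div n \<in> bits n K \<and> e mod n \<in> bits n K)"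
      using dm by (auto simp: bits_def mod2_eq_if)
    finally show ?thesis using edge_ids_iff[OF E eI] e by auto
  next
    case False
    then have "\<not> (\<exists>e\<in>edge_ids n E (bits n K). in_cell A E k b = {e})" by auto
    moreover have "cell_count A E k K b = 0" using False cell_eq_card(1)[OF E] by (simp add: cell_count_def)
    ultimately show ?thesis by simp
  qed
  then have "(\<Sum>b<T. cell_count A E k K b) = card B" unfolding B_def by (simp only: card_Collect_less_sum)
  also have "\<dots> = card (?rec)"
  proof (rule bij_betw_same_card[symmetric])
    have rec: "e \<in> ?rec \<longleftrightarrow>
        e \<in> edge_ids n E (bits n K) \<and> bucket A e k < T \<and> in_cell A E k (bucket A e k) = {e}" for e
    proof -
      have "hash q t ?a e < min (T * 2 ^ i) q \<longleftrightarrow> bucket A e k < T"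
        using hash_less[of q t ?a e] q1 by (simp add: bk div_less_iff_less_mult)
      moreover have "isolated q t (2 ^ i) ?I ?a e \<longleftrightarrow> in_cell A E k (bucket A e k) = {e}" if "e \<in> ?I"
        using that by (auto simp: isolated_def in_cell_def bk)
      ultimately show ?thesis using Isub by (auto simp: recovered_def)
    qed
    show "bij_betw (\<lambda>e. bucket A e k) (?rec) B"
    proof (rule bij_betw_imageI)
      show "inj_on (\<lambda>e. bucket A e k) (?rec)"
      proof (rule inj_onI)
        fix x y assume "x \<in> ?rec"
          "y \<in> ?rec" "bucket A x k = bucket A y k"
        then have "{x} = {y}" unfolding rec by metis
        then show "x = y" by simp
      qed
      show "(\<lambda>e. bucket A e k) ` ?rec = B"
      proof (intro equalityI subsetI)
        fix b assume "b \<in> (\<lambda>e. bucket A e k) ` ?rec"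
        then show "b \<in> B" unfolding B_def using rec by blast
      next
        fix b assume "b \<in> B"
        then obtain e where e: "b < T" "e \<in> edge_ids n E (bits n K)" "in_cell A E k b = {e}" by (auto simp: B_def)
        then have "bucket A e k = b" by (auto simp: in_cell_def)
        then show "b \<in> (\<lambda>e. bucket A e k) ` ?rec"
          using e rec by blast
      qed
    qed
  qed
  finally show ?thesis .
qed

end

section \<open>Programs of the output phase\<close>

definition level_body :: com where
  "level_body = (''W'' ::= Num 2 \<otimes> Reg ''W'' ;; ''i'' ::= Reg ''i'' \<oplus> Num 1)"

text \<open>Comparison with \<open>q + 1\<close> expresses \<open>\<le> q\<close> by the strict
  operator; \<open>m + 1\<close> instead of \<open>m\<close> makes the loop stop for the empty graph
  as well.\<close>

abbreviation "level_guard \<equiv> Num 16 \<otimes> ((Reg ''m'' \<oplus> Num 1) \<otimes> Reg ''W'') \<prec> Reg ''q'' \<oplus> Num 1"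

definition level_prog :: com where
  "level_prog =
     (''i'' ::= Num 0 ;; ''W'' ::= Num 1 ;;
      While level_guard level_body ;;
      ''h'' ::= Reg ''T'' \<otimes> Reg ''W'' ;;
      If (Reg ''q'' \<prec> Reg ''h'') (''h'' ::= Reg ''q'') Skip)"

definition bits_body :: com where
  "bits_body =
     (''P'' ::= Num 2 \<up> Reg ''j'' ;;
      ''z'' ::= Reg ''z'' \<oplus> (Reg ''K'' \<oslash> Reg ''P'') \<odot> Num 2 ;;
      ''j'' ::= Reg ''j'' \<oplus> Num 1)"

definition bits_prog :: com where
  "bits_prog = (''z'' ::= Num 0 ;; ''j'' ::= Num 0 ;; While (Reg ''j'' \<prec> Reg ''n'') bits_body)"

definition count_body :: com where
  "count_body =
     (''P'' ::= Reg ''D'' \<up> (Reg ''B'' \<oplus> Reg ''j'') ;;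
      ''C'' ::= (Reg ''S'' \<oslash> Reg ''P'') \<odot> Reg ''D'' ;;
      If (Bin Equal (Reg ''C'' \<odot> (Reg ''n'' \<otimes> Reg ''n'')) (Num 1))
       (''x'' ::= Reg ''C'' \<oslash> (Reg ''n'' \<otimes> Reg ''n'') ;;
        ''P'' ::= Num 2 \<up> (Reg ''x'' \<oslash> Reg ''n'') ;;
        ''y'' ::= Num 2 \<up> (Reg ''x'' \<odot> Reg ''n'') ;;
        ''X'' ::= Reg ''X'' \<oplus> ((Reg ''K'' \<oslash> Reg ''P'') \<odot> Num 2) \<otimes> ((Reg ''K'' \<oslash> Reg ''y'') \<odot> Num 2))
       Skip ;;
      ''j'' ::= Reg ''j'' \<oplus> Num 1)"

definition count_prog :: com where
  "count_prog = (''X'' ::= Num 0 ;; ''j'' ::= Num 0 ;; While (Reg ''j'' \<prec> Reg ''T'') count_body)"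

text \<open>The counter \<open>Y\<close> runs over all pairs of a repetition and a vertex set, the
  latter coded by its characteristic bits \<open>K\<close>. Densities are compared by
  cross-multiplication; the empty set, where \<open>X\<close> and \<open>z\<close> are both 0, can
  never pass the strict test.\<close>

definition max_body :: com where
  "max_body =
     (''K'' ::= Reg ''Y'' \<odot> Reg ''N'' ;;
      ''B'' ::= ((Reg ''Y'' \<oslash> Reg ''N'') \<otimes> Reg ''G'' \<oplus> Reg ''i'') \<otimes> Reg ''T'' ;;
      bits_prog ;;
      count_prog ;;
      If (Reg ''num'' \<otimes> Reg ''z'' \<prec> Reg ''X'' \<otimes> Reg ''den'')
       (''num'' ::= Reg ''X'' ;; ''den'' ::= Reg ''z'') Skip ;;
      ''Y'' ::= Reg ''Y'' \<oplus> Num 1)"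

definition output_com :: com where
  "output_com =
     (level_prog ;;
      ''N'' ::= Num 2 \<up> Reg ''n'' ;; ''num'' ::= Num 0 ;; ''den'' ::= Num 1 ;; ''Y'' ::= Num 0 ;;
      While (Reg ''Y'' \<prec> Reg ''R'' \<otimes> Reg ''N'') max_body ;;
      ''num'' ::= Num 3 \<otimes> Reg ''num'' \<otimes> Reg ''q'' ;;
      ''den'' ::= Num 4 \<otimes> Reg ''den'' \<otimes> Reg ''h'')"

lemma wp_Seq_eq: "wp U (Seq c d) Q = wp U c (wp U d Q)"
  by (rule ext) (rule wp_simps)

context sketch
begin

lemma U_gt: "2 ^ n < U" "n < U" "T < U" "1 < U"
proof -
  have "2 ^ n \<le> R * 2 ^ n" "T \<le> R * G * T" using pos by simp_all
  then show 1: "2 ^ n < U" "T < U" using U(4,6) by linarith+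
  show "n < U" using 1(1) less_exp[of n] by linarith
  then show "1 < U" using n by linarith
qed

definition level :: "nat \<Rightarrow> nat" where
  "level m = (LEAST i. q < 16 * ((m + 1) * 2 ^ i))"

lemma level_upper: "q < 16 * ((m + 1) * 2 ^ level m)"
  unfolding level_def
proof (rule LeastI)
  have "q < 2 ^ q" by simp
  also have "\<dots> \<le> 16 * ((m + 1) * 2 ^ q)" by simp
  finally show "q < 16 * ((m + 1) * 2 ^ q)" .
qed

lemma level_below: "i < level m \<Longrightarrow> 16 * ((m + 1) * 2 ^ i) \<le> q"
  unfolding level_def by (drule not_less_Least) simp

text \<open>Minimality of the level, doubled. Level \<open>0\<close> has no predecessor, so there
  the claim rests on the assumption, which the choice of \<open>q\<close> guarantees later.\<close>

lemma level_lower: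
  assumes "8 * (m + 1) \<le> q" shows "8 * ((m + 1) * 2 ^ level m) \<le> q"
proof (cases "level m")
  case 0 then show ?thesis using assms by simp
next
  case (Suc i)
  then have "16 * ((m + 1) * 2 ^ i) \<le> q" by (intro level_below) simp
  then show ?thesis by (simp add: Suc)
qed

lemma power_level_le: "8 * (m + 1) \<le> q \<Longrightarrow> 2 ^ level m \<le> q"
  using level_lower[of m] by (simp add: algebra_simps)

lemma wp_level_prog:
  assumes par: "par A s" and m: "s ''m'' = m" "8 * (m + 1) \<le> q"
  shows "wp U level_prog (\<lambda>s'. agree {''i'', ''W'', ''h''} s s' \<and> s' ''i'' = level m \<and>
    s' ''h'' = min (T * 2 ^ level m) q) s"
proof -
  let ?V = "{''i'', ''W'', ''h''}"
  define s1 where "s1 = s(''i'' := 0, ''W'' := 1)"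
  define I where "I j s' \<longleftrightarrow> agree ?V s s' \<and> s' ''i'' = j \<and> s' ''W'' = 2 ^ j" for j s'
  have g: "aval level_guard s' = of_bool (16 * ((m + 1) * 2 ^ j) \<le> q)"
    if "I j s'" for j s'
  proof -
    have ag: "agree ?V s s'" using that unfolding I_def by blast
    have "s' ''q'' = q" "s' ''m'' = m" using par m by (simp_all add: agreeD[OF ag] par_def)
    then show ?thesis using that by (auto simp: I_def)
  qed
  have lU: "2 ^ j < U" if "j \<le> level m" for j
  proof -
    have "(2::nat) ^ j \<le> 2 ^ level m" using that by (intro power_increasing) auto
    also note power_level_le[OF m(2)]
    finally show ?thesis using qU by simp
  qed
  have loop: "wp U (While level_guard level_body) (I (level m)) s1"
  proof (rule wp_While_count[where I = I and N = "level m"])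
    show "I 0 s1" by (simp add: I_def s1_def agree_upd agree_refl)
    fix j s' assume j: "j < level m" "I j s'"
    have "2 * 2 ^ j < U" using lU[of "Suc j"] j(1) by simp
    moreover have "Suc j < U" using lU[of "Suc j"] j(1) less_exp[of "Suc j"] by (simp add: less_trans)
    ultimately have "wp U level_body (I (Suc j)) s'"
      using j(2) by (simp add: level_body_def wp_simps I_def agree_upd)
    then show "aval level_guard s' \<noteq> 0 \<and> wp U level_body (I (Suc j)) s'"
      using g[OF j(2)] level_below[OF j(1)] by simp
  next
    fix s' assume I: "I (level m) s'"
    show "aval level_guard s' = 0 \<and> I (level m) s'"
      using g[OF I] level_upper[of m] I by simp
  qed
  have TU: "T * 2 ^ level m < U"
  proof -
    have "T * 2 ^ level m \<le> 3 * T * q" using power_level_le[OF m(2)] by (simp add: mult_le_mono)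
    then show ?thesis using U(7) by linarith
  qed
  have "wp U (While level_guard level_body)
    (wp U (''h'' ::= Reg ''T'' \<otimes> Reg ''W'' ;; If (Reg ''q'' \<prec> Reg ''h'') (''h'' ::= Reg ''q'') Skip)
    (\<lambda>s'. agree ?V s s' \<and> s' ''i'' = level m \<and> s' ''h'' = min (T * 2 ^ level m) q)) s1"
  proof (rule wp_conseq[OF loop])
    fix s' assume I: "I (level m) s'"
    have ag: "agree ?V s s'" using I unfolding I_def by blast
    have v: "s' ''q'' = q" "s' ''T'' = T" using par by (simp_all add: agreeD[OF ag] par_def)
    show "wp U (''h'' ::= Reg ''T'' \<otimes> Reg ''W'' ;; If (Reg ''q'' \<prec> Reg ''h'') (''h'' ::= Reg ''q'') Skip)
    (\<lambda>s'. agree ?V s s' \<and> s' ''i'' = level m \<and> s' ''h'' = min (T * 2 ^ level m) q) s'"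
      using I TU qU by (simp add: wp_simps v I_def agree_upd)
  qed
  then show ?thesis unfolding level_prog_def wp_simps(3)
    using U_gt by (simp add: wp_simps(2) s1_def)
qed

lemma wp_bits_prog:
  assumes par: "par A s" and K: "s ''K'' = K"
  shows "wp U bits_prog (\<lambda>s'. agree {''z'', ''j'', ''P''} s s' \<and> s' ''z'' = card (bits n K)) s"
proof -
  let ?V = "{''z'', ''j'', ''P''}"
  define s1 where "s1 = s(''z'' := 0, ''j'' := 0)"
  define I where "I j s' \<longleftrightarrow> agree ?V s s' \<and> s' ''j'' = j \<and> s' ''z'' = (\<Sum>i<j. K div 2 ^ i mod 2)" for j s'
  note nU = U_gt(2,1)
  have "wp U (While (Reg ''j'' \<prec> Reg ''n'') bits_body) (\<lambda>s'. agree ?V s s' \<and> s' ''z'' = card (bits n K)) s1"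
  proof (rule wp_While_count[where I = I and N = n])
    show "I 0 s1" by (simp add: I_def s1_def agree_upd agree_refl)
  next
    fix s' assume I: "I n s'"
    then have ag: "agree ?V s s'" unfolding I_def by blast
    have "s' ''n'' = n" using par by (simp add: agreeD[OF ag] par_def)
    then show "aval (Reg ''j'' \<prec> Reg ''n'') s' = 0 \<and> agree ?V s s' \<and> s' ''z'' = card (bits n K)"
      using I by (simp add: I_def card_bits)
  next
    fix j s' assume j: "j < n" and I: "I j s'"
    then have ag: "agree ?V s s'" unfolding I_def by blast
    have v: "s' ''n'' = n" "s' ''K'' = K" using par K by (simp_all add: agreeD[OF ag] par_def)
    have P: "2 ^ j < U"
    proof -
      have "(2::nat) ^ j \<le> 2 ^ n" using j by (intro power_increasing) auto
      then show ?thesis using nU by linarith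
    qed
    have "(\<Sum>i<j. K div 2 ^ i mod 2) + K div 2 ^ j mod 2 \<le> (\<Sum>i<Suc j. 1)"
      unfolding sum.lessThan_Suc by (intro add_mono sum_mono) auto
    then have "(\<Sum>i<j. K div 2 ^ i mod 2) + K div 2 ^ j mod 2 < U" "Suc j < U" using j nU by simp_all
    then have "wp U bits_body (I (Suc j)) s'"
      using I P by (simp add: bits_body_def wp_simps I_def v agree_upd)
    then show "aval (Reg ''j'' \<prec> Reg ''n'') s' \<noteq> 0 \<and> wp U bits_body (I (Suc j)) s'"
      using j v I by (simp add: I_def)
  qed
  then show ?thesis unfolding bits_prog_def wp_simps(3) using nU by (simp add: wp_simps(2) s1_def)
qed

lemma cell_count_le: "cell_count A E k K b \<le> 1"
proof -
  have m: "x mod 2 \<le> (1::nat)" for x by simp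
  have "(x mod 2) * (y mod 2) \<le> 1 * (1::nat)" for x y by (intro mult_mono m) auto
  then show ?thesis by (simp add: cell_count_def Let_def)
qed

lemma wp_count_prog:
  assumes par: "par A s" and E: "graph_on n E" and s: "s ''K'' = K" "s ''S'' = state A E" "s ''B'' = k * T" "k < R * G"
  shows "wp U count_prog (\<lambda>s'. agree {''X'', ''j'', ''P'', ''C'', ''x'', ''y''} s s' \<and>
    s' ''X'' = (\<Sum>b<T. cell_count A E k K b)) s"
proof -
  let ?V = "{''X'', ''j'', ''P'', ''C'', ''x'', ''y''}"
  define s1 where "s1 = s(''X'' := 0, ''j'' := 0)"
  define I where "I j s' \<longleftrightarrow> agree ?V s s' \<and> s' ''j'' = j \<and> s' ''X'' = (\<Sum>b<j. cell_count A E k K b)" for j s'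
  note nU = U_gt(1) and TU = U_gt(3)
  have "wp U (While (Reg ''j'' \<prec> Reg ''T'') count_body) (\<lambda>s'. agree ?V s s' \<and> s' ''X'' = (\<Sum>b<T. cell_count A E k K b)) s1"
  proof (rule wp_While_count[where I = I and N = T])
    show "I 0 s1" by (simp add: I_def s1_def agree_upd agree_refl)
  next
    fix s' assume I: "I T s'"
    then have ag: "agree ?V s s'" unfolding I_def by blast
    have "s' ''T'' = T" using par by (simp add: agreeD[OF ag] par_def)
    then show "aval (Reg ''j'' \<prec> Reg ''T'') s' = 0 \<and> agree ?V s s' \<and> s' ''X'' = (\<Sum>b<T. cell_count A E k K b)"
      using I by (simp add: I_def)
  next
    fix j s' assume j: "j < T" and I: "I j s'"
    then have ag: "agree ?V s s'" unfolding I_def by blast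
    have v: "s' ''n'' = n" "s' ''D'' = D" "s' ''K'' = K" "s' ''S'' = state A E" "s' ''B'' = k * T" "s' ''T'' = T"
      using par s by (simp_all add: agreeD[OF ag] par_def)
    have vI: "s' ''j'' = j" "s' ''X'' = (\<Sum>b<j. cell_count A E k K b)" using I by (simp_all add: I_def)
    let ?c = "cell A E k j"
    have P: "D ^ (k * T + j) < U"
    proof -
      have "D ^ (k * T + j) \<le> D ^ (R * G * T)" using idx_less[OF s(4) j] n by (intro power_increasing) auto
      then show ?thesis using U(2) by linarith
    qed
    have C: "state A E div D ^ (k * T + j) mod D = ?c" by (rule state_digit[OF E s(4) j])
    have cU: "?c < U"
    proof -
      have "D ^ 1 \<le> D ^ (R * G * T)" using n pos by (intro power_increasing) auto
      then show ?thesis using U(2) cell_less[OF E, of A k j] by simp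
    qed
    have XU: "(\<Sum>b<j. cell_count A E k K b) + cell_count A E k K j < U" "Suc j < U"
    proof -
      have "(\<Sum>b<Suc j. cell_count A E k K b) \<le> (\<Sum>b<Suc j. 1)" by (intro sum_mono cell_count_le)
      then show "(\<Sum>b<j. cell_count A E k K b) + cell_count A E k K j < U" "Suc j < U" using j TU by simp_all
    qed
    have "wp U count_body (I (Suc j)) s'"
    proof (cases "?c mod n ^ 2 = 1")
      case True
      then obtain e where e: "in_cell A E k j = {e}"
        using cell_eq_card(1)[OF E, of A k j] by (auto simp: card_1_singleton_iff)
      then have ce: "?c div n ^ 2 = e" using cell_eq_card(2)[OF E, of A k j] by simp
      have "e \<in> edge_ids n E {..<n}" using e by (auto simp: in_cell_def)
      then have en: "e < n * n" using edge_ids_subset[OF E] by (fastforce simp: power2_eq_square)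
      then have dm: "e div n < n" "e mod n < n" using n by (auto simp: less_mult_imp_div_less)
      have P2: "2 ^ (e div n) < U" "2 ^ (e mod n) < U"
      proof -
        have "(2::nat) ^ (e div n) \<le> 2 ^ n" "(2::nat) ^ (e mod n) \<le> 2 ^ n"
          using dm by (auto intro!: power_increasing)
        then show "2 ^ (e div n) < U" "2 ^ (e mod n) < U" using nU by linarith+
      qed
      have eU: "e < U" using en U(5) by linarith
      have cc: "cell_count A E k K j = (K div 2 ^ (e div n) mod 2) * (K div 2 ^ (e mod n) mod 2)"
        using True ce by (simp add: cell_count_def)
      have True': "?c mod (n * n) = 1" and ce': "?c div (n * n) = e" using True ce by (simp_all add: power2_eq_square)
      let ?s = "s'(''P'' := D ^ (k * T + j), ''C'' := ?c, ''x'' := e, ''P'' := 2 ^ (e div n), ''y'' := 2 ^ (e mod n),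
        ''X'' := (\<Sum>b<Suc j. cell_count A E k K b))"
      have X': "(\<Sum>b<Suc j. cell_count A E k K b) < U" using XU by simp
      have last: "wp U (''j'' ::= Reg ''j'' \<oplus> Num 1) (I (Suc j)) ?s"
        using XU ag by (simp add: wp_simps vI I_def agree_upd)
      show ?thesis unfolding count_body_def
        by (rule wp_Seq, rule wp_AssignI[where k = "D ^ (k * T + j)"], simp add: v vI, rule P,
            rule wp_Seq, rule wp_AssignI[where k = "?c"], simp add: v C, rule cU,
            rule wp_Seq, rule wp_IfTrue, simp add: v True',
            rule wp_Seq, rule wp_AssignI[where k = e], simp add: v ce', rule eU,
            rule wp_Seq, rule wp_AssignI[where k = "2 ^ (e div n)"], simp add: v, rule P2,
            rule wp_Seq, rule wp_AssignI[where k = "2 ^ (e mod n)"], simp add: v, rule P2,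
            rule wp_AssignI[where k = "\<Sum>b<Suc j. cell_count A E k K b"], simp add: v vI cc, rule X', rule last)
    next
      case False
      then have "cell_count A E k K j = 0" by (simp add: cell_count_def Let_def)
      moreover have "?c mod (n * n) \<noteq> 1" using False by (simp add: power2_eq_square)
      ultimately show ?thesis
        using P C cU XU ag by (simp add: count_body_def wp_simps v vI I_def agree_upd)
    qed
    then show "aval (Reg ''j'' \<prec> Reg ''T'') s' \<noteq> 0 \<and> wp U count_body (I (Suc j)) s'"
      using j v vI by simp
  qed
  then show ?thesis unfolding count_prog_def wp_simps(3) using nU by (simp add: wp_simps(2) s1_def)
qed

definition sample_size :: "nat \<Rightarrow> nat set set \<Rightarrow> nat \<Rightarrow> nat" where
  "sample_size A E y = (\<Sum>b<T. cell_count A E (y div 2 ^ n * G + level (card E)) (y mod 2 ^ n) b)"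

lemma sample_size_le: "sample_size A E y \<le> T"
proof -
  have "sample_size A E y \<le> (\<Sum>b<T. 1)" unfolding sample_size_def by (intro sum_mono cell_count_le)
  then show ?thesis by simp
qed

lemma card_bits_le: "card (bits n K) \<le> n"
  using card_mono[OF _ bits_subset[of n K]] by simp

lemma level_less:
  assumes "8 * (m + 1) \<le> q" "q < 2 ^ G" shows "level m < G"
proof -
  have "(2::nat) ^ level m < 2 ^ G" using power_level_le[OF assms(1)] assms(2) by linarith
  then show ?thesis by simp
qed

lemma sample_size_eq:
  assumes "graph_on n E" "level (card E) < G"
  shows "sample_size A E y = card (recovered n q t (2 ^ level (card E)) E (min (T * 2 ^ level (card E)) q)
    (A div Q ^ (y div 2 ^ n) mod Q) (bits n (y mod 2 ^ n)))"
  unfolding sample_size_def by (rule sum_cell_count[OF assms(1) refl assms(2)])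

lemma sample_size_empty:
  assumes E: "graph_on n E" and "level (card E) < G" and b: "card (bits n (y mod 2 ^ n)) = 0"
  shows "sample_size A E y = 0"
proof -
  have "finite (bits n (y mod 2 ^ n))" using bits_subset finite_subset by blast
  then have "bits n (y mod 2 ^ n) = {}" using b by simp
  moreover have "edge_ids n E {} = {}" using E by (auto simp: edge_ids_def induced_edges_def graph_on_def)
  ultimately show ?thesis by (simp add: sample_size_eq[OF assms(1,2)] recovered_def)
qed

text \<open>The inequalities between densities are free of division, as in the program. The
  alternative \<open>num = 0\<close> covers the initial fraction \<open>0 / 1\<close>, which need
  not be the density of any set seen so far.\<close>

definition maximal_upto :: "nat \<Rightarrow> nat set set \<Rightarrow> nat \<Rightarrow> store \<Rightarrow> bool" where
  "maximal_upto A E y s \<longleftrightarrow> 0 < s ''den'' \<and> s ''den'' \<le> n \<and> s ''num'' \<le> T \<and>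
     (\<forall>x<y. sample_size A E x * s ''den'' \<le> s ''num'' * card (bits n (x mod 2 ^ n))) \<and>
     (s ''num'' = 0 \<or> (\<exists>x<y. sample_size A E x = s ''num'' \<and> card (bits n (x mod 2 ^ n)) = s ''den''))"

abbreviation "max_regs \<equiv> {''K'', ''B'', ''z'', ''j'', ''P'', ''X'', ''C'', ''x'', ''y'', ''num'', ''den'', ''Y''}"

lemma maximal_upto_skip:
  assumes "maximal_upto A E y s" "sample_size A E y * s ''den'' \<le> s ''num'' * card (bits n (y mod 2 ^ n))"
    "s' ''num'' = s ''num''" "s' ''den'' = s ''den''"
  shows "maximal_upto A E (Suc y) s'"
  using assms unfolding maximal_upto_def by (auto simp: less_Suc_eq)

text \<open>Transitivity of the comparison of fractions by cross-multiplication, for which the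
  denominators must be positive; the new one is, because an empty set has no sampled edges and would
  fail the strict test.\<close>

lemma maximal_upto_update:
  assumes m: "maximal_upto A E y s" and less: "s ''num'' * card (bits n (y mod 2 ^ n)) < sample_size A E y * s ''den''"
    and E: "graph_on n E" "level (card E) < G"
    and s': "s' ''num'' = sample_size A E y" "s' ''den'' = card (bits n (y mod 2 ^ n))"
  shows "maximal_upto A E (Suc y) s'"
proof -
  let ?z = "\<lambda>x. card (bits n (x mod 2 ^ n))"
  have den: "0 < s ''den''" using m by (simp add: maximal_upto_def)
  have z: "0 < ?z y"
  proof (rule ccontr)
    assume "\<not> 0 < ?z y"
    then have "sample_size A E y = 0" using sample_size_empty[OF E] by simp
    then show False using less by simp
  qed
  have "sample_size A E x * ?z y \<le> sample_size A E y * ?z x" if "x < y" for x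
  proof -
    have "sample_size A E x * s ''den'' \<le> s ''num'' * ?z x" using m that by (simp add: maximal_upto_def)
    then have "sample_size A E x * s ''den'' * ?z y \<le> s ''num'' * ?z x * ?z y" by (rule mult_right_mono) simp
    also have "\<dots> = s ''num'' * ?z y * ?z x" by simp
    also have "\<dots> \<le> sample_size A E y * s ''den'' * ?z x" using less by (intro mult_right_mono) auto
    finally have "(sample_size A E x * ?z y) * s ''den'' \<le> (sample_size A E y * ?z x) * s ''den''"
      by (simp only: mult_ac)
    then show ?thesis using den by simp
  qed
  then show ?thesis
    using z s' card_bits_le sample_size_le by (auto simp: maximal_upto_def less_Suc_eq)
qed

lemma wp_max_body:
  assumes par: "par A s" and E: "graph_on n E" "level (card E) < G"
    and s: "s ''S'' = state A E" "s ''i'' = level (card E)" "s ''N'' = 2 ^ n" "s ''Y'' = y" "y < R * 2 ^ n"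
    and m: "maximal_upto A E y s"
  shows "wp U max_body (\<lambda>s'. agree max_regs s s' \<and> s' ''Y'' = Suc y \<and> maximal_upto A E (Suc y) s') s"
proof -
  define k where "k = y div 2 ^ n * G + level (card E)"
  define K where "K = y mod 2 ^ n"
  define s1 where "s1 = s(''K'' := K, ''B'' := k * T)"
  have "y div 2 ^ n < R" using s(5) by (simp add: less_mult_imp_div_less)
  then have "Suc (y div 2 ^ n) * G \<le> R * G" by (intro mult_right_mono) auto
  then have k: "k < R * G" using E(2) by (simp add: k_def)
  then have kT: "k * T < U"
  proof -
    have "k * T \<le> R * G * T" using k by (intro mult_right_mono) auto
    then show ?thesis using U(6) by linarith
  qed
  have "K < 2 ^ n" by (simp add: K_def)
  then have KU: "K < U" using U_gt(1) by linarith
  have par1: "par A s1" using par by (simp add: s1_def par_def)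
  have ag1: "agree max_regs s s1" by (simp add: s1_def agree_upd agree_refl)
  let ?tail = "If (Reg ''num'' \<otimes> Reg ''z'' \<prec> Reg ''X'' \<otimes> Reg ''den'')
       (''num'' ::= Reg ''X'' ;; ''den'' ::= Reg ''z'') Skip ;;
      ''Y'' ::= Reg ''Y'' \<oplus> Num 1"
  define Post where "Post s' \<longleftrightarrow> agree max_regs s s' \<and> s' ''Y'' = Suc y \<and> maximal_upto A E (Suc y) s'" for s'
  have tail: "wp U ?tail Post s3"
    if ag: "agree max_regs s s3" and v: "s3 ''num'' = s ''num''" "s3 ''den'' = s ''den''" "s3 ''Y'' = y"
      "s3 ''z'' = card (bits n K)" "s3 ''X'' = sample_size A E y" for s3
  proof -
    have b: "Suc y < U" using s(5) U(4) by simp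
    have c: "card (bits n K) < U" "sample_size A E y < U"
      using card_bits_le[of K] sample_size_le[of A E y] U_gt by linarith+
    show ?thesis
    proof (cases "s ''num'' * card (bits n K) < sample_size A E y * s ''den''")
      case True
      have "maximal_upto A E (Suc y) (s3(''num'' := sample_size A E y, ''den'' := card (bits n K), ''Y'' := Suc y))"
        by (rule maximal_upto_update[OF m _ E]) (use True in \<open>simp_all add: K_def\<close>)
      then show ?thesis using True ag b c by (simp add: wp_simps v Post_def agree_upd)
    next
      case False
      have "maximal_upto A E (Suc y) (s3(''Y'' := Suc y))"
        by (rule maximal_upto_skip[OF m]) (use False in \<open>simp_all add: K_def v\<close>)
      then show ?thesis using False ag b c by (simp add: wp_simps v Post_def agree_upd)
    qed
  qed
  have "wp U bits_prog (wp U count_prog (wp U ?tail Post)) s1"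
  proof (rule wp_conseq[OF wp_bits_prog[OF par1]])
    show "s1 ''K'' = K" by (simp add: s1_def)
    fix s2 assume s2: "agree {''z'', ''j'', ''P''} s1 s2 \<and> s2 ''z'' = card (bits n K)"
    then have ag2: "agree {''z'', ''j'', ''P''} s1 s2" by blast
    have par2: "par A s2" using par_agree[OF par1 ag2] by simp
    have ag2': "agree max_regs s s2" by (rule agree_trans[OF ag1 ag2]) auto
    show "wp U count_prog (wp U ?tail Post) s2"
    proof (rule wp_conseq[OF wp_count_prog[OF par2 E(1) _ _ _ k]])
      show "s2 ''K'' = K" "s2 ''S'' = state A E" "s2 ''B'' = k * T"
        using s by (simp_all add: agreeD[OF ag2] s1_def)
      fix s3 assume s3: "agree {''X'', ''j'', ''P'', ''C'', ''x'', ''y''} s2 s3 \<and> s3 ''X'' = (\<Sum>b<T. cell_count A E k K b)"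
      then have ag3: "agree {''X'', ''j'', ''P'', ''C'', ''x'', ''y''} s2 s3" by blast
      have ag3': "agree max_regs s s3" by (rule agree_trans[OF ag2' ag3]) auto
      show "wp U ?tail Post s3"
      proof (rule tail[OF ag3'])
        show "s3 ''num'' = s ''num''" "s3 ''den'' = s ''den''" "s3 ''Y'' = y" "s3 ''z'' = card (bits n K)"
          using s s2 by (simp_all add: agreeD[OF ag3] agreeD[OF ag2] s1_def)
        show "s3 ''X'' = sample_size A E y" using s3 by (simp add: sample_size_def k_def K_def)
      qed
    qed
  qed
  then have main: "wp U bits_prog (wp U count_prog (wp U (If (Reg ''num'' \<otimes> Reg ''z'' \<prec> Reg ''X'' \<otimes> Reg ''den'')
       (''num'' ::= Reg ''X'' ;; ''den'' ::= Reg ''z'') Skip) (wp U (''Y'' ::= Reg ''Y'' \<oplus> Num 1) Post))) s1"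
    by (simp only: wp_Seq_eq)
  have v: "s ''G'' = G" "s ''T'' = T" using par by (simp_all add: par_def)
  show ?thesis unfolding max_body_def Post_def[symmetric] wp_simps(3)
    by (rule wp_AssignI[where k = K], simp add: s K_def, rule KU,
        rule wp_AssignI[where k = "k * T"], simp add: s v k_def, rule kT, rule main[unfolded s1_def])
qed

abbreviation "good E \<equiv> good_seed n q t (2 ^ level (card E)) E (min (T * 2 ^ level (card E)) q) R"

text \<open>Randomness enters only through the premise on the seed \<open>A\<close>. At the end of
  the loop \<open>num / den\<close> is an upper bound for all sampled densities and is 0 or
  attained, which is what \<open>good_seed\<close> asks of \<open>x\<close>.\<close>

lemma wp_output_com:
  assumes par: "par A s" and E: "graph_on n E" and s: "s ''S'' = state A E" "s ''m'' = card E"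
    and q8: "8 * (card E + 1) \<le> q" and qG: "q < 2 ^ G"
  shows "wp U output_com (\<lambda>s'. good E A \<longrightarrow>
     max_density n E / 2 \<le> real (s' ''num'') / real (s' ''den'') \<and>
     real (s' ''num'') / real (s' ''den'') \<le> max_density n E) s"
proof -
  define \<theta> where "\<theta> = min (T * 2 ^ level (card E)) q"
  have th: "0 < \<theta>" "\<theta> \<le> q" using pos q1 by (auto simp: \<theta>_def)
  have lG: "level (card E) < G" by (rule level_less[OF q8 qG])
  define Post where "Post s' \<longleftrightarrow> (good_seed n q t (2 ^ level (card E)) E \<theta> R A \<longrightarrow>
     max_density n E / 2 \<le> real (s' ''num'') / real (s' ''den'') \<and>
     real (s' ''num'') / real (s' ''den'') \<le> max_density n E)" for s' :: store
  define tail where "tail = (''num'' ::= Num 3 \<otimes> Reg ''num'' \<otimes> Reg ''q'' ;; ''den'' ::= Num 4 \<otimes> Reg ''den'' \<otimes> Reg ''h'')"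
  have tail: "wp U tail Post s'" if m: "maximal_upto A E (R * 2 ^ n) s'" and v: "s' ''q'' = q" "s' ''h'' = \<theta>" for s'
  proof -
    define N d where "N = s' ''num''" and "d = s' ''den''"
    have d: "0 < d" "d \<le> n" "N \<le> T" using m by (simp_all add: maximal_upto_def N_def d_def)
    have "3 * N * q \<le> 3 * T * q" "4 * d * \<theta> \<le> 4 * n * q" using d th by (auto intro: mult_le_mono)
    then have b: "3 * N * q < U" "4 * d * \<theta> < U" using U(7,8) by linarith+
    have "max_density n E / 2 \<le> real (3 * N * q) / real (4 * d * \<theta>) \<and> real (3 * N * q) / real (4 * d * \<theta>) \<le> max_density n E"
      if good: "good_seed n q t (2 ^ level (card E)) E \<theta> R A"
    proof -
      define x where "x = real N / real d"
      have x: "real N = x * real d" using d by (simp add: x_def)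
      let ?rec = "\<lambda>r S. recovered n q t (2 ^ level (card E)) E \<theta> (A div Q ^ r mod Q) S"
      have sz: "sample_size A E (r * 2 ^ n + K) = card (?rec r (bits n K))" if "K < 2 ^ n" for r K
        using that by (simp add: sample_size_eq[OF E lG] \<theta>_def)
      have "real (card (?rec r S)) \<le> x * real (card S)" if "r < R" and S: "S \<subseteq> {..<n}" for r S
      proof -
        obtain K where K: "K < 2 ^ n" "bits n K = S" using bits_surj[OF S] by blast
        have "Suc r * 2 ^ n \<le> R * 2 ^ n" using that by (intro mult_right_mono) auto
        then have "r * 2 ^ n + K < R * 2 ^ n" using K by simp
        then have "sample_size A E (r * 2 ^ n + K) * d \<le> N * card (bits n ((r * 2 ^ n + K) mod 2 ^ n))"
          using m unfolding maximal_upto_def N_def d_def by blast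
        then have "card (?rec r S) * d \<le> N * card S" using K by (simp add: sz)
        then have "real (card (?rec r S) * d) \<le> real (N * card S)" by (rule of_nat_mono)
        then have "real (card (?rec r S)) * real d \<le> (x * real (card S)) * real d" by (simp add: x mult_ac)
        then show ?thesis using d by simp
      qed
      moreover have "x = 0 \<or> (\<exists>r<R. \<exists>S\<subseteq>{..<n}. S \<noteq> {} \<and> real (card (?rec r S)) = x * real (card S))"
      proof (cases "N = 0")
        case True then show ?thesis by (simp add: x_def)
      next
        case False
        then have "s' ''num'' \<noteq> 0" by (simp add: N_def)
        then have "\<exists>y<R * 2 ^ n. sample_size A E y = s' ''num'' \<and> card (bits n (y mod 2 ^ n)) = s' ''den''"
          using m by (simp add: maximal_upto_def)
        then obtain y where "y < R * 2 ^ n" "sample_size A E y = s' ''num''" "card (bits n (y mod 2 ^ n)) = s' ''den''"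
          by blast
        then have y: "y < R * 2 ^ n" "sample_size A E y = N" "card (bits n (y mod 2 ^ n)) = d"
          by (simp_all add: N_def d_def)
        have "y div 2 ^ n < R" using y(1) by (simp add: less_mult_imp_div_less)
        moreover have "real (card (?rec (y div 2 ^ n) (bits n (y mod 2 ^ n)))) = x * real (card (bits n (y mod 2 ^ n)))"
          using y x by (simp add: sample_size_eq[OF E lG] \<theta>_def)
        moreover have "bits n (y mod 2 ^ n) \<noteq> {}" using y(3) d by auto
        ultimately show ?thesis using bits_subset by blast
      qed
      ultimately have "max_density n E / 2 \<le> 3 / 4 * x * (real q / real \<theta>) \<and> 3 / 4 * x * (real q / real \<theta>) \<le> max_density n E"
        using good unfolding good_seed_def by blast
      moreover have "3 / 4 * x * (real q / real \<theta>) = real (3 * N * q) / real (4 * d * \<theta>)" by (simp add: x_def)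
      ultimately show ?thesis by (simp only:)
    qed
    then have P: "Post (s'(''num'' := 3 * N * q, ''den'' := 4 * d * \<theta>))" by (simp add: Post_def)
    show ?thesis unfolding tail_def
      by (rule wp_Seq, rule wp_AssignI[where k = "3 * N * q"], simp add: v N_def, rule b,
          rule wp_AssignI[where k = "4 * d * \<theta>"], simp add: v d_def, rule b, rule P)
  qed
  define loop where "loop = While (Reg ''Y'' \<prec> Reg ''R'' \<otimes> Reg ''N'') max_body"
  have loop: "wp U loop (wp U tail Post) s1"
    if ag: "agree {''i'', ''W'', ''h'', ''N'', ''num'', ''den'', ''Y''} s s1"
      and v: "s1 ''i'' = level (card E)" "s1 ''h'' = \<theta>" "s1 ''N'' = 2 ^ n" "s1 ''num'' = 0" "s1 ''den'' = 1" "s1 ''Y'' = 0" for s1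
  proof -
    have par1: "par A s1" using par_agree[OF par ag] by simp
    have S1: "s1 ''S'' = state A E" using s by (simp add: agreeD[OF ag])
    define I where "I y s' \<longleftrightarrow> agree max_regs s1 s' \<and> s' ''Y'' = y \<and> maximal_upto A E y s'" for y s'
    show ?thesis unfolding loop_def
    proof (rule wp_While_count[where I = I and N = "R * 2 ^ n"])
      show "I 0 s1" using v n by (simp add: I_def agree_refl maximal_upto_def)
    next
      fix s' assume I: "I (R * 2 ^ n) s'"
      then have ag': "agree max_regs s1 s'" unfolding I_def by blast
      have par': "par A s'" using par_agree[OF par1 ag'] by simp
      have v': "s' ''h'' = \<theta>" "s' ''N'' = 2 ^ n" using v by (simp_all add: agreeD[OF ag'])
      have "wp U tail Post s'" by (rule tail) (use I par' v' in \<open>simp_all add: I_def par_def\<close>)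
      then show "aval (Reg ''Y'' \<prec> Reg ''R'' \<otimes> Reg ''N'') s' = 0 \<and> wp U tail Post s'"
        using I par' v' by (simp add: I_def par_def)
    next
      fix y s' assume y: "y < R * 2 ^ n" and I: "I y s'"
      then have ag': "agree max_regs s1 s'" unfolding I_def by blast
      have par': "par A s'" using par_agree[OF par1 ag'] by simp
      have v': "s' ''N'' = 2 ^ n" "s' ''S'' = state A E" "s' ''i'' = level (card E)" "s' ''Y'' = y" "maximal_upto A E y s'"
        using v S1 I by (simp_all add: agreeD[OF ag'] I_def)
      have "wp U max_body (I (Suc y)) s'"
      proof (rule wp_conseq[OF wp_max_body[OF par' E lG v'(2,3,1,4) y v'(5)]])
        fix s'' assume *: "agree max_regs s' s'' \<and> s'' ''Y'' = Suc y \<and> maximal_upto A E (Suc y) s''"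
        then have "agree max_regs s1 s''" using ag' agree_trans by blast
        then show "I (Suc y) s''" using * by (simp add: I_def)
      qed
      then show "aval (Reg ''Y'' \<prec> Reg ''R'' \<otimes> Reg ''N'') s' \<noteq> 0 \<and> wp U max_body (I (Suc y)) s'"
        using y par' v' by (simp add: par_def)
    qed
  qed
  have "wp U level_prog (wp U (''N'' ::= Num 2 \<up> Reg ''n'' ;; ''num'' ::= Num 0 ;; ''den'' ::= Num 1 ;; ''Y'' ::= Num 0 ;;
      loop ;; tail) Post) s"
  proof (rule wp_conseq[OF wp_level_prog[OF par s(2) q8]])
    fix s' assume s': "agree {''i'', ''W'', ''h''} s s' \<and> s' ''i'' = level (card E) \<and> s' ''h'' = min (T * 2 ^ level (card E)) q"
    then have ag: "agree {''i'', ''W'', ''h''} s s'" by blast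
    have n': "s' ''n'' = n" using par by (simp add: agreeD[OF ag] par_def)
    have "agree {''i'', ''W'', ''h'', ''N'', ''num'', ''den'', ''Y''} s s'"
      by (rule agree_trans[OF ag agree_refl[of "{}"]]) auto
    then have "wp U loop (wp U tail Post) (s'(''N'' := 2 ^ n, ''num'' := 0, ''den'' := 1, ''Y'' := 0))"
      by (intro loop) (use s' in \<open>simp_all add: agree_upd \<theta>_def\<close>)
    then show "wp U (''N'' ::= Num 2 \<up> Reg ''n'' ;; ''num'' ::= Num 0 ;; ''den'' ::= Num 1 ;; ''Y'' ::= Num 0 ;;
      loop ;; tail) Post s'"
      using U_gt n' by (simp add: wp_simps(2,3))
  qed
  then show ?thesis unfolding output_com_def wp_simps(3) Post_def[symmetric] \<theta>_def[symmetric] loop_def tail_def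
    by simp
qed

end


section \<open>Random seeds and parameters\<close>

text \<open>The coin flipped first becomes the most significant bit: it decides between the lower
  and the upper half of the range below \<open>2 * m\<close>.\<close>

lemma bind_coin_uniform:
  fixes g :: "bool \<Rightarrow> nat \<Rightarrow> 'a"
  assumes "0 < m"
  shows "bind_spmf coin_spmf (\<lambda>b. map_spmf (g b) (spmf_of_set {..<m})) =
    map_spmf (\<lambda>a. g (m \<le> a) (a mod m)) (spmf_of_set {..<2 * m})"
proof -
  have 1: "map_spmf (\<lambda>a. of_bool b * m + a) (spmf_of_set {..<m}) = spmf_of_set {of_bool b * m..<of_bool b * m + m}" for b
  proof -
    have "(\<lambda>a. of_bool b * m + a) ` {..<m} = {of_bool b * m..<of_bool b * m + m}"
      by (simp add: lessThan_atLeast0)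
    then show ?thesis by (subst map_spmf_of_set_inj_on) (auto intro: inj_onI)
  qed
  have 2: "bind_spmf coin_spmf (\<lambda>b. map_spmf (\<lambda>a. of_bool b * m + a) (spmf_of_set {..<m})) = spmf_of_set {..<2 * m}"
    unfolding 1
  proof (rule spmf_eqI)
    fix x
    show "spmf (bind_spmf coin_spmf (\<lambda>b. spmf_of_set {of_bool b * m..<of_bool b * m + m})) x = spmf (spmf_of_set {..<2 * m}) x"
      by (simp add: spmf_bind integral_spmf_of_set UNIV_bool, auto simp: spmf_of_set indicator_def)
  qed
  have "map_spmf (\<lambda>a. g (m \<le> a) (a mod m)) (spmf_of_set {..<2 * m}) =
      bind_spmf coin_spmf (\<lambda>b. map_spmf (\<lambda>a. g (m \<le> of_bool b * m + a) ((of_bool b * m + a) mod m)) (spmf_of_set {..<m}))"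
    unfolding 2[symmetric] by (simp only: map_spmf_bind_spmf o_def spmf.map_comp)
  also have "\<dots> = bind_spmf coin_spmf (\<lambda>b. map_spmf (g b) (spmf_of_set {..<m}))"
    by (intro bind_spmf_cong[OF refl] map_spmf_cong refl) (auto simp: of_bool_def)
  finally show ?thesis ..
qed

lemma exec_wp:
  assumes "wp (2 ^ l) c Q s" "com_ok c" "com_regs c \<subseteq> X" "com_weight c \<le> M"
    "bounded_on X l s" "finite X" "0 < l" "m \<le> space_bound X M l"
  shows "\<exists>s' m'. exec X c (s, m) = return_spmf (s', m') \<and> m' \<le> space_bound X M l \<and> bounded_on X l s' \<and> Q s'"
proof -
  obtain s' where "big_step (2 ^ l) c s s'" "Q s'" using assms(1) by (auto simp: wp_def)
  then show ?thesis using exec_big_step[OF _ assms(2-8)] by blast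
qed

definition flip_rest :: com where
  "flip_rest = (''A'' ::= Num 2 \<otimes> Reg ''A'' \<oplus> Reg ''b'' ;; ''c'' ::= Num 2 \<otimes> Reg ''c'')"

definition flip_loop :: com where
  "flip_loop = While (Reg ''c'' \<prec> Reg ''M'') (Flip ''b'' ;; flip_rest)"

text \<open>The only random part of the algorithm. Expressing its outcome as a function
  \<open>g\<close> of one uniform number lets the remaining run be analysed separately for each
  seed. The assumption on \<open>(s ''A'' + 1) * 2 ^ k\<close> reserves room for the remaining
  doublings and is preserved by each of them.\<close>

lemma exec_flip_loop:
  fixes X :: "string set" and M l :: nat
  assumes X: "com_regs flip_loop \<subseteq> X" "finite X" "com_weight flip_loop \<le> M" "0 < l"
    and k: "\<And>j. j < k \<Longrightarrow> s ''c'' * 2 ^ j < s ''M''" "s ''M'' \<le> s ''c'' * 2 ^ k"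
    and big: "(s ''A'' + 1) * 2 ^ k \<le> 2 ^ l" "s ''c'' * 2 ^ k < 2 ^ l"
    and s: "bounded_on X l s" "m \<le> space_bound X M l"
  shows "\<exists>g. exec X flip_loop (s, m) = map_spmf g (spmf_of_set {..<2 ^ k}) \<and>
    (\<forall>a<2 ^ k. agree {''A'', ''b'', ''c''} s (fst (g a)) \<and> fst (g a) ''A'' = s ''A'' * 2 ^ k + a \<and>
       bounded_on X l (fst (g a)) \<and> snd (g a) \<le> space_bound X M l)"
  using k big s
proof (induction k arbitrary: s m)
  case 0
  have g: "aval (Reg ''c'' \<prec> Reg ''M'') s = 0" using "0.prems" by simp
  have "\<exists>m'\<le>space_bound X M l. charge X (aexp_space (Reg ''c'' \<prec> Reg ''M'') s) (s, m) = (s, m')"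
    by (rule charge_exp) (use "0.prems" X in \<open>auto simp: flip_loop_def\<close>)
  then obtain m1 where m1: "m1 \<le> space_bound X M l" "charge X (aexp_space (Reg ''c'' \<prec> Reg ''M'') s) (s, m) = (s, m1)" by blast
  have "exec X flip_loop (s, m) = return_spmf (s, m1)"
    unfolding flip_loop_def exec.simps by (subst while_spmf.simps) (use g m1 in \<open>simp del: aval.simps aexp_space.simps\<close>)
  moreover have "{..<2 ^ 0} = {0::nat}" by auto
  ultimately show ?case using m1 "0.prems"
    by (intro exI[of _ "\<lambda>_. (s, m1)"]) (auto simp: agree_refl spmf_of_set_singleton)
next
  case (Suc k)
  have g: "aval (Reg ''c'' \<prec> Reg ''M'') s \<noteq> 0" using Suc.prems(1)[of 0] by simp
  have "\<exists>m'\<le>space_bound X M l. charge X (aexp_space (Reg ''c'' \<prec> Reg ''M'') s) (s, m) = (s, m')"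
    by (rule charge_exp) (use Suc.prems X in \<open>auto simp: flip_loop_def\<close>)
  then obtain m1 where m1: "m1 \<le> space_bound X M l" "charge X (aexp_space (Reg ''c'' \<prec> Reg ''M'') s) (s, m) = (s, m1)" by blast
  define sb where "sb b = s(''b'' := of_bool b)" for b
  have regs: "''A'' \<in> X" "''b'' \<in> X" "''c'' \<in> X" "com_regs flip_rest \<subseteq> X" "com_weight flip_rest \<le> M"
    using X by (auto simp: flip_loop_def flip_rest_def)
  have bb: "bounded_on X l (sb b)" for b
  proof -
    have "of_bool b < (2::nat) ^ l" using one_less_power[of "2::nat" l] X(4) by (cases b) auto
    then show ?thesis using Suc.prems(5) by (auto simp: bounded_on_def sb_def)
  qed
  have "\<exists>m2\<le>space_bound X M l. charge X 0 (sb b, m1) = (sb b, m2)" for b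
    by (rule charge_le[OF bb]) (use X m1 in auto)
  then obtain m2 where m2: "\<And>b. m2 b \<le> space_bound X M l" "\<And>b. charge X 0 (sb b, m1) = (sb b, m2 b)" by metis
  have k1: "2 ^ k \<ge> (1::nat)" by simp
  have A': "(2 * s ''A'' + of_bool b + 1) * 2 ^ k \<le> (s ''A'' + 1) * 2 ^ Suc k" for b :: bool
    by (cases b) auto
  have cU: "2 * s ''c'' < 2 ^ l"
  proof -
    have "2 * s ''c'' \<le> s ''c'' * 2 ^ Suc k" by simp
    then show ?thesis using Suc.prems(4) by linarith
  qed
  have AU: "2 * s ''A'' + of_bool b < 2 ^ l" for b :: bool
  proof -
    have "2 * s ''A'' + of_bool b + 1 \<le> (2 * s ''A'' + of_bool b + 1) * 2 ^ k"
      using mult_le_mono2[OF k1, of "2 * s ''A'' + of_bool b + 1"] by (simp only: mult_1_right)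
    also have "\<dots> \<le> 2 ^ l" using A'[of b] Suc.prems(3) by (rule le_trans)
    finally show ?thesis by simp
  qed
  define s3 where "s3 b = (sb b)(''A'' := 2 * s ''A'' + of_bool b, ''c'' := 2 * s ''c'')" for b
  have "\<exists>s' m'. exec X flip_rest (sb b, m2 b) = return_spmf (s', m') \<and> m' \<le> space_bound X M l \<and> bounded_on X l s' \<and> s' = s3 b" for b
    by (rule exec_wp[OF _ _ regs(4,5) bb X(2,4) m2(1)])
      (use cU AU in \<open>simp_all add: flip_rest_def wp_simps sb_def s3_def\<close>)
  then obtain m3 where m3: "\<And>b. exec X flip_rest (sb b, m2 b) = return_spmf (s3 b, m3 b)"
    "\<And>b. m3 b \<le> space_bound X M l" "\<And>b. bounded_on X l (s3 b)" by metis
  have "\<exists>g. exec X flip_loop (s3 b, m3 b) = map_spmf g (spmf_of_set {..<2 ^ k}) \<and>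
    (\<forall>a<2 ^ k. agree {''A'', ''b'', ''c''} (s3 b) (fst (g a)) \<and> fst (g a) ''A'' = s3 b ''A'' * 2 ^ k + a \<and>
       bounded_on X l (fst (g a)) \<and> snd (g a) \<le> space_bound X M l)" for b
  proof (rule Suc.IH)
    fix j assume "j < k"
    then show "s3 b ''c'' * 2 ^ j < s3 b ''M''" using Suc.prems(1)[of "Suc j"] by (simp add: s3_def sb_def mult.commute mult.left_commute)
  next
    show "s3 b ''M'' \<le> s3 b ''c'' * 2 ^ k" using Suc.prems(2) by (simp add: s3_def sb_def mult.commute mult.left_commute)
    show "(s3 b ''A'' + 1) * 2 ^ k \<le> 2 ^ l" using A'[of b] Suc.prems(3) by (simp add: s3_def)
    show "s3 b ''c'' * 2 ^ k < 2 ^ l" using Suc.prems(4) by (simp add: s3_def mult.commute mult.left_commute)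
  qed (use m3 in auto)
  then obtain g where g': "\<And>b. exec X flip_loop (s3 b, m3 b) = map_spmf (g b) (spmf_of_set {..<2 ^ k})"
    "\<And>b a. a < 2 ^ k \<Longrightarrow> agree {''A'', ''b'', ''c''} (s3 b) (fst (g b a)) \<and> fst (g b a) ''A'' = s3 b ''A'' * 2 ^ k + a \<and>
       bounded_on X l (fst (g b a)) \<and> snd (g b a) \<le> space_bound X M l" by metis
  have body: "exec X (Flip ''b'' ;; flip_rest) (s, m1) = map_spmf (\<lambda>b. (s3 b, m3 b)) coin_spmf"
    using m2(2) m3(1) by (simp add: set_reg_def bind_map_spmf o_def sb_def map_spmf_conv_bind_spmf)
  have "exec X flip_loop (s, m) = bind_spmf (exec X (Flip ''b'' ;; flip_rest) (s, m1)) (exec X flip_loop)"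
    unfolding flip_loop_def exec.simps(6) by (subst while_spmf.simps) (use g m1 in \<open>simp del: aval.simps aexp_space.simps exec.simps\<close>)
  also have "\<dots> = bind_spmf coin_spmf (\<lambda>b. map_spmf (g b) (spmf_of_set {..<2 ^ k}))"
    unfolding body by (simp add: bind_map_spmf o_def g'(1))
  also have "\<dots> = map_spmf (\<lambda>a. g (2 ^ k \<le> a) (a mod 2 ^ k)) (spmf_of_set {..<2 * 2 ^ k})"
    by (rule bind_coin_uniform) simp
  finally have e: "exec X flip_loop (s, m) = map_spmf (\<lambda>a. g (2 ^ k \<le> a) (a mod 2 ^ k)) (spmf_of_set {..<2 ^ Suc k})" by simp
  have "agree {''A'', ''b'', ''c''} s (fst (g (2 ^ k \<le> a) (a mod 2 ^ k))) \<and>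
      fst (g (2 ^ k \<le> a) (a mod 2 ^ k)) ''A'' = s ''A'' * 2 ^ Suc k + a \<and>
      bounded_on X l (fst (g (2 ^ k \<le> a) (a mod 2 ^ k))) \<and> snd (g (2 ^ k \<le> a) (a mod 2 ^ k)) \<le> space_bound X M l"
    if a: "a < 2 ^ Suc k" for a
  proof -
    define b where "b = (2 ^ k \<le> a)"
    have am: "of_bool b * 2 ^ k + a mod 2 ^ k = a"
    proof (cases b)
      case True
      then have "2 ^ k \<le> a" "a - 2 ^ k < 2 ^ k" using a by (auto simp: b_def)
      then have "a mod 2 ^ k = a - 2 ^ k" by (simp add: le_mod_geq)
      then show ?thesis using True \<open>2 ^ k \<le> a\<close> by simp
    qed (simp add: b_def)
    have 1: "agree {''A'', ''b'', ''c''} (s3 b) (fst (g b (a mod 2 ^ k)))"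
      "fst (g b (a mod 2 ^ k)) ''A'' = s3 b ''A'' * 2 ^ k + a mod 2 ^ k"
      "bounded_on X l (fst (g b (a mod 2 ^ k)))" "snd (g b (a mod 2 ^ k)) \<le> space_bound X M l"
      using g'(2)[of "a mod 2 ^ k" b] by auto
    have "agree {''A'', ''b'', ''c''} s (s3 b)" by (simp add: s3_def sb_def agree_upd agree_refl)
    then have 2: "agree {''A'', ''b'', ''c''} s (fst (g b (a mod 2 ^ k)))" using 1(1) agree_trans by blast
    have "s3 b ''A'' * 2 ^ k + a mod 2 ^ k = s ''A'' * 2 ^ Suc k + (of_bool b * 2 ^ k + a mod 2 ^ k)"
      by (simp add: s3_def algebra_simps)
    then show ?thesis using 1 2 am unfolding b_def[symmetric] by simp
  qed
  then show ?case using e by blast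
qed

section \<open>Computing the parameters from the number of nodes\<close>

definition log_body :: com where
  "log_body = (''x'' ::= Num 2 \<otimes> Reg ''x'' ;; ''L'' ::= Reg ''L'' \<oplus> Num 1)"

definition prime_body :: com where
  "prime_body = If (Reg ''q'' \<odot> Reg ''d'') (''d'' ::= Reg ''d'' \<oplus> Num 1)
     (''q'' ::= Reg ''q'' \<oplus> Num 1 ;; ''d'' ::= Num 2)"

definition param_tail :: com where
  "param_tail =
     (''Q'' ::= Reg ''q'' \<up> Reg ''t'' ;; ''M'' ::= Reg ''Q'' \<up> Reg ''R'' ;;
      ''D'' ::= Reg ''n'' \<up> Num 6 ;; ''c'' ::= Num 1)"

definition param_mid :: "nat \<Rightarrow> nat \<Rightarrow> nat \<Rightarrow> com" where
  "param_mid kc rc gc =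
     (''t'' ::= Reg ''n'' \<otimes> (Reg ''L'' \<otimes> Num kc) ;; ''T'' ::= Num 192 \<otimes> Reg ''t'' ;;
      ''R'' ::= Num rc \<otimes> Reg ''L'' ;; ''G'' ::= Num gc \<otimes> Reg ''L'' ;;
      ''q'' ::= Num 16 \<otimes> (Reg ''n'' \<otimes> Reg ''t'') ;; ''d'' ::= Num 2 ;;
      While (Reg ''d'' \<prec> Reg ''q'') prime_body ;;
      param_tail)"

definition param_prog :: "nat \<Rightarrow> nat \<Rightarrow> nat \<Rightarrow> com" where
  "param_prog kc rc gc =
     (''L'' ::= Num 1 ;; ''x'' ::= Num 2 ;; While (Reg ''x'' \<prec> Reg ''n'') log_body ;;
      param_mid kc rc gc)"

definition log_ceil :: "nat \<Rightarrow> nat" where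
  "log_ceil n = (LEAST l. 1 \<le> l \<and> n \<le> 2 ^ l)"

lemma log_ceil: "1 \<le> log_ceil n" "n \<le> 2 ^ log_ceil n"
proof -
  have "1 \<le> log_ceil n \<and> n \<le> 2 ^ log_ceil n"
    unfolding log_ceil_def
  proof (rule LeastI[of "\<lambda>l. 1 \<le> l \<and> n \<le> 2 ^ l"])
    show "1 \<le> Suc n \<and> n \<le> 2 ^ Suc n" using less_exp[of n] unfolding power_Suc by linarith
  qed
  then show "1 \<le> log_ceil n" "n \<le> 2 ^ log_ceil n" by auto
qed

lemma less_log_ceil: "1 \<le> j \<Longrightarrow> j < log_ceil n \<Longrightarrow> 2 ^ j < n"
  unfolding log_ceil_def by (drule not_less_Least) simp

definition next_prime :: "nat \<Rightarrow> nat" where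
  "next_prime m = (LEAST p. prime p \<and> m \<le> p)"

lemma next_prime:
  assumes "2 \<le> m" shows "prime (next_prime m)" "m \<le> next_prime m" "next_prime m \<le> m ^ 3"
proof -
  obtain p where p: "prime p" "m < p" "p \<le> m ^ 3" using exists_prime_between[OF assms] by blast
  then have "prime (next_prime m) \<and> m \<le> next_prime m"
    unfolding next_prime_def by (intro LeastI[of "\<lambda>p. prime p \<and> m \<le> p" p]) simp
  then show "prime (next_prime m)" "m \<le> next_prime m" by auto
  have "next_prime m \<le> p" unfolding next_prime_def by (rule Least_le[of "\<lambda>p. prime p \<and> m \<le> p"]) (use p in simp)
  then show "next_prime m \<le> m ^ 3" using p by simp
qed

lemma wp_log_loop:
  assumes "s ''n'' = n" "s ''L'' = 1" "s ''x'' = 2" "2 * n < U"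
  shows "wp U (While (Reg ''x'' \<prec> Reg ''n'') log_body) (\<lambda>s'. agree {''L'', ''x''} s s' \<and> s' ''L'' = log_ceil n) s"
proof (rule wp_While_count[where I = "\<lambda>j s'. agree {''L'', ''x''} s s' \<and> s' ''L'' = Suc j \<and> s' ''x'' = 2 ^ Suc j"
      and N = "log_ceil n - 1"])
  show "agree {''L'', ''x''} s s \<and> s ''L'' = Suc 0 \<and> s ''x'' = 2 ^ Suc 0" using assms by (simp add: agree_refl)
next
  fix s' assume I: "agree {''L'', ''x''} s s' \<and> s' ''L'' = Suc (log_ceil n - 1) \<and> s' ''x'' = 2 ^ Suc (log_ceil n - 1)"
  then have ag: "agree {''L'', ''x''} s s'" by blast
  have "s' ''n'' = n" using assms by (simp add: agreeD[OF ag])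
  then show "aval (Reg ''x'' \<prec> Reg ''n'') s' = 0 \<and> agree {''L'', ''x''} s s' \<and> s' ''L'' = log_ceil n"
    using I log_ceil[of n] by (simp add: Suc_diff_le)
next
  fix j s' assume j: "j < log_ceil n - 1" and I: "agree {''L'', ''x''} s s' \<and> s' ''L'' = Suc j \<and> s' ''x'' = 2 ^ Suc j"
  then have ag: "agree {''L'', ''x''} s s'" by blast
  have n: "s' ''n'' = n" using assms by (simp add: agreeD[OF ag])
  have l: "2 ^ Suc j < n" using less_log_ceil[of "Suc j" n] j by simp
  have "Suc (Suc j) \<le> 2 ^ Suc j" using less_exp[of "Suc j"] by linarith
  then have "Suc (Suc j) < U" "2 * 2 ^ Suc j < U" using l assms(4) by linarith+
  then show "aval (Reg ''x'' \<prec> Reg ''n'') s' \<noteq> 0 \<and>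
      wp U log_body (\<lambda>s'. agree {''L'', ''x''} s s' \<and> s' ''L'' = Suc (Suc j) \<and> s' ''x'' = 2 ^ Suc (Suc j)) s'"
    using I l n by (simp add: log_body_def wp_simps agree_upd)
qed

text \<open>The variant encodes the lexicographic order on candidate and trial divisor in one
  number, as the divisor restarts at 2. The search cannot run past the prime \<open>p\<close>, since
  rejecting it would require a divisor between 2 and \<open>p - 1\<close>.\<close>

lemma wp_prime_loop:
  assumes "s ''q'' = m" "s ''d'' = 2" "2 \<le> m" "next_prime m < U"
  shows "wp U (While (Reg ''d'' \<prec> Reg ''q'') prime_body) (\<lambda>s'. agree {''q'', ''d''} s s' \<and> s' ''q'' = next_prime m) s"
proof -
  define p where "p = next_prime m"
  note p = next_prime[OF assms(3), folded p_def]
  define I where "I s' \<longleftrightarrow> agree {''q'', ''d''} s s' \<and> m \<le> s' ''q'' \<and> s' ''q'' \<le> p \<and> 2 \<le> s' ''d'' \<and> s' ''d'' \<le> s' ''q'' \<and>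
    (\<forall>i. 2 \<le> i \<longrightarrow> i < s' ''d'' \<longrightarrow> \<not> i dvd s' ''q'')" for s'
  define f where "f s' = (p - s' ''q'') * (p + 1) + (p - s' ''d'')" for s' :: store
  show ?thesis
  proof (rule wp_While_measure[where I = I and f = f])
    show "I s" using assms p by (simp add: I_def agree_refl)
  next
    fix s' assume I: "I s'" and "aval (Reg ''d'' \<prec> Reg ''q'') s' = 0"
    then have d: "s' ''d'' = s' ''q''" by (simp add: I_def)
    have "prime (s' ''q'')" unfolding prime_nat_iff
    proof (intro conjI allI impI)
      show "1 < s' ''q''" using I d by (simp add: I_def)
      fix i assume i: "i dvd s' ''q''"
      then have "i \<le> s' ''q''" "0 < i" using \<open>1 < s' ''q''\<close> by (auto dest: dvd_imp_le intro: Nat.gr0I)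
      moreover have "\<not> (2 \<le> i \<and> i < s' ''q'')" using I d i unfolding I_def by metis
      ultimately show "i = 1 \<or> i = s' ''q''" by linarith
    qed
    then have "p \<le> s' ''q''" unfolding p_def next_prime_def using I by (intro Least_le[of "\<lambda>p. prime p \<and> m \<le> p"]) (simp add: I_def)
    then show "agree {''q'', ''d''} s s' \<and> s' ''q'' = next_prime m" using I by (simp add: I_def p_def)
  next
    fix s' assume I: "I s'" and g: "aval (Reg ''d'' \<prec> Reg ''q'') s' \<noteq> 0"
    then have lt: "s' ''d'' < s' ''q''" by (simp split: if_splits)
    have qp: "s' ''q'' \<le> p" "2 \<le> s' ''d''" using I by (simp_all add: I_def)
    show "wp U prime_body (\<lambda>s''. I s'' \<and> f s'' < f s') s'"
    proof (cases "s' ''d'' dvd s' ''q''")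
      case False
      have "\<not> i dvd s' ''q''" if "2 \<le> i" "i < Suc (s' ''d'')" for i
        using that False I by (cases "i = s' ''d''") (auto simp: I_def)
      then have "I (s'(''d'' := Suc (s' ''d'')))" using I lt by (simp add: I_def agree_upd)
      moreover have "f (s'(''d'' := Suc (s' ''d''))) < f s'"
      proof -
        have "p - Suc (s' ''d'') < p - s' ''d''" using lt qp by linarith
        then show ?thesis by (simp add: f_def)
      qed
      ultimately show ?thesis using False lt qp assms(4)
        by (simp add: prime_body_def wp_simps dvd_eq_mod_eq_0 p_def)
    next
      case True
      have "s' ''q'' \<noteq> p"
      proof
        assume "s' ''q'' = p"
        then have "s' ''d'' = 1 \<or> s' ''d'' = p" using True p(1) by (simp add: prime_nat_iff)
        then show False using lt qp \<open>s' ''q'' = p\<close> by simp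
      qed
      then have lt': "s' ''q'' < p" using qp by simp
      have I': "I (s'(''q'' := Suc (s' ''q''), ''d'' := 2))"
        using I lt lt' by (simp add: I_def agree_upd)
      obtain r where r: "p = Suc (s' ''q'') + r" using lt' by (metis less_imp_Suc_add add_Suc)
      have "(p - Suc (s' ''q'')) * (p + 1) + (p - 2) < (p - s' ''q'') * (p + 1) + (p - s' ''d'')"
        by (simp add: r algebra_simps)
      then have "f (s'(''q'' := Suc (s' ''q''), ''d'' := 2)) < f s'" by (simp add: f_def)
      then show ?thesis using True I' lt lt' qp assms(4)
        by (simp add: prime_body_def wp_simps dvd_eq_mod_eq_0 p_def)
    qed
  qed
qed

context sketch
begin

lemma wp_param_prog:
  assumes L: "L = log_ceil n" and c: "t = n * (L * kc)" "T = 192 * t" "R = rc * L" "G = gc * L" "q = next_prime (16 * (n * t))"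
    and s: "s ''n'' = n"
  shows "wp U (param_prog kc rc gc) (\<lambda>s'. agree {''L'', ''x'', ''t'', ''T'', ''R'', ''G'', ''q'', ''d'', ''Q'', ''M'', ''D'', ''c''} s s' \<and>
    s' ''t'' = t \<and> s' ''T'' = T \<and> s' ''R'' = R \<and> s' ''G'' = G \<and> s' ''q'' = q \<and> s' ''Q'' = Q \<and> s' ''M'' = Q ^ R \<and>
    s' ''D'' = D \<and> s' ''c'' = 1) s"
proof -
  let ?V = "{''L'', ''x'', ''t'', ''T'', ''R'', ''G'', ''q'', ''d'', ''Q'', ''M'', ''D'', ''c''}"
  define Post where "Post s' \<longleftrightarrow> agree ?V s s' \<and>
    s' ''t'' = t \<and> s' ''T'' = T \<and> s' ''R'' = R \<and> s' ''G'' = G \<and> s' ''q'' = q \<and> s' ''Q'' = Q \<and> s' ''M'' = Q ^ R \<and>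
    s' ''D'' = D \<and> s' ''c'' = 1" for s'
  have m2: "2 \<le> 16 * (n * t)" using n t by (cases "n * t") auto
  note p = next_prime[OF m2, folded c(5)]
  have RU: "R < U" and GU: "G < U"
  proof -
    have "R \<le> R * G * T" "G \<le> R * G * T" using pos by simp_all
    then show "R < U" "G < U" using U(6) by linarith+
  qed
  have nU: "2 * n < U" "2 < U"
  proof -
    have "2 * n \<le> n * n" using n by (rule mult_right_mono) simp
    then show "2 * n < U" using U(5) by linarith
    then show "2 < U" using n by linarith
  qed
  have DU: "D < U"
  proof -
    have "D ^ 1 \<le> D ^ (R * G * T)" using n pos by (intro power_increasing) auto
    then show ?thesis using U(2) by simp
  qed
  have QRU: "Q ^ R < U" using U(1) by linarith
  have last: "wp U param_tail Post s3"
    if ag: "agree ?V s s3" and v: "s3 ''q'' = q" "s3 ''t'' = t" "s3 ''T'' = T" "s3 ''R'' = R" "s3 ''G'' = G" for s3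
  proof -
    have "s3 ''n'' = n" using s by (simp add: agreeD[OF ag])
    then show ?thesis using v ag QU QRU DU nU by (simp add: param_tail_def wp_simps Post_def agree_upd)
  qed
  have mid: "wp U (param_mid kc rc gc) Post s1"
    if ag: "agree ?V s s1" and v: "s1 ''L'' = L" for s1
  proof -
    have n1: "s1 ''n'' = n" using s by (simp add: agreeD[OF ag])
    define s2 where "s2 = s1(''t'' := t, ''T'' := T, ''R'' := R, ''G'' := G, ''q'' := 16 * (n * t), ''d'' := 2)"
    have qU': "16 * (n * t) < U" using p(2) qU by linarith
    have ag2: "agree ?V s s2" using ag by (simp add: s2_def agree_upd)
    have "wp U (While (Reg ''d'' \<prec> Reg ''q'') prime_body) (wp U param_tail Post) s2"
    proof (rule wp_conseq[OF wp_prime_loop[of s2 "16 * (n * t)"]])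
      fix s3 assume s3: "agree {''q'', ''d''} s2 s3 \<and> s3 ''q'' = next_prime (16 * (n * t))"
      then have ag3: "agree {''q'', ''d''} s2 s3" by blast
      have "agree ?V s s3" by (rule agree_trans[OF ag2 ag3]) auto
      then show "wp U param_tail Post s3"
        by (rule last) (use s3 c in \<open>simp_all add: agreeD[OF ag3] s2_def\<close>)
    qed (use m2 qU c in \<open>simp_all add: s2_def\<close>)
    then show ?thesis unfolding param_mid_def wp_Seq_eq
      by - (rule wp_AssignI[where k = t], simp add: n1 v c, rule U,
          rule wp_AssignI[where k = T], simp add: c, rule U_gt,
          rule wp_AssignI[where k = R], simp add: v c, rule RU,
          rule wp_AssignI[where k = G], simp add: v c, rule GU,
          rule wp_AssignI[where k = "16 * (n * t)"], simp add: n1, rule qU',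
          rule wp_AssignI[where k = 2], simp, rule nU, simp only: s2_def)
  qed
  have "wp U (While (Reg ''x'' \<prec> Reg ''n'') log_body) (wp U (param_mid kc rc gc) Post) (s(''L'' := 1, ''x'' := 2))"
  proof (rule wp_conseq[OF wp_log_loop[of _ n]])
    fix s1 assume s1: "agree {''L'', ''x''} (s(''L'' := 1, ''x'' := 2)) s1 \<and> s1 ''L'' = log_ceil n"
    have "agree ?V s (s(''L'' := 1, ''x'' := 2))" by (simp add: agree_upd agree_refl)
    then have "agree ?V s s1" by (rule agree_trans) (use s1 in auto)
    then show "wp U (param_mid kc rc gc) Post s1"
      by (rule mid) (use s1 L in simp)
  qed (use s nU in simp_all)
  then show ?thesis unfolding param_prog_def Post_def[symmetric]
    by - (rule wp_Seq, rule wp_AssignI[where k = 1], simp, rule U_gt,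
      rule wp_Seq, rule wp_AssignI[where k = 2], simp, rule nU, rule wp_Seq)
qed

end


section \<open>Runs of the streaming algorithm\<close>

definition sketch_alg :: "nat \<Rightarrow> nat \<Rightarrow> nat \<Rightarrow> stream_alg" where
  "sketch_alg kc rc gc = \<lparr>init_prog = (param_prog kc rc gc ;; flip_loop),
     update_prog = update_com, output_prog = output_com\<rparr>"

definition alg_weight :: "stream_alg \<Rightarrow> nat" where
  "alg_weight A = com_weight (init_prog A) + com_weight (update_prog A) + com_weight (output_prog A)"

definition alg_space :: "stream_alg \<Rightarrow> nat \<Rightarrow> nat" where
  "alg_space A l = space_bound (alg_regs A) (alg_weight A) l"

lemma finite_aexp_regs: "finite (aexp_regs e)"
  by (induction e) auto

lemma finite_com_regs: "finite (com_regs c)"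
  by (induction c) (auto simp: finite_aexp_regs)

lemma finite_alg_regs: "finite (alg_regs A)"
  by (simp add: alg_regs_def finite_com_regs)

lemma sketch_com_ok: "com_ok (param_prog kc rc gc)" "com_ok update_com" "com_ok output_com"
  by (simp_all add: param_prog_def param_mid_def param_tail_def log_body_def prime_body_def update_com_def update_body_def hash_prog_def hash_body_def
      cell_update_def output_com_def level_prog_def level_body_def max_body_def bits_prog_def bits_body_def
      count_prog_def count_body_def)

lemma graph_on_insert: "graph_on n E \<Longrightarrow> u < n \<Longrightarrow> v < n \<Longrightarrow> u \<noteq> v \<Longrightarrow> graph_on n (insert {u, v} E)"
  unfolding graph_on_def by (metis insert_commute insert_iff linorder_neqE_nat)

lemma graph_on_subset: "graph_on n E \<Longrightarrow> E' \<subseteq> E \<Longrightarrow> graph_on n E'"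
  by (auto simp: graph_on_def)

lemma edge_id_unordered: "u \<noteq> v \<Longrightarrow> edge_id n {u, v} = (if u < v then u * n + v else v * n + u)"
  using edge_id_pair[of u v n] edge_id_pair[of v u n] by (auto simp: insert_commute)

lemma digit_mod:
  fixes Q :: nat
  assumes "r < R" shows "(A mod Q ^ R) div Q ^ r mod Q = A div Q ^ r mod Q"
proof (cases "Q = 0")
  case False
  obtain s where R: "R = r + Suc s" using assms by (auto dest: less_imp_Suc_add)
  have "A mod Q ^ R = Q ^ r * (A div Q ^ r mod Q ^ Suc s) + A mod Q ^ r"
    unfolding R power_add by (rule mod_mult2_eq)
  then have "A mod Q ^ R div Q ^ r = A div Q ^ r mod Q ^ Suc s" using False by simp
  moreover have "A div Q ^ r mod Q ^ Suc s mod Q = A div Q ^ r mod Q" by (rule mod_mod_cancel) simp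
  ultimately show ?thesis by simp
qed (use assms in \<open>simp add: power_0_left\<close>)

text \<open>Only the lowest \<open>R\<close> digits of the seed are read. So the program need not
  reduce the drawn number modulo \<open>(q ^ t) ^ R\<close>, and \<open>card_mod_le\<close> applies
  nevertheless.\<close>

lemma good_seed_mod: "good_seed n q t w E \<theta> R (A mod (q ^ t) ^ R) \<longleftrightarrow> good_seed n q t w E \<theta> R A"
  unfolding good_seed_def by (simp add: digit_mod cong: conj_cong imp_cong)

context sketch
begin

text \<open>Read from right to left, the equation also describes deletion, and it shows that the
  subtraction is not truncated.\<close>

lemma state_insert:
  assumes E: "graph_on n (insert f E)" "f \<notin> E"
  shows "state A (insert f E) = state A E + edge_contrib A (edge_id n f)"
proof -
  have E': "graph_on n E" using E(1) by (rule graph_on_subset) auto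
  have "edge_ids n (insert f E) {..<n} = insert (edge_id n f) (edge_ids n E {..<n})"
    by (simp add: edge_ids_def induced_edges_univ[OF E(1)] induced_edges_univ[OF E'])
  moreover have "edge_id n f \<notin> edge_ids n E {..<n}"
    using inj_on_edge_id[OF E(1)] E(2) by (auto simp: edge_ids_def induced_edges_univ[OF E'] inj_on_def)
  ultimately show ?thesis using finite_edge_ids[OF E'] by (simp add: state_def)
qed

definition stream_inv :: "stream_alg \<Rightarrow> nat \<Rightarrow> nat \<Rightarrow> nat set set \<Rightarrow> config \<Rightarrow> bool" where
  "stream_inv alg l A E z \<longleftrightarrow> graph_on n E \<and> par A (fst z) \<and> fst z ''S'' = state A E \<and> fst z ''m'' = card E \<and>
     bounded_on (alg_regs alg) l (fst z) \<and> snd z \<le> alg_space alg l"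

lemma stream_inv_update:
  assumes alg: "alg = sketch_alg kc rc gc" and U2: "U = 2 ^ l" "0 < l"
    and inv: "stream_inv alg l A E z" and a: "valid_stream n E (a # us)"
  shows "\<exists>z'. exec (alg_regs alg) (update_prog alg) (charge (alg_regs alg) 0 (load_update a z)) = return_spmf z' \<and>
     stream_inv alg l A (apply_update a E) z'"
proof -
  define X where "X = alg_regs alg"
  have E: "graph_on n E" using inv by (simp add: stream_inv_def)
  obtain u v b where uv: "u < n" "v < n" "u \<noteq> v"
    and load: "fst (load_update a z) = (fst z)(''v'' := v, ''u'' := u, ''op'' := of_bool b)" "snd (load_update a z) = snd z"
    and app: "apply_update a E = (if b then insert {u, v} E else E - {{u, v}})" and mem: "b \<longleftrightarrow> {u, v} \<notin> E"
  proof (cases a)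
    case (Insert u v)
    then show ?thesis using that[of u v True] a by (simp add: set_reg_def)
  next
    case (Delete u v)
    then have "{u, v} \<in> E" using a by simp
    \<comment> \<open>A deletion only guarantees that the pair is an edge; range and distinctness of
      its endpoints come from the invariant \<open>graph_on\<close>.\<close>
    then obtain x y where "{u, v} = {x, y}" "x < y" "y < n" using E unfolding graph_on_def by blast
    then have "u < n" "v < n" "u \<noteq> v" by (auto simp: doubleton_eq_iff)
    then show ?thesis using that[of u v False] Delete \<open>{u, v} \<in> E\<close> by (simp add: set_reg_def)
  qed
  define s where "s = (fst z)(''v'' := v, ''u'' := u, ''op'' := of_bool b)"
  \<comment> \<open>Insertion and deletion are treated alike, as the two directions between
    \<open>E0\<close> and \<open>E0\<close> with the edge added.\<close>
  define E0 where "E0 = E - {{u, v}}"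
  have E0: "graph_on n E0" "graph_on n (insert {u, v} E0)" "{u, v} \<notin> E0"
    using graph_on_subset[OF E, of E0] graph_on_insert[of n E0 u v] uv by (auto simp: E0_def)
  have E_eq: "E = (if b then E0 else insert {u, v} E0)" "apply_update a E = (if b then insert {u, v} E0 else E0)"
    using mem app by (auto simp: E0_def)
  define e where "e = edge_id n {u, v}"
  define \<Delta> where "\<Delta> = edge_contrib A e"
  have st: "state A (insert {u, v} E0) = state A E0 + \<Delta>"
    unfolding \<Delta>_def e_def by (rule state_insert[OF E0(2,3)])
  have card: "card (insert {u, v} E0) = card E0 + 1" using E0 finite_graph_on[OF E0(1)] by simp
  have stU: "state A (insert {u, v} E0) < U" using state_less[OF E0(2), of A] U(2) by linarith
  have cU: "card (insert {u, v} E0) + 1 < U"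
  proof -
    have "card (insert {u, v} E0) < n ^ 2" using card_graph_less[OF E0(2)] n by simp
    then show ?thesis using U(5) by (simp add: power2_eq_square)
  qed
  have inv': "par A (fst z)" "fst z ''S'' = state A E" "fst z ''m'' = card E" "bounded_on X l (fst z)" "snd z \<le> alg_space alg l"
    using inv by (simp_all add: stream_inv_def X_def)
  have par: "par A s" using inv'(1) by (simp add: s_def par_def)
  have bd: "bounded_on X l s"
  proof -
    have "u < 2 ^ l" "v < 2 ^ l" "of_bool b < (2::nat) ^ l"
      using uv U_gt U2 by (auto simp: of_bool_def)
    then show ?thesis using inv'(4) by (auto simp: bounded_on_def s_def)
  qed
  have finX: "finite X" by (simp add: X_def finite_alg_regs)
  obtain m1 where m1: "m1 \<le> space_bound X (alg_weight alg) l" "charge X 0 (s, snd z) = (s, m1)"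
    using charge_le[OF bd finX U2(2), of 0 "alg_weight alg" "snd z"] inv'(5) by (auto simp: alg_space_def X_def)
  have "wp U update_com (\<lambda>s'. par A s' \<and>
     s' ''S'' = (if s ''op'' \<noteq> 0 then s ''S'' + edge_contrib A e else s ''S'' - edge_contrib A e) \<and>
     s' ''m'' = (if s ''op'' \<noteq> 0 then s ''m'' + 1 else s ''m'' - 1)) s"
  proof (rule wp_update_com[OF par])
    show "(if s ''u'' < s ''v'' then s ''u'' * n + s ''v'' else s ''v'' * n + s ''u'') = e"
      using uv by (simp add: s_def e_def edge_id_unordered)
    show "e < n ^ 2" unfolding e_def by (rule edge_id_bounds(2)[OF E0(2)]) simp
    show "s ''S'' < U" using stU st inv' E_eq by (auto simp: s_def)
    show "s ''S'' + edge_contrib A e < U" if "s ''op'' \<noteq> 0"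
      using that stU st inv' E_eq(1) by (simp add: s_def \<Delta>_def[symmetric] split: if_splits)
    show "s ''m'' + 1 < U" using cU card inv' E_eq(1) by (simp add: s_def split: if_splits)
  qed
  moreover have "com_regs update_com \<subseteq> X" "com_weight update_com \<le> alg_weight alg"
    by (auto simp: X_def alg_regs_def alg sketch_alg_def alg_weight_def)
  ultimately obtain s' m' where e: "exec X update_com (s, m1) = return_spmf (s', m')" "m' \<le> space_bound X (alg_weight alg) l"
    "bounded_on X l s'" "par A s'"
    "s' ''S'' = (if s ''op'' \<noteq> 0 then s ''S'' + \<Delta> else s ''S'' - \<Delta>)"
    "s' ''m'' = (if s ''op'' \<noteq> 0 then s ''m'' + 1 else s ''m'' - 1)"
    using exec_wp[OF _ sketch_com_ok(2) _ _ bd finX U2(2) m1(1)] unfolding U2(1) \<Delta>_def by blast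
  have "s' ''S'' = state A (apply_update a E)" "s' ''m'' = card (apply_update a E)"
    using e(5,6) inv' E_eq st card by (simp_all add: s_def split: if_splits)
  moreover have "graph_on n (apply_update a E)" using E_eq(2) E0 by simp
  ultimately have "stream_inv alg l A (apply_update a E) (s', m')"
    using e by (simp add: stream_inv_def X_def alg_space_def)
  moreover have "charge X 0 (load_update a z) = (s, m1)"
    using m1(2) load by (metis prod.collapse s_def)
  ultimately show ?thesis using e(1) by (auto simp: X_def alg sketch_alg_def)
qed

lemma process_stream_inv:
  assumes alg: "alg = sketch_alg kc rc gc" and U2: "U = 2 ^ l" "0 < l"
    and inv: "stream_inv alg l A E z" and us: "valid_stream n E us"
  shows "\<exists>z'. process_stream alg us z = return_spmf z' \<and> stream_inv alg l A (fold apply_update us E) z'"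
  using inv us
proof (induction us arbitrary: E z)
  case Nil then show ?case by simp
next
  case (Cons a us)
  from stream_inv_update[OF alg U2 Cons.prems] obtain z1 where
    z1: "exec (alg_regs alg) (update_prog alg) (charge (alg_regs alg) 0 (load_update a z)) = return_spmf z1"
    "stream_inv alg l A (apply_update a E) z1" by blast
  have "valid_stream n (apply_update a E) us" using Cons.prems(2) by (cases a) auto
  from Cons.IH[OF z1(2) this] show ?case using z1(1) by simp
qed

text \<open>The whole run becomes a function of one uniform number below \<open>2 ^ k\<close>, so
  statements about probability reduce to counting seeds.\<close>

lemma run_uniform:
  assumes alg: "alg = sketch_alg kc rc gc" and U2: "U = 2 ^ l" "0 < l"
    and c: "t = n * (log_ceil n * kc)" "T = 192 * t" "R = rc * log_ceil n" "G = gc * log_ceil n" "q = next_prime (16 * (n * t))"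
    and q8: "8 * n ^ 2 \<le> q" and qG: "q < 2 ^ G"
    and us: "valid_stream n {} us" and E: "E = final_graph us"
  shows "\<exists>k g. run alg n us = map_spmf g (spmf_of_set {..<2 ^ k}) \<and> Q ^ R \<le> 2 ^ k \<and> 2 ^ k \<le> 2 * Q ^ R \<and> graph_on n E \<and>
    (\<forall>a<2 ^ k. peak_space (g a) \<le> alg_space alg l \<and>
      (good E a \<longrightarrow>
        max_density n E / 2 \<le> answer (g a) \<and> answer (g a) \<le> max_density n E))"
proof -
  define X where "X = alg_regs alg"
  define M where "M = alg_weight alg"
  have finX: "finite X" by (simp add: X_def finite_alg_regs)
  have progs: "com_regs (param_prog kc rc gc) \<subseteq> X" "com_regs flip_loop \<subseteq> X" "com_regs output_com \<subseteq> X"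
    "com_weight (param_prog kc rc gc) \<le> M" "com_weight flip_loop \<le> M" "com_weight output_com \<le> M"
    by (auto simp: X_def M_def alg_regs_def alg sketch_alg_def alg_weight_def)
  define s0 where "s0 = (\<lambda>_::string. 0::nat)(''n'' := n)"
  have bd0: "bounded_on X l s0" using U_gt(2) U2 by (auto simp: bounded_on_def s0_def)
  obtain m0 where m0: "m0 \<le> space_bound X M l" "charge X 0 (s0, 0) = (s0, m0)"
    using charge_le[OF bd0 finX U2(2), of 0 M 0] by auto
  have "wp U (param_prog kc rc gc) (\<lambda>s'. agree {''L'', ''x'', ''t'', ''T'', ''R'', ''G'', ''q'', ''d'', ''Q'', ''M'', ''D'', ''c''} s0 s' \<and>
    s' ''t'' = t \<and> s' ''T'' = T \<and> s' ''R'' = R \<and> s' ''G'' = G \<and> s' ''q'' = q \<and> s' ''Q'' = Q \<and> s' ''M'' = Q ^ R \<and>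
    s' ''D'' = D \<and> s' ''c'' = 1) s0"
    by (rule wp_param_prog[OF refl c]) (simp add: s0_def)
  from exec_wp[OF this[unfolded U2(1)] sketch_com_ok(1) progs(1,4) bd0 finX U2(2) m0(1)]
  obtain s1 m1 where s1: "exec X (param_prog kc rc gc) (s0, m0) = return_spmf (s1, m1)" "m1 \<le> space_bound X M l" "bounded_on X l s1"
    and ag1: "agree {''L'', ''x'', ''t'', ''T'', ''R'', ''G'', ''q'', ''d'', ''Q'', ''M'', ''D'', ''c''} s0 s1"
    and v1: "s1 ''t'' = t" "s1 ''T'' = T" "s1 ''R'' = R" "s1 ''G'' = G" "s1 ''q'' = q" "s1 ''Q'' = Q" "s1 ''M'' = Q ^ R"
      "s1 ''D'' = D" "s1 ''c'' = 1" by blast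
  have v1': "s1 ''n'' = n" "s1 ''A'' = 0" "s1 ''S'' = 0" "s1 ''m'' = 0"
    by (simp_all add: agreeD[OF ag1] s0_def)
  \<comment> \<open>The number of coin flips: the seed range is the first power of two that reaches
    \<open>Q ^ R\<close>, hence less than twice too large.\<close>
  define k where "k = (LEAST k. Q ^ R \<le> 2 ^ k)"
  have k1: "Q ^ R \<le> 2 ^ k" unfolding k_def
    by (rule LeastI[of "\<lambda>k. Q ^ R \<le> 2 ^ k" "Q ^ R"]) (use less_exp[of "Q ^ R"] in simp)
  have k2: "2 ^ j < Q ^ R" if "j < k" for j
    using not_less_Least[of j "\<lambda>k. Q ^ R \<le> 2 ^ k"] that by (simp add: k_def)
  have k3: "2 ^ k \<le> 2 * Q ^ R"
  proof (cases k)
    case 0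
    have "0 < Q ^ R" using Q0 by (rule zero_less_power)
    then show ?thesis unfolding 0 power_0 by linarith
  next
    case (Suc j)
    then show ?thesis using k2[of j] by simp
  qed
  have k4: "2 ^ k < U" using k3 U(1) by linarith
  have "\<exists>g. exec X flip_loop (s1, m1) = map_spmf g (spmf_of_set {..<2 ^ k}) \<and>
    (\<forall>a<2 ^ k. agree {''A'', ''b'', ''c''} s1 (fst (g a)) \<and> fst (g a) ''A'' = s1 ''A'' * 2 ^ k + a \<and>
       bounded_on X l (fst (g a)) \<and> snd (g a) \<le> space_bound X M l)"
    by (rule exec_flip_loop[OF progs(2) finX progs(5) U2(2)]) (use v1 v1' k1 k2 k4 U2 s1 in auto)
  then obtain g where g: "exec X flip_loop (s1, m1) = map_spmf g (spmf_of_set {..<2 ^ k})"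
    "\<And>a. a < 2 ^ k \<Longrightarrow> agree {''A'', ''b'', ''c''} s1 (fst (g a)) \<and> fst (g a) ''A'' = a \<and>
       bounded_on X l (fst (g a)) \<and> snd (g a) \<le> space_bound X M l" using v1' by auto
  have init: "exec X (init_prog alg) (start_config alg n) = map_spmf g (spmf_of_set {..<2 ^ k})"
    using m0(2) s1(1) g(1) by (simp add: start_config_def set_reg_def alg sketch_alg_def X_def s0_def)
  have inv0: "stream_inv alg l a {} (g a)" if a: "a < 2 ^ k" for a
  proof -
    have ag: "agree {''A'', ''b'', ''c''} s1 (fst (g a))" using g(2)[OF a] by blast
    show ?thesis using g(2)[OF a] v1 v1'
      by (simp add: stream_inv_def graph_on_def par_def agreeD[OF ag] state_def edge_ids_def induced_edges_def X_def M_def alg_space_def)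
  qed
  have "\<exists>z. bind_spmf (process_stream alg us (g a)) (exec X (output_prog alg)) = return_spmf z \<and> graph_on n E \<and>
      peak_space z \<le> alg_space alg l \<and>
      (good E a \<longrightarrow>
        max_density n E / 2 \<le> answer z \<and> answer z \<le> max_density n E)" if a: "a < 2 ^ k" for a
  proof -
    from process_stream_inv[OF alg U2 inv0[OF a] us] obtain z where
      z: "process_stream alg us (g a) = return_spmf z" "stream_inv alg l a E z"
      unfolding E final_graph_def by blast
    have inv: "graph_on n E" "par a (fst z)" "fst z ''S'' = state a E" "fst z ''m'' = card E" "bounded_on X l (fst z)"
      "snd z \<le> space_bound X M l"
      using z(2) by (simp_all add: stream_inv_def X_def M_def alg_space_def)
    have "card E + 1 \<le> n ^ 2" using card_graph_less[OF inv(1)] n by simp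
    then have "8 * (card E + 1) \<le> 8 * n ^ 2" by (rule mult_le_mono2)
    then have "8 * (card E + 1) \<le> q" using q8 by (rule le_trans)
    from wp_output_com[OF inv(2,1,3,4) this qG, unfolded U2(1)]
    have "\<exists>s' m'. exec X output_com (fst z, snd z) = return_spmf (s', m') \<and> m' \<le> space_bound X M l \<and> bounded_on X l s' \<and>
      (good E a \<longrightarrow>
     max_density n E / 2 \<le> real (s' ''num'') / real (s' ''den'') \<and>
     real (s' ''num'') / real (s' ''den'') \<le> max_density n E)"
      by (rule exec_wp[OF _ sketch_com_ok(3) progs(3,6) inv(5) finX U2(2) inv(6)])
    then show ?thesis using z(1) inv(1)
      by (auto simp: alg sketch_alg_def peak_space_def answer_def alg_space_def X_def M_def)
  qed
  then obtain h where h: "\<And>a. a < 2 ^ k \<Longrightarrow> bind_spmf (process_stream alg us (g a)) (exec X (output_prog alg)) = return_spmf (h a) \<and>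
      graph_on n E \<and> peak_space (h a) \<le> alg_space alg l \<and>
      (good E a \<longrightarrow>
        max_density n E / 2 \<le> answer (h a) \<and> answer (h a) \<le> max_density n E)" by metis
  have "run alg n us = bind_spmf (spmf_of_set {..<2 ^ k}) (\<lambda>a. bind_spmf (process_stream alg us (g a)) (exec X (output_prog alg)))"
    unfolding run_def X_def[symmetric] init by (simp add: bind_map_spmf o_def)
  also have "\<dots> = bind_spmf (spmf_of_set {..<2 ^ k}) (\<lambda>a. return_spmf (h a))"
    by (rule bind_spmf_cong[OF refl]) (use h in auto)
  finally have "run alg n us = map_spmf h (spmf_of_set {..<2 ^ k})" by (simp add: map_spmf_conv_bind_spmf)
  moreover have "graph_on n E" using h[of 0] by simp
  ultimately show ?thesis using h k1 k3 by blast
qed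

text \<open>The factor 2 in the failure probability is the price of drawing below a power of two
  instead of below \<open>Q ^ R\<close>; it comes from \<open>card_mod_le\<close>. The space bound
  holds for every seed.\<close>

lemma run_correct:
  assumes alg: "alg = sketch_alg kc rc gc" and U2: "U = 2 ^ l" "0 < l"
    and c: "t = n * (log_ceil n * kc)" "T = 192 * t" "R = rc * log_ceil n" "G = gc * log_ceil n" "q = next_prime (16 * (n * t))"
    and q8: "8 * n ^ 2 \<le> q" and qG: "q < 2 ^ G"
    and k: "4 * real n ^ 2 * (6 / 7) ^ (log_ceil n * kc) \<le> 1"
    and us: "valid_stream n {} us" and d: "d = max_density n (final_graph us)"
  shows "lossless_spmf (run alg n us)" "\<And>z. z \<in> set_spmf (run alg n us) \<Longrightarrow> peak_space z \<le> alg_space alg l"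
    "1 - 2 * (real R * (2 * real n * (6 / 7) ^ (log_ceil n * kc)) + (3 / 4) ^ R) \<le>
       measure (measure_spmf (run alg n us)) {z. d / 2 \<le> answer z \<and> answer z \<le> d}"
proof -
  define E where "E = final_graph us"
  define w where "w = (2::nat) ^ level (card E)"
  define \<theta> where "\<theta> = min (T * w) q"
  define \<beta> where "\<beta> = real R * (2 * real n * (6 / 7) ^ (log_ceil n * kc)) + (3 / 4) ^ R"
  from run_uniform[OF alg U2 c q8 qG us E_def] obtain k g where
    run: "run alg n us = map_spmf g (spmf_of_set {..<2 ^ k})" and k1: "Q ^ R \<le> 2 ^ k" "2 ^ k \<le> 2 * Q ^ R" and E: "graph_on n E"
    and g: "\<And>a. a < 2 ^ k \<Longrightarrow> peak_space (g a) \<le> alg_space alg l \<and> (good_seed n q t w E \<theta> R a \<longrightarrow>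
        max_density n E / 2 \<le> answer (g a) \<and> answer (g a) \<le> max_density n E)"
    unfolding w_def \<theta>_def by blast
  have ne: "{..<(2::nat) ^ k} \<noteq> {}" by (metis lessThan_iff empty_iff pos2 zero_less_power)
  show "lossless_spmf (run alg n us)" unfolding run using ne by simp
  show "peak_space z \<le> alg_space alg l" if "z \<in> set_spmf (run alg n us)" for z
    using that g unfolding run by auto
  have "card E + 1 \<le> n ^ 2" using card_graph_less[OF E] n by simp
  then have "8 * (card E + 1) \<le> 8 * n ^ 2" by (rule mult_le_mono2)
  then have m8: "8 * (card E + 1) \<le> q" using q8 by (rule le_trans)
  have "real (card {A. A < Q ^ R \<and> \<not> good_seed n q t w E \<theta> R A}) \<le> \<beta> * real (Q ^ R)"
    unfolding \<beta>_def
  proof (rule bad_seed_count[OF q t(2) nq n E c(1,2) _ _ _ _ \<theta>_def k])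
    show "0 < log_ceil n * kc" using c(1) t(1) by (cases "log_ceil n * kc") auto
    show "0 < w" by (simp add: w_def)
    show "8 * (card E * w) \<le> q" using level_lower[OF m8] by (simp add: w_def)
    show "q < 16 * ((card E + 1) * w)" using level_upper[of "card E"] by (simp add: w_def)
  qed
  moreover have "card {a. a < 2 ^ k \<and> \<not> good_seed n q t w E \<theta> R (a mod Q ^ R)} \<le> 2 * card {A. A < Q ^ R \<and> \<not> good_seed n q t w E \<theta> R A}"
    by (rule card_mod_le[OF k1(2)])
  then have "real (card {a. a < 2 ^ k \<and> \<not> good_seed n q t w E \<theta> R a}) \<le> real (2 * card {A. A < Q ^ R \<and> \<not> good_seed n q t w E \<theta> R A})"
    unfolding good_seed_mod by (rule of_nat_mono)
  ultimately have "real (card {a. a < 2 ^ k \<and> \<not> good_seed n q t w E \<theta> R a}) \<le> 2 * \<beta> * real (Q ^ R)" by simp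
  also have "\<dots> \<le> 2 * \<beta> * real (2 ^ k)"
    using k1(1) by (intro mult_left_mono of_nat_mono) (auto simp: \<beta>_def)
  finally have bad: "real (card {a. a < 2 ^ k \<and> \<not> good_seed n q t w E \<theta> R a}) \<le> 2 * \<beta> * 2 ^ k" by simp
  let ?S = "{z. d / 2 \<le> answer z \<and> answer z \<le> d}"
  have "{..<2 ^ k} \<subseteq> ({..<2 ^ k} \<inter> g -` ?S) \<union> {a. a < 2 ^ k \<and> \<not> good_seed n q t w E \<theta> R a}"
    using g d E_def by auto
  then have "card {..<(2::nat) ^ k} \<le> card (({..<2 ^ k} \<inter> g -` ?S) \<union> {a. a < 2 ^ k \<and> \<not> good_seed n q t w E \<theta> R a})"
    by (rule card_mono[rotated]) simp
  also have "\<dots> \<le> card ({..<2 ^ k} \<inter> g -` ?S) + card {a. a < 2 ^ k \<and> \<not> good_seed n q t w E \<theta> R a}" by (rule card_Un_le)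
  finally have "real (2 ^ k) \<le> real (card ({..<2 ^ k} \<inter> g -` ?S) + card {a. a < 2 ^ k \<and> \<not> good_seed n q t w E \<theta> R a})"
    unfolding card_lessThan by (rule of_nat_mono)
  then have "(1 - 2 * \<beta>) * 2 ^ k \<le> real (card ({..<2 ^ k} \<inter> g -` ?S))" using bad by (simp add: algebra_simps)
  then have "1 - 2 * \<beta> \<le> real (card ({..<2 ^ k} \<inter> g -` ?S)) / 2 ^ k" by (simp add: pos_le_divide_eq)
  also have "\<dots> = measure (measure_spmf (run alg n us)) ?S"
    unfolding run measure_map_spmf by (simp add: measure_spmf_of_set)
  finally show "1 - 2 * (real R * (2 * real n * (6 / 7) ^ (log_ceil n * kc)) + (3 / 4) ^ R) \<le>
       measure (measure_spmf (run alg n us)) ?S" by (simp add: \<beta>_def)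
qed

end


section \<open>Failure probability and space\<close>

lemma log_ceil_bounds:
  assumes "2 \<le> n"
  shows "log_ceil n \<le> n" "real (log_ceil n) \<le> 2 * log 2 (real n)"
proof -
  have 1: "1 \<le> log 2 (real n)" using assms by (simp add: le_log_iff)
  have "log_ceil n \<le> n \<and> real (log_ceil n) \<le> 2 * log 2 (real n)"
  proof (cases "log_ceil n = 1")
    case True
    show ?thesis unfolding True of_nat_1 using 1 assms by (intro conjI) linarith+
  next
    case False
    then have l: "1 \<le> log_ceil n - 1" "log_ceil n - 1 < log_ceil n" using log_ceil(1)[of n] by auto
    then have p: "2 ^ (log_ceil n - 1) < n" by (rule less_log_ceil)
    have "log_ceil n - 1 < n" using p less_exp[of "log_ceil n - 1"] by linarith
    moreover have "real (log_ceil n - 1) \<le> log 2 (real n)"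
    proof -
      have "real (2 ^ (log_ceil n - 1)) \<le> real n" using p by (intro of_nat_mono) simp
      then have "2 powr real (log_ceil n - 1) \<le> real n" by (simp add: powr_realpow)
      then show ?thesis using assms by (simp add: le_log_iff)
    qed
    moreover have "real (log_ceil n - 1) = real (log_ceil n) - 1" using l by (simp add: of_nat_diff)
    ultimately show ?thesis using 1 by (intro conjI) linarith+
  qed
  then show "log_ceil n \<le> n" "real (log_ceil n) \<le> 2 * log 2 (real n)" by auto
qed

text \<open>Each block of \<open>b\<close> factors gains a factor of 2, and
  \<open>log_ceil n\<close> such blocks gain a factor of \<open>n\<close>.\<close>

lemma power_log_ceil_le:
  fixes x :: real
  assumes "0 \<le> x" "x ^ b \<le> 1 / 2" "2 \<le> n"
  shows "x ^ (log_ceil n * (b * j)) \<le> 1 / real n ^ j"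
proof -
  have "real n \<le> real (2 ^ log_ceil n)" using log_ceil(2)[of n] by (rule of_nat_mono)
  then have n: "real n \<le> 2 ^ log_ceil n" by simp
  have "x ^ (log_ceil n * (b * j)) = (x ^ b) ^ (log_ceil n * j)"
    by (simp add: mult.left_commute flip: power_mult)
  also have "\<dots> \<le> (1 / 2) ^ (log_ceil n * j)" using assms by (intro power_mono) auto
  also have "\<dots> = 1 / (2 ^ log_ceil n) ^ j" by (simp add: power_divide power_mult)
  also have "\<dots> \<le> 1 / real n ^ j" using n assms(3) by (intro divide_left_mono power_mono) auto
  finally show ?thesis .
qed

text \<open>The factors 5 and 3 are exponents at which \<open>6 / 7\<close> and \<open>3 / 4\<close>
  drop below \<open>1 / 2\<close>. The exponent \<open>2 * c + 9 = c + (c + 2) + 5 + 2\<close> pays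
  for the target, for the factor \<open>c + 2\<close> in the number of repetitions, for the constant
  \<open>24 \<le> 2 ^ 5\<close>, and for \<open>n * log_ceil n \<le> n ^ 2\<close>. Each of the two
  error terms receives \<open>1 / (4 * n ^ c)\<close>.\<close>

lemma failure_bound:
  assumes n: "2 \<le> n"
  shows "4 * real n ^ 2 * (6 / 7) ^ (log_ceil n * (5 * (2 * c + 9))) \<le> 1"
    "2 * (real (3 * (c + 2) * log_ceil n) * (2 * real n * (6 / 7) ^ (log_ceil n * (5 * (2 * c + 9)))) +
      (3 / 4) ^ (3 * (c + 2) * log_ceil n)) \<le> 1 / real n ^ c"
proof -
  define N where "N = real n"
  have N: "2 \<le> N" using n by (simp add: N_def)
  define y where "y = (6 / 7 :: real) ^ (log_ceil n * (5 * (2 * c + 9)))"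
  have "(6 / 7 :: real) ^ 5 \<le> 1 / 2" by (simp add: power_divide)
  then have "y \<le> 1 / N ^ (2 * c + 9)" unfolding y_def N_def by (intro power_log_ceil_le n) auto
  then have y: "y * N ^ (2 * c + 9) \<le> 1" using N by (simp add: pos_le_divide_eq)
  have y0: "0 \<le> y" by (simp add: y_def)
  have "2 * c + 9 = c + (c + 2) + 5 + 2" by simp
  then have e: "N ^ (2 * c + 9) = N ^ c * N ^ (c + 2) * N ^ 5 * N ^ 2" by (simp only: power_add)
  have p: "32 \<le> N ^ 5" using power_mono[OF N, of 5] by simp
  have pc: "real (c + 2) \<le> N ^ (c + 2)"
  proof -
    have "real (c + 2) \<le> real (2 ^ (c + 2))" by (intro of_nat_mono less_imp_le less_exp)
    also have "\<dots> \<le> N ^ (c + 2)" using power_mono[OF N, of "c + 2"] by simp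
    finally show ?thesis .
  qed
  have N1: "1 \<le> N" using N by simp
  note p1 = one_le_power[OF N1, of c] one_le_power[OF N1, of "c + 2"]
  have "4 * N ^ 2 * y \<le> 1"
  proof -
    have "1 * 1 * 4 * N ^ 2 \<le> N ^ c * N ^ (c + 2) * N ^ 5 * N ^ 2"
      using p p1 N by (intro mult_mono) auto
    then have "4 * N ^ 2 \<le> N ^ (2 * c + 9)" unfolding e by (simp only: mult_1)
    from mult_right_mono[OF this y0] have "4 * N ^ 2 * y \<le> N ^ (2 * c + 9) * y" .
    then show ?thesis using y by (simp add: mult.commute)
  qed
  then show "4 * real n ^ 2 * (6 / 7) ^ (log_ceil n * (5 * (2 * c + 9))) \<le> 1" by (simp add: N_def y_def)
  have "real (3 * (c + 2) * log_ceil n) * (2 * N * y) \<le> 1 / (4 * N ^ c)"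
  proof -
    have "real (log_ceil n) \<le> N" using log_ceil_bounds(1)[OF n] by (simp add: N_def)
    then have "3 * real (c + 2) * real (log_ceil n) \<le> 3 * real (c + 2) * N" by (rule mult_left_mono) simp
    then have "real (3 * (c + 2) * log_ceil n) \<le> 3 * real (c + 2) * N" by (simp only: of_nat_mult of_nat_numeral)
    then have "real (3 * (c + 2) * log_ceil n) * (2 * N * y) \<le> 3 * real (c + 2) * N * (2 * N * y)"
      by (rule mult_right_mono) (use y0 N in simp)
    then have "real (3 * (c + 2) * log_ceil n) * (2 * N * y) * (4 * N ^ c) \<le> 3 * real (c + 2) * N * (2 * N * y) * (4 * N ^ c)"
      by (rule mult_right_mono) (use N in simp)
    also have "\<dots> = (N ^ c * real (c + 2) * 24 * N ^ 2) * y" by (simp add: power2_eq_square)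
    also have "\<dots> \<le> (N ^ c * N ^ (c + 2) * N ^ 5 * N ^ 2) * y"
      using pc p y0 N by (intro mult_right_mono mult_mono) auto
    also have "\<dots> \<le> 1" unfolding e[symmetric] using y by (simp add: mult.commute)
    finally show ?thesis using N by (simp add: pos_le_divide_eq)
  qed
  moreover have "(3 / 4 :: real) ^ (3 * (c + 2) * log_ceil n) \<le> 1 / (4 * N ^ c)"
  proof -
    have "(3 / 4 :: real) ^ 3 \<le> 1 / 2" by (simp add: power_divide)
    then have "(3 / 4 :: real) ^ (log_ceil n * (3 * (c + 2))) \<le> 1 / N ^ (c + 2)"
      unfolding N_def by (intro power_log_ceil_le n) auto
    also have "\<dots> \<le> 1 / (4 * N ^ c)"
    proof (rule divide_left_mono)
      have "4 \<le> N ^ 2" using power_mono[OF N, of 2] by simp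
      then show "4 * N ^ c \<le> N ^ (c + 2)" using N by (simp add: power_add power2_eq_square)
    qed (use N in auto)
    finally show ?thesis by (simp add: mult.commute)
  qed
  ultimately have "2 * (real (3 * (c + 2) * log_ceil n) * (2 * N * y) + (3 / 4) ^ (3 * (c + 2) * log_ceil n)) \<le>
      2 * (1 / (4 * N ^ c) + 1 / (4 * N ^ c))" by (intro mult_left_mono add_mono) simp_all
  also have "\<dots> = 1 / N ^ c" by simp
  finally show "2 * (real (3 * (c + 2) * log_ceil n) * (2 * real n * (6 / 7) ^ (log_ceil n * (5 * (2 * c + 9)))) +
      (3 / 4) ^ (3 * (c + 2) * log_ceil n)) \<le> 1 / real n ^ c" by (simp add: N_def y_def)
qed

text \<open>The register length \<open>10 * (L * R * G * T) + 1\<close> is dominated by the sketch, which has \<open>R * G * T\<close>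
  cells with \<open>O(L)\<close> bits each.\<close>

lemma sketch_instance:
  assumes n: "2 \<le> n" and c: "0 < kc" "0 < rc"
    and L: "L = log_ceil n" "t = n * (L * kc)" "T = 192 * t" "R = rc * L" "G = (21 + 3 * kc) * L" "q = next_prime (16 * (n * t))"
  shows "sketch n t T R G q (2 ^ (10 * (L * R * G * T) + 1))" "8 * n ^ 2 \<le> q" "q < 2 ^ G"
proof -
  define Z where "Z = L * R * G * T"
  have L1: "1 \<le> L" using log_ceil(1) L by simp
  have t0: "n \<le> t" using L1 c L(2) by simp
  have pos: "0 < t" "0 < T" "0 < R" "0 < G" "t \<le> T" using t0 n L1 c L by auto
  have m2: "2 \<le> 16 * (n * t)" using n pos by (cases "n * t") auto
  note p = next_prime[OF m2, folded L(6)]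
  have nt: "n ^ 2 \<le> n * t" using t0 by (simp add: power2_eq_square)
  show q8: "8 * n ^ 2 \<le> q" using p(2) nt by linarith
  have tq: "t \<le> q"
  proof -
    have "t \<le> n * t" using n by simp
    then show ?thesis using p(2) by linarith
  qed
  have nL: "n \<le> 2 ^ L" using log_ceil(2) L(1) by simp
  \<comment> \<open>Origin of the number of levels: the cube of \<open>16 * (n * t)\<close> has
    exponent \<open>12 + 9 * L + 3 * kc\<close>, at most \<open>(21 + 3 * kc) * L\<close> because
    \<open>L \<ge> 1\<close>.\<close>
  show qG: "q < 2 ^ G"
  proof -
    have "16 * (n * t) = 2 ^ 4 * n * n * L * kc" by (simp add: L)
    also have "\<dots> < 2 ^ 4 * 2 ^ L * 2 ^ L * 2 ^ L * 2 ^ kc"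
    proof (rule mult_le_less_imp_less)
      show "2 ^ 4 * n * n * L \<le> 2 ^ 4 * 2 ^ L * 2 ^ L * 2 ^ L"
        using nL less_exp[of L] by (intro mult_le_mono) auto
      show "0 < 2 ^ 4 * n * n * L" using n L1 by simp
    qed auto
    also have "\<dots> = 2 ^ (4 + 3 * L + kc)" by (simp add: power_add mult_ac power_mult power3_eq_cube)
    finally have "(16 * (n * t)) ^ 3 < (2 ^ (4 + 3 * L + kc)) ^ 3" by (rule power_strict_mono) auto
    also have "\<dots> = 2 ^ ((4 + 3 * L + kc) * 3)" by (simp only: power_mult)
    also have "\<dots> \<le> 2 ^ G"
    proof (rule power_increasing)
      obtain m where "L = Suc m" using L1 by (cases L) auto
      then have "(4 + 3 * L + kc) * 3 \<le> 21 * L + 3 * (kc * L)" by simp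
      then show "(4 + 3 * L + kc) * 3 \<le> G" by (simp add: L(5) algebra_simps)
    qed simp
    finally show ?thesis using p(3) by linarith
  qed
  have Zge: "L \<le> Z" "R \<le> Z" "G \<le> Z" "T \<le> Z" "R * G * T \<le> Z" "G * T * R \<le> Z" "L * R * G * T \<le> Z"
    using pos L1 by (auto simp: Z_def)
  have GtR: "G * t * R \<le> Z"
  proof -
    have "G * t * R \<le> G * T * R" using pos by (intro mult_le_mono) auto
    then show ?thesis using Zge by linarith
  qed
  have tZ: "t \<le> Z" "n \<le> Z" "1 \<le> Z" using Zge pos t0 L1 by linarith+
  have up: "x < 2 ^ (10 * Z + 1)" if "x \<le> 2 ^ y" "y < 10 * Z + 1" for x y :: nat
  proof -
    have "(2::nat) ^ y < 2 ^ (10 * Z + 1)" using that(2) by (rule power_strict_increasing) simp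
    then show ?thesis using that(1) by linarith
  qed
  have le2: "x \<le> 2 ^ x" for x :: nat using less_exp[of x] by linarith
  have "sketch n t T R G q (2 ^ (10 * Z + 1))"
  proof
    show "n ^ 2 \<le> q" using q8 by linarith
    have "(q ^ t) ^ R \<le> (2 ^ G) ^ (t * R)" unfolding power_mult[symmetric]
      using qG power_mono[of q "2 ^ G" "t * R"] by (simp add: power_mult)
    then have "2 * (q ^ t) ^ R \<le> 2 ^ (1 + G * t * R)" by (simp add: power_mult mult.assoc)
    then show "2 * (q ^ t) ^ R < 2 ^ (10 * Z + 1)" by (rule up) (use GtR tZ in linarith)
    \<comment> \<open>The sketch gives the largest requirement, \<open>6 * Z\<close> bits;
      \<open>10 * Z + 1\<close> leaves slack for all others.\<close>
    have "(n ^ 6) ^ (R * G * T) \<le> ((2 ^ L) ^ 6) ^ (R * G * T)" using nL by (intro power_mono) auto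
    also have "\<dots> = 2 ^ (6 * Z)" by (simp add: Z_def mult_ac flip: power_mult)
    finally show "(n ^ 6) ^ (R * G * T) < 2 ^ (10 * Z + 1)" by (rule up) simp
    show "2 ^ G < (2::nat) ^ (10 * Z + 1)" by (rule up[OF order_refl]) (use Zge tZ in linarith)
    have "R * 2 ^ n \<le> 2 ^ (R + n)" using le2[of R] by (simp add: power_add)
    then show "R * 2 ^ n < 2 ^ (10 * Z + 1)" by (rule up) (use Zge tZ in linarith)
    have "n * n \<le> 2 ^ (L + L)" unfolding power_add using nL by (intro mult_le_mono)
    then show "n * n < 2 ^ (10 * Z + 1)" by (rule up) (use Zge tZ in linarith)
    show "R * G * T < 2 ^ (10 * Z + 1)" by (rule up[OF le2]) (use Zge tZ in linarith)
    have "3 * T * q \<le> 2 ^ 2 * 2 ^ T * 2 ^ G" using qG le2[of T] by (intro mult_le_mono) auto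
    then have "3 * T * q \<le> 2 ^ (2 + T + G)" by (simp only: power_add)
    then show "3 * T * q < 2 ^ (10 * Z + 1)" by (rule up) (use Zge tZ in linarith)
    have "4 * n * q \<le> 2 ^ 2 * 2 ^ L * 2 ^ G" using qG nL by (intro mult_le_mono) auto
    then have "4 * n * q \<le> 2 ^ (2 + L + G)" by (simp only: power_add)
    then show "4 * n * q < 2 ^ (10 * Z + 1)" by (rule up) (use Zge tZ in linarith)
    show "t < 2 ^ (10 * Z + 1)" by (rule up[OF le2]) (use tZ in linarith)
  qed (use n p tq pos in auto)
  then show "sketch n t T R G q (2 ^ (10 * (L * R * G * T) + 1))" by (simp only: Z_def)
qed

theorem theorem3p1:
  shows "\<exists>K::real. K > 0 \<and> (\<forall>c::nat. \<exists>(C::real) (a::nat) (b::nat).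
    \<forall>\<epsilon>::real. 0 < \<epsilon> \<and> \<epsilon> < 1 / 2 \<longrightarrow>
      (\<exists>A::stream_alg. \<forall>n::nat. n \<ge> 2 \<longrightarrow>
        (\<forall>us::edge_update list. valid_stream n {} us \<longrightarrow>
          lossless_spmf (run A n us) \<and>
          (\<forall>z \<in> set_spmf (run A n us).
             real (peak_space z) \<le> C * real n * log 2 (real n) ^ a * (1 / \<epsilon>) ^ b) \<and>
          measure (measure_spmf (run A n us))
              {z. is_approximation (2 + K * \<epsilon>) (max_density n (final_graph us)) (answer z)}
            \<ge> 1 - 1 / real n ^ c)))"
proof (rule exI[of _ "1::real"], intro conjI allI)
  fix c :: nat
  define kc rc gc where "kc = 5 * (2 * c + 9)" and "rc = 3 * (c + 2)" and "gc = 21 + 3 * kc"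
  define alg where "alg = sketch_alg kc rc gc"
  define W where "W = card (alg_regs alg) + alg_weight alg"
  \<comment> \<open>The number 11 absorbs the summand 1 in the register length, and
    \<open>16 = 2 ^ 4\<close> comes from \<open>log_ceil n \<le> 2 * log 2 n\<close>. The four
    logarithms stem from the digit length, the repetitions, the levels and the degree of
    independence.\<close>
  define C where "C = real (W * 11 * rc * gc * 192 * kc) * 16"
  have "lossless_spmf (run alg n us) \<and>
      (\<forall>z \<in> set_spmf (run alg n us). real (peak_space z) \<le> C * real n * log 2 (real n) ^ 4 * (1 / \<epsilon>) ^ 0) \<and>
      measure (measure_spmf (run alg n us))
        {z. is_approximation (2 + 1 * \<epsilon>) (max_density n (final_graph us)) (answer z)} \<ge> 1 - 1 / real n ^ c"
    if e: "0 < \<epsilon> \<and> \<epsilon> < 1 / 2" and n: "n \<ge> 2" and us: "valid_stream n {} us" for \<epsilon> :: real and n us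
  proof -
    define L where "L = log_ceil n"
    define t where "t = n * (L * kc)"
    define T where "T = 192 * t"
    define R where "R = rc * L"
    define G where "G = gc * L"
    define q where "q = next_prime (16 * (n * t))"
    define l where "l = 10 * (L * R * G * T) + 1"
    have G': "G = (21 + 3 * kc) * L" by (simp add: G_def gc_def)
    have c0: "0 < kc" "0 < rc" by (auto simp: kc_def rc_def)
    note inst = sketch_instance[OF n c0 L_def t_def T_def R_def G' q_def, folded l_def]
    interpret sketch n t T R G q "2 ^ l" by (rule inst(1))
    have l0: "0 < l" by (simp add: l_def)
    have k: "4 * real n ^ 2 * (6 / 7) ^ (log_ceil n * kc) \<le> 1"
      using failure_bound(1)[OF n, of c] by (simp add: kc_def)
    note run = run_correct[OF alg_def refl l0 t_def[unfolded L_def] T_def R_def[unfolded L_def] G_def[unfolded L_def] q_def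
      inst(2,3) k us refl]
    have space: "real (peak_space z) \<le> C * real n * log 2 (real n) ^ 4 * (1 / \<epsilon>) ^ 0" if "z \<in> set_spmf (run alg n us)" for z
    proof -
      have "1 \<le> L * R * G * T" using pos log_ceil(1)[of n] by (simp add: L_def Suc_le_eq)
      then have "l \<le> 11 * (L * R * G * T)" by (simp add: l_def)
      then have "W * l \<le> W * (11 * (L * R * G * T))" by (rule mult_le_mono2)
      also have "\<dots> = W * 11 * rc * gc * 192 * kc * n * L ^ 4"
        by (simp add: R_def G_def T_def t_def power4_eq_xxxx mult_ac)
      finally have "peak_space z \<le> W * 11 * rc * gc * 192 * kc * n * L ^ 4"
        using run(2)[OF that] by (simp add: alg_space_def space_bound_def W_def)
      then have "real (peak_space z) \<le> real (W * 11 * rc * gc * 192 * kc * n * L ^ 4)" by (rule of_nat_mono)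
      also have "\<dots> = real (W * 11 * rc * gc * 192 * kc) * real n * real L ^ 4" by simp
      also have "\<dots> \<le> real (W * 11 * rc * gc * 192 * kc) * real n * (2 * log 2 (real n)) ^ 4"
        using log_ceil_bounds(2)[OF n] by (intro mult_left_mono power_mono) (auto simp: L_def)
      also have "\<dots> = C * real n * log 2 (real n) ^ 4 * (1 / \<epsilon>) ^ 0"
        by (simp add: C_def power_mult_distrib)
      finally show ?thesis .
    qed
    let ?d = "max_density n (final_graph us)"
    \<comment> \<open>The factor 2 is exact, so the slack \<open>\<epsilon>\<close> only weakens the
      lower bound; this needs that the density is nonnegative.\<close>
    have "?d / (2 + 1 * \<epsilon>) \<le> ?d / 2" using max_density_nonneg[of n] n e by (intro divide_left_mono) auto
    then have sub: "{z. ?d / 2 \<le> answer z \<and> answer z \<le> ?d} \<subseteq> {z. is_approximation (2 + 1 * \<epsilon>) ?d (answer z)}"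
      unfolding is_approximation_def by (intro subsetI CollectI) (metis (mono_tags, lifting) mem_Collect_eq order_trans)
    have "1 - 1 / real n ^ c \<le> measure (measure_spmf (run alg n us)) {z. ?d / 2 \<le> answer z \<and> answer z \<le> ?d}"
      using run(3) failure_bound(2)[OF n, of c] by (simp add: R_def L_def kc_def rc_def)
    also have "\<dots> \<le> measure (measure_spmf (run alg n us)) {z. is_approximation (2 + 1 * \<epsilon>) ?d (answer z)}"
      using sub by (rule measure_spmf.finite_measure_mono) simp
    finally show ?thesis using run(1) space by blast
  qed
  then show "\<exists>(C::real) (a::nat) (b::nat).
    \<forall>\<epsilon>::real. 0 < \<epsilon> \<and> \<epsilon> < 1 / 2 \<longrightarrow>
      (\<exists>A::stream_alg. \<forall>n::nat. n \<ge> 2 \<longrightarrow>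
        (\<forall>us::edge_update list. valid_stream n {} us \<longrightarrow>
          lossless_spmf (run A n us) \<and>
          (\<forall>z \<in> set_spmf (run A n us).
             real (peak_space z) \<le> C * real n * log 2 (real n) ^ a * (1 / \<epsilon>) ^ b) \<and>
          measure (measure_spmf (run A n us))
              {z. is_approximation (2 + 1 * \<epsilon>) (max_density n (final_graph us)) (answer z)}
            \<ge> 1 - 1 / real n ^ c))" by blast
qed simp

end
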